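(* Let $G$ be a locally compact group with a $C^1$-continuous amenable action on a differentiable manifold $X$. Then there exists a $G$-equivariant strong linear lifting $\lambda\colon L^\infty(X)\to \mathscr{L}^\infty(X)$.
   Context: Measure on $X$: the manifold $X$ is endowed with the Lebesgue measure associated to some Riemannian structure on $X$ (the spaces below do not depend on the choice). Function spaces: $\mathscr{L}^\infty(X)$ is the space of (everywhere defined) bounded Lebesgue-measurable functions on $X$ (real or complex), with the sup-norm. $L^\infty(X)$ is the space of classes $[f]$ of such functions $f$, where two functions are identified if they agree locally almost everywhere (i.e. almost everywhere when the measure is $\sigma$-finite). Linear lifting: a positive linear map $\lambda\colon L^\infty(X)\to\mathscr{L}^\infty(X)$ such that $\lambda(\varphi)\in\varphi$ (i.e. $[\lambda(\varphi)]=\varphi$) for all $\varphi\in L^\infty(X)$ and $\lambda([\mathbf 1_X])=\mathbf 1_X$. It is strong if $\lambda([f])=f$ for every (bounded) continuous function $f$ on $X$. Equivariance: $G$ acts on functions and on function classes by $(sf)(x)=f(s^{-1}x)$; $\lambda$ is $G$-equivariant if $\lambda(s\varphi)=s\lambda(\varphi)$ for all $s\in G$ and all $\varphi\in L^\infty(X)$. $C^1$-continuous action: a continuous action of a topological group $G$ on a differentiable manifold $X$ such that each $g\in G$ has a derivative at each $x\in X$ and the derivative depends continuously on $(g,x)\in G\times X$. Amenable action (topological amenability): with $dg$ a left Haar measure on $G$, there is a net $(\mu_i)_{i\in I}$ of non-negative continuous functions on $G\times X$ such that (a) $\int_G\mu_i(g,x)\,dg=1$ for all $i\in I$ and all $x\in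 X$; (b) $\lim_{i\in I}\int_G|\mu_i(sg,sx)-\mu_i(g,x)|\,dg=0$ uniformly for $(s,x)$ in compact subsets of $G\times X$. *)

theory Defs
  imports "HOL-Analysis.Analysis"
begin

section \<open>Haar measure and topological amenability\<close>

text \<open>
  Topological groups are written additively, as in the type class
  \<^class>\<open>topological_group_add\<close>; commutativity is not assumed.
  Over such a type, \<open>s + g\<close> is the product \<open>sg\<close> and \<open>- s\<close> is \<open>s\<inverse>\<close>.
\<close>

definition left_haar_measure :: "'g::{topological_group_add,t2_space} measure \<Rightarrow> bool"
  where "left_haar_measure \<mu> \<longleftrightarrow>
    sets \<mu> = sets borel \<and>
    emeasure \<mu> UNIV \<noteq> 0 \<and>
    (\<forall>K. compact K \<longrightarrow> emeasure \<mu> K < \<infinity>) \<and>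
    (\<forall>A\<in>sets borel. emeasure \<mu> A = (INF U\<in>{U. open U \<and> A \<subseteq> U}. emeasure \<mu> U)) \<and>
    (\<forall>U. open U \<longrightarrow> emeasure \<mu> U = (SUP K\<in>{K. compact K \<and> K \<subseteq> U}. emeasure \<mu> K)) \<and>
    (\<forall>g. \<forall>A\<in>sets borel. emeasure \<mu> ((+) g ` A) = emeasure \<mu> A)"

definition continuous_action ::
    "('g::topological_group_add \<Rightarrow> 'x::topological_space \<Rightarrow> 'x) \<Rightarrow> bool"
  where "continuous_action act \<longleftrightarrow>
    (\<forall>x. act 0 x = x) \<and>
    (\<forall>g h x. act (g + h) x = act g (act h x)) \<and>
    continuous_on UNIV (\<lambda>(g, x). act g x)"

text \<open>
  A net is a family indexed by the type \<open>'i\<close> together with a proper filter on \<open>'i\<close> (for a directed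
  index set, its filter of tails).  As HOL cannot quantify over types inside a formula, the index
  type is a parameter; a hypothesis \<open>amenable_action TYPE('i) haar act\<close> with \<open>'i\<close> an otherwise
  unconstrained type variable expresses that a net over some index set exists.
\<close>

definition amenable_action ::
    "'i itself \<Rightarrow> 'g::{topological_group_add,t2_space} measure \<Rightarrow>
      ('g \<Rightarrow> 'x::topological_space \<Rightarrow> 'x) \<Rightarrow> bool"
  where "amenable_action _ haar act \<longleftrightarrow>
    (\<exists>(F :: 'i filter) (m :: 'i \<Rightarrow> 'g \<times> 'x \<Rightarrow> real).
      F \<noteq> bot \<and>
      (\<forall>i. continuous_on UNIV (m i) \<and> (\<forall>p. 0 \<le> m i p)) \<and>
      (\<forall>i x. has_bochner_integral haar (\<lambda>g. m i (g, x)) 1) \<and>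
      (\<forall>K. compact K \<longrightarrow>
        uniform_limit K
          (\<lambda>i (s, x). LINT g|haar. \<bar>m i (s + g, act s x) - m i (g, x)\<bar>) (\<lambda>_. 0) F))"


section \<open>Differentiable manifolds\<close>

text \<open>
  A chart is a pair of its domain and its coordinate map.  Its values lie in a model space \<open>S\<close>,
  which is \<open>UNIV :: (real^'n) set\<close> for manifolds of dimension \<open>CARD('n)\<close>, and \<open>{0}\<close> for manifolds
  of dimension \<open>0\<close>, a dimension not of the form \<open>CARD('n)\<close>.
\<close>

type_synonym ('x, 'n) chart = "'x set \<times> ('x \<Rightarrow> real^'n)"

definition paracompact_type :: "'x::topological_space itself \<Rightarrow> bool"
  where "paracompact_type _ \<longleftrightarrow>
    (\<forall>\<U> :: 'x set set. (\<forall>U\<in>\<U>. open U) \<and> \<Union>\<U> = UNIV \<longrightarrow>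
      (\<exists>\<V>. (\<forall>V\<in>\<V>. open V \<and> (\<exists>U\<in>\<U>. V \<subseteq> U)) \<and> \<Union>\<V> = UNIV \<and>
        locally_finite_in euclidean \<V>))"

definition C1_on :: "'e::real_normed_vector set \<Rightarrow> 'e set \<Rightarrow> ('e \<Rightarrow> 'e) \<Rightarrow> bool"
  where "C1_on S T f \<longleftrightarrow>
    (\<exists>f' :: 'e \<Rightarrow> 'e \<Rightarrow>\<^sub>L 'e.
      (\<forall>v\<in>T. (f has_derivative blinfun_apply (f' v)) (at v within S)) \<and> continuous_on T f')"

definition C1_atlas :: "(real^'n) set \<Rightarrow> ('x::topological_space, 'n::finite) chart set \<Rightarrow> bool"
  where "C1_atlas S \<A> \<longleftrightarrow>
    (\<Union>(U, \<phi>)\<in>\<A>. U) = UNIV \<and>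
    (\<forall>(U, \<phi>)\<in>\<A>. open U \<and> openin (top_of_set S) (\<phi> ` U) \<and>
      homeomorphism U (\<phi> ` U) \<phi> (inv_into U \<phi>)) \<and>
    (\<forall>(U, \<phi>)\<in>\<A>. \<forall>(V, \<psi>)\<in>\<A>. C1_on S (\<phi> ` (U \<inter> V)) (\<psi> \<circ> inv_into U \<phi>))"

definition differentiable_manifold ::
    "(real^'n) set \<Rightarrow> ('x::t2_space, 'n::finite) chart set \<Rightarrow> bool"
  where "differentiable_manifold S \<A> \<longleftrightarrow>
    (S = UNIV \<or> S = {0}) \<and> paracompact_type TYPE('x) \<and> C1_atlas S \<A>"

text \<open>
  In the charts \<open>(U, \<phi>)\<close> and \<open>(V, \<psi>)\<close>, the derivative of the action at \<open>(g, x)\<close> is that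
  of \<open>\<psi> \<circ> act g \<circ> \<phi>\<inverse>\<close> at \<open>\<phi> x\<close>.
\<close>

definition C1_continuous_action ::
    "(real^'n) set \<Rightarrow> ('x::t2_space, 'n::finite) chart set \<Rightarrow>
      ('g::topological_group_add \<Rightarrow> 'x \<Rightarrow> 'x) \<Rightarrow> bool"
  where "C1_continuous_action S \<A> act \<longleftrightarrow>
    continuous_action act \<and>
    (\<forall>(U, \<phi>)\<in>\<A>. \<forall>(V, \<psi>)\<in>\<A>. \<exists>D :: 'g \<times> 'x \<Rightarrow> (real^'n) \<Rightarrow>\<^sub>L (real^'n).
      (\<forall>g x. x \<in> U \<and> act g x \<in> V \<longrightarrow>
        ((\<psi> \<circ> act g \<circ> inv_into U \<phi>) has_derivative blinfun_apply (D (g, x)))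
          (at (\<phi> x) within S)) \<and>
      continuous_on {(g, x). x \<in> U \<and> act g x \<in> V} D)"


section \<open>Riemannian structures and Lebesgue measure\<close>

text \<open>
  \<open>\<rho> c x\<close> is the Gram matrix, in the chart \<open>c\<close>, of the inner product on the tangent space at \<open>x\<close>.
  On a \<open>C\<^sup>1\<close> manifold the natural regularity of a Riemannian structure is continuity.
\<close>

definition riemannian_structure ::
    "(real^'n) set \<Rightarrow> ('x::topological_space, 'n::finite) chart set \<Rightarrow>
      (('x, 'n) chart \<Rightarrow> 'x \<Rightarrow> real^'n^'n) \<Rightarrow> bool"
  where "riemannian_structure S \<A> \<rho> \<longleftrightarrow>
    (\<forall>(U, \<phi>)\<in>\<A>. continuous_on U (\<rho> (U, \<phi>)) \<and>
      (\<forall>x\<in>U. (\<forall>v\<in>S. \<forall>w\<in>S. v \<bullet> (\<rho> (U, \<phi>) x *v w) = w \<bullet> (\<rho> (U, \<phi>) x *v v)) \<and>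
        (\<forall>v\<in>S. v \<noteq> 0 \<longrightarrow> 0 < v \<bullet> (\<rho> (U, \<phi>) x *v v)))) \<and>
    (\<forall>(U, \<phi>)\<in>\<A>. \<forall>(V, \<psi>)\<in>\<A>. \<forall>x\<in>U \<inter> V. \<forall>D.
      ((\<psi> \<circ> inv_into U \<phi>) has_derivative D) (at (\<phi> x) within S) \<longrightarrow>
      (\<forall>v\<in>S. \<forall>w\<in>S. v \<bullet> (\<rho> (U, \<phi>) x *v w) = D v \<bullet> (\<rho> (V, \<psi>) x *v D w)))"

definition model_measure :: "(real^'n::finite) set \<Rightarrow> (real^'n) measure"
  where "model_measure S = (if S = {0} then count_space {0} else lebesgue)"

definition volume_density :: "(real^'n::finite) set \<Rightarrow> real^'n^'n \<Rightarrow> real"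
  where "volume_density S P = (if S = {0} then 1 else sqrt (det P))"

text \<open>
  The measure of a set contained in a chart domain is given by the usual volume formula.  When the
  manifold is not \<open>\<sigma>\<close>-compact, this leaves open the values on sets that are not covered by
  countably many charts; local null sets do not depend on these values.
\<close>

definition riemannian_lebesgue_measure ::
    "(real^'n) set \<Rightarrow> ('x::topological_space, 'n::finite) chart set \<Rightarrow>
      (('x, 'n) chart \<Rightarrow> 'x \<Rightarrow> real^'n^'n) \<Rightarrow> 'x measure \<Rightarrow> bool"
  where "riemannian_lebesgue_measure S \<A> \<rho> M \<longleftrightarrow>
    space M = UNIV \<and>
    sets M = {E. \<forall>(U, \<phi>)\<in>\<A>. \<phi> ` (E \<inter> U) \<in> sets (model_measure S)} \<and>
    (\<forall>(U, \<phi>)\<in>\<A>. \<forall>E\<in>sets M. E \<subseteq> U \<longrightarrow>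
      emeasure M E =
        (\<integral>\<^sup>+v. ennreal (volume_density S (\<rho> (U, \<phi>) (inv_into U \<phi> v))) * indicator (\<phi> ` E) v
          \<partial>model_measure S))"


section \<open>Bounded measurable functions and linear liftings\<close>

definition bounded_measurable :: "'x measure \<Rightarrow> ('x \<Rightarrow> 'k::real_normed_field) set"
  where "bounded_measurable M = {f. f \<in> borel_measurable M \<and> bounded (range f)}"

definition locally_AE :: "'x::topological_space measure \<Rightarrow> ('x \<Rightarrow> bool) \<Rightarrow> bool"
  where "locally_AE M P \<longleftrightarrow> (\<forall>K. compact K \<longrightarrow> (AE x in M. x \<in> K \<longrightarrow> P x))"

definition locally_AE_eq_rel ::
    "'x::topological_space measure \<Rightarrow> (('x \<Rightarrow> 'k::real_normed_field) \<times> ('x \<Rightarrow> 'k)) set"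
  where "locally_AE_eq_rel M =
    {(f, g). f \<in> bounded_measurable M \<and> g \<in> bounded_measurable M \<and>
      locally_AE M (\<lambda>x. f x = g x)}"

definition Linfty :: "'x::topological_space measure \<Rightarrow> ('x \<Rightarrow> 'k::real_normed_field) set set"
  where "Linfty M = bounded_measurable M // locally_AE_eq_rel M"

definition Linfty_class ::
    "'x::topological_space measure \<Rightarrow> ('x \<Rightarrow> 'k::real_normed_field) \<Rightarrow> ('x \<Rightarrow> 'k) set"
  where "Linfty_class M f = locally_AE_eq_rel M `` {f}"

text \<open>
  The vector space operations and the order of \<open>L\<^sup>\<infinity>\<close> are those induced from representatives.
  Here \<open>'k\<close> is \<open>real\<close> or \<open>complex\<close>, and \<open>\<exists>r\<ge>0. z = of_real r\<close> says that the
  scalar \<open>z\<close> is a non-negative real number.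
\<close>

definition linear_lifting ::
    "'x::topological_space measure \<Rightarrow> (('x \<Rightarrow> 'k::real_normed_field) set \<Rightarrow> ('x \<Rightarrow> 'k)) \<Rightarrow> bool"
  where "linear_lifting M \<Lambda> \<longleftrightarrow>
    (\<forall>\<phi>\<in>Linfty M. \<Lambda> \<phi> \<in> bounded_measurable M \<and> \<Lambda> \<phi> \<in> \<phi>) \<and>
    (\<forall>f\<in>bounded_measurable M. \<forall>g\<in>bounded_measurable M.
      \<Lambda> (Linfty_class M (\<lambda>x. f x + g x)) =
        (\<lambda>x. \<Lambda> (Linfty_class M f) x + \<Lambda> (Linfty_class M g) x)) \<and>
    (\<forall>c. \<forall>f\<in>bounded_measurable M.
      \<Lambda> (Linfty_class M (\<lambda>x. c * f x)) = (\<lambda>x. c * \<Lambda> (Linfty_class M f) x)) \<and>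
    (\<forall>f\<in>bounded_measurable M. locally_AE M (\<lambda>x. \<exists>r\<ge>0. f x = of_real r) \<longrightarrow>
      (\<forall>x. \<exists>r\<ge>0. \<Lambda> (Linfty_class M f) x = of_real r)) \<and>
    \<Lambda> (Linfty_class M (\<lambda>_. 1)) = (\<lambda>_. 1)"

definition strong_lifting ::
    "'x::topological_space measure \<Rightarrow> (('x \<Rightarrow> 'k::real_normed_field) set \<Rightarrow> ('x \<Rightarrow> 'k)) \<Rightarrow> bool"
  where "strong_lifting M \<Lambda> \<longleftrightarrow>
    (\<forall>f. continuous_on UNIV f \<and> bounded (range f) \<longrightarrow> \<Lambda> (Linfty_class M f) = f)"

definition translate :: "('g::group_add \<Rightarrow> 'x \<Rightarrow> 'x) \<Rightarrow> 'g \<Rightarrow> ('x \<Rightarrow> 'k) \<Rightarrow> ('x \<Rightarrow> 'k)"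
  where "translate act s f = (\<lambda>x. f (act (- s) x))"

definition equivariant_lifting ::
    "'x::topological_space measure \<Rightarrow> ('g::group_add \<Rightarrow> 'x \<Rightarrow> 'x) \<Rightarrow>
      (('x \<Rightarrow> 'k::real_normed_field) set \<Rightarrow> ('x \<Rightarrow> 'k)) \<Rightarrow> bool"
  where "equivariant_lifting M act \<Lambda> \<longleftrightarrow>
    (\<forall>s. \<forall>\<phi>\<in>Linfty M. \<Lambda> (translate act s ` \<phi>) = translate act s (\<Lambda> \<phi>))"

end

theory Submission
  imports Defs
begin

text \<open>
  Every \<open>x\<close> and \<open>g\<close> have small neighbourhoods \<open>g B(g\<inverse>x, \<epsilon>)\<close> of \<open>x\<close>, where the ball is taken in a chart
  around \<open>g\<inverse>x\<close>.  Averages of \<open>f\<close> over them depend in an almost equivariant way on \<open>(g, x)\<close>: as the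
  density of a translated measure is continuous, the defect disappears as \<open>\<epsilon> \<rightarrow> 0\<close>.  The lifting
  at \<open>x\<close> integrates the averages against \<open>\<mu>\<^sub>i(g, x) dg\<close> and takes a generalised limit first
  over \<open>\<epsilon> \<rightarrow> 0\<close>, then over \<open>i\<close>.  Since the neighbourhoods shrink regularly to \<open>x\<close>, the averages converge
  to \<open>f x\<close> at every Lebesgue point, hence almost everywhere, and at every point if \<open>f\<close> is continuous.
  Invariance of the Haar measure and the asymptotic invariance of \<open>\<mu>\<^sub>i\<close> give exact equivariance.
\<close>

section \<open>Generalised limits\<close>

text \<open>For small \<epsilon>, translation by s carries the neighbourhood of x attached to
  (s\<inverse>g, x) exactly onto the neighbourhood of s x attached to (g, s x): both come from the
  same ball around g\<inverse>s x. Hence only the densities of the measure in the charts at x and at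
  s x can differ. Near x their ratio is almost constant, and a constant cancels in the quotient that
  defines an average. A neighbourhood of x chosen without regard to g would change its shape under
  translation. The order of the limits is forced. The defect under translation tends to 0 for each
  g, without uniformity in g, so it is removed by dominated convergence against one fixed density.
  The defect that remains is bounded by the invariance defect of that density, uniformly in
  \<epsilon>. Integration over g needs measurability in g, while charts cannot be chosen
  continuously and neither the group nor the manifold is assumed second countable. This is met by a
  Borel choice of charts, together with lower semicontinuity in g of the measures of open
  sections.\<close>

lemma ultrafilter_exists:
  fixes F :: "'a filter"
  assumes "F \<noteq> bot"
  obtains U where "U \<le> F" "U \<noteq> bot" "\<And>P. eventually P U \<or> eventually (\<lambda>x. \<not> P x) U"
proof -
  let ?A = "{G. G \<le> F \<and> G \<noteq> bot}" and ?R = "\<lambda>G H :: 'a filter. H \<le> G"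
  have "\<exists>U\<in>?A. \<forall>G\<in>?A. ?R U G \<longrightarrow> G = U"
  proof (rule predicate_Zorn)
    show "partial_order_on ?A (relation_of ?R ?A)"
      by (rule partial_order_on_relation_ofI) auto
    fix C assume C: "C \<in> Chains (relation_of ?R ?A)"
    show "\<exists>u\<in>?A. \<forall>a\<in>C. u \<le> a"
    proof (cases "C = {}")
      case True
      then show ?thesis using assms by auto
    next
      case False
      have CA: "C \<subseteq> ?A" and tot: "\<And>G H. G \<in> C \<Longrightarrow> H \<in> C \<Longrightarrow> G \<le> H \<or> H \<le> G"
        using C unfolding Chains_def relation_of_def by blast+
      \<comment> \<open>A chain is a filter base: an event of its infimum is already an event of one
        member. No member contains the empty event, so neither does the infimum.\<close>
      have ev: "eventually P (Inf C) \<longleftrightarrow> (\<exists>b\<in>C. eventually P b)" for P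
        by (rule eventually_Inf_base[OF False]) (use tot in \<open>fastforce\<close>)
      have "Inf C \<noteq> bot"
      proof
        assume "Inf C = bot"
        then have "\<exists>b\<in>C. eventually (\<lambda>_. False) b"
          unfolding ev[symmetric] by simp
        then show False using CA by (auto simp: trivial_limit_def)
      qed
      moreover have "Inf C \<le> F"
        using False CA by (auto intro: Inf_lower2)
      ultimately show ?thesis by (auto intro: Inf_lower)
    qed
  qed
  then obtain U where U: "U \<le> F" "U \<noteq> bot" and min: "\<And>G. G \<le> U \<Longrightarrow> G \<noteq> bot \<Longrightarrow> G = U"
    by (metis (mono_tags, lifting) mem_Collect_eq order_trans)
  have "eventually P U \<or> eventually (\<lambda>x. \<not> P x) U" for P
  \<comment> \<open>Minimality decides P: either the refinement of U by P is improper, so the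
    complement of P is an event, or it is U itself.\<close>
  proof (cases "inf U (principal {x. P x}) = bot")
    case True
    then have "eventually (\<lambda>x. \<not> P x) U"
      unfolding trivial_limit_def eventually_inf_principal by simp
    then show ?thesis ..
  next
    case False
    then have eq: "inf U (principal {x. P x}) = U" using min by simp
    have "eventually P (inf U (principal {x. P x}))"
      unfolding eventually_inf_principal by simp
    then show ?thesis using eq by simp
  qed
  with U show thesis using that by blast
qed

text \<open>Compactness of the closed range gives a cluster point of \<open>u\<close> along
  \<open>U\<close>. For an ultrafilter a cluster point is a limit: a neighbourhood that is not
  eventually entered is eventually avoided, which contradicts clustering.\<close>

lemma bounded_convergent_along_ultrafilter:
  fixes u :: "'a \<Rightarrow> real"
  assumes U: "U \<noteq> bot" "\<And>P. eventually P U \<or> eventually (\<lambda>x. \<not> P x) U"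
    and bdd: "bounded (range u)"
  shows "\<exists>l. (u \<longlongrightarrow> l) U"
proof -
  have "compact (closure (range u))" using bdd compact_closure by blast
  moreover have "filtermap u U \<noteq> bot" using U by (simp add: filtermap_bot_iff)
  moreover have "eventually (\<lambda>x. x \<in> closure (range u)) (filtermap u U)"
    unfolding eventually_filtermap using closure_subset[of "range u"] by (auto intro!: always_eventually)
  ultimately obtain l where l: "inf (nhds l) (filtermap u U) \<noteq> bot"
    unfolding compact_filter by blast
  have "eventually (\<lambda>x. u x \<in> S) U" if S: "open S" "l \<in> S" for S
  proof (rule ccontr)
    assume "\<not> ?thesis"
    then have "eventually (\<lambda>x. u x \<notin> S) U" using U(2) by blast
    then have "eventually (\<lambda>y. y \<notin> S) (inf (nhds l) (filtermap u U))"
      by (intro filter_leD[OF inf_le2]) (simp add: eventually_filtermap)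
    moreover have "eventually (\<lambda>y. y \<in> S) (inf (nhds l) (filtermap u U))"
      using S by (intro filter_leD[OF inf_le1] eventually_nhds_in_open)
    ultimately have "eventually (\<lambda>_. False) (inf (nhds l) (filtermap u U))"
      by eventually_elim simp
    with l show False by (simp add: trivial_limit_def)
  qed
  then show ?thesis by (auto simp: tendsto_def)
qed

text \<open>Limits along one ultrafilter finer than \<open>F\<close> exist for all bounded functions
  at once, which makes them additive; cluster points chosen separately for each function would not
  be. For functions without a limit \<open>Lim\<close> is unspecified, hence the boundedness
  conditions. The bound by B allows a second functional to be applied to values of the
  first.\<close>

lemma exists_limit_functional:
  fixes F :: "'a filter"
  assumes "F \<noteq> bot"
  obtains \<Lambda> :: "('a \<Rightarrow> real) \<Rightarrow> real" where
    "\<And>u v. bounded (range u) \<Longrightarrow> bounded (range v) \<Longrightarrow> \<Lambda> (\<lambda>i. u i + v i) = \<Lambda> u + \<Lambda> v"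
    "\<And>c u. bounded (range u) \<Longrightarrow> \<Lambda> (\<lambda>i. c * u i) = c * \<Lambda> u"
    "\<And>u B. (\<And>i. \<bar>u i\<bar> \<le> B) \<Longrightarrow> \<bar>\<Lambda> u\<bar> \<le> B"
    "\<And>u. bounded (range u) \<Longrightarrow> (\<And>i. 0 \<le> u i) \<Longrightarrow> 0 \<le> \<Lambda> u"
    "\<And>u l. (u \<longlongrightarrow> l) F \<Longrightarrow> \<Lambda> u = l"
proof -
  obtain U where U: "U \<le> F" "U \<noteq> bot" "\<And>P. eventually P U \<or> eventually (\<lambda>x. \<not> P x) U"
    by (rule ultrafilter_exists[OF assms]) blast
  define \<Lambda> where "\<Lambda> u = Lim U u" for u :: "'a \<Rightarrow> real"
  have eq: "\<Lambda> u = l" if "(u \<longlongrightarrow> l) U" for u l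
    using that U(2) unfolding \<Lambda>_def by (intro tendsto_Lim) auto
  have lim: "(u \<longlongrightarrow> \<Lambda> u) U" if "bounded (range u)" for u
    using bounded_convergent_along_ultrafilter[OF U(2,3) that] eq by auto
  show thesis
  proof
    show "\<Lambda> (\<lambda>i. u i + v i) = \<Lambda> u + \<Lambda> v" if "bounded (range u)" "bounded (range v)" for u v
      by (intro eq tendsto_add lim that)
    show "\<Lambda> (\<lambda>i. c * u i) = c * \<Lambda> u" if "bounded (range u)" for c u
      by (intro eq tendsto_mult tendsto_const lim that)
    show "\<bar>\<Lambda> u\<bar> \<le> B" if "\<And>i. \<bar>u i\<bar> \<le> B" for u B
    proof -
      have "bounded (range u)" using that by (auto simp: bounded_iff)
      then have "((\<lambda>i. \<bar>u i\<bar>) \<longlongrightarrow> \<bar>\<Lambda> u\<bar>) U" by (intro tendsto_rabs lim)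
      then show ?thesis using U(2) that by (intro tendsto_upperbound) auto
    qed
    show "0 \<le> \<Lambda> u" if "bounded (range u)" "\<And>i. 0 \<le> u i" for u
      using U(2) that by (intro tendsto_lowerbound[OF lim]) auto
    show "\<Lambda> u = l" if "(u \<longlongrightarrow> l) F" for u l
      using that U(1) by (intro eq) (rule tendsto_mono)
  qed
qed

section \<open>Lebesgue points\<close>

lemma bounded_integrable_on_lmeasurable:
  fixes F :: "'a::euclidean_space \<Rightarrow> real"
  assumes "F \<in> borel_measurable lebesgue" "\<And>x. \<bar>F x\<bar> \<le> B" "A \<in> lmeasurable"
  shows "set_integrable lebesgue A F"
  unfolding set_integrable_def
proof (rule Bochner_Integration.integrable_bound)
  show "integrable lebesgue (\<lambda>x. B * indicator A x)"
    using assms(3) by (intro integrable_mult_right) (auto simp: fmeasurable_def)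
  show "(\<lambda>x. indicator A x *\<^sub>R F x) \<in> borel_measurable lebesgue"
    using assms by (intro borel_measurable_scaleR borel_measurable_indicator) (auto simp: fmeasurable_def)
  have "B \<ge> 0" using assms(2) by (meson abs_ge_zero order_trans)
  then show "AE x in lebesgue. norm (indicator A x *\<^sub>R F x) \<le> norm (B * indicator A x)"
    using assms(2) by (auto simp: indicator_def)
qed

text \<open>Let \<nu> be the measure with density \<open>f\<close>. Disjoint balls with \<eta>
  |ball| < \<nu>(ball), selected by Vitali's theorem inside an open set U around S, cover the
  exceptional set up to a null set. As \<open>f\<close> vanishes on S and is at most C, their total
  measure is at most C |U - S| / \<eta>, which outer regularity makes small.\<close>

lemma positive_upper_density_negligible:
  fixes f :: "'a::euclidean_space \<Rightarrow> real"
  assumes f: "f \<in> borel_measurable lebesgue" "\<And>x. 0 \<le> f x" "\<And>x. f x \<le> C"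
    and S: "S \<in> sets lebesgue" "\<And>x. x \<in> S \<Longrightarrow> f x = 0"
    and "0 < \<eta>"
  shows "negligible {x\<in>S. \<forall>d>0. \<exists>r. 0 < r \<and> r < d \<and>
           \<eta> * measure lebesgue (ball x r) < (LINT w:ball x r|lebesgue. f w)}" (is "negligible ?T")
  unfolding negligible_outer_le
proof (intro allI impI)
  fix \<epsilon> :: real assume "0 < \<epsilon>"
  have C0: "0 \<le> C" using f(2,3) by (meson order_trans)
  \<comment> \<open>This choice gives C \<delta> \<le> \<eta> \<epsilon>; the summand 1 avoids a
    vanishing denominator when C = 0.\<close>
  define \<delta> where "\<delta> = \<epsilon> * \<eta> / (C + 1)"
  have "0 < \<delta>" using \<open>0 < \<epsilon>\<close> \<open>0 < \<eta>\<close> C0 by (simp add: \<delta>_def)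
  then obtain U where U: "open U" "S \<subseteq> U" "U - S \<in> lmeasurable" "emeasure lebesgue (U - S) < ennreal \<delta>"
    using sets_lebesgue_outer_open[OF S(1)] by blast
  define K where "K = {(x, r). x \<in> ?T \<and> 0 < r \<and> ball x r \<subseteq> U \<and>
           \<eta> * measure lebesgue (ball x r) < (LINT w:ball x r|lebesgue. f w)}"
  have "\<exists>i. i \<in> K \<and> x \<in> ball (fst i) (snd i) \<and> snd i < d" if x: "x \<in> ?T" and d: "0 < d" for x d
  proof -
    obtain e where "0 < e" "ball x e \<subseteq> U" using U(1,2) x open_contains_ball by blast
    moreover from x obtain r where "0 < r" "r < min d e"
      "\<eta> * measure lebesgue (ball x r) < (LINT w:ball x r|lebesgue. f w)"
      using d \<open>0 < e\<close> by (auto dest!: spec[of _ "min d e"])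
    moreover have "ball x r \<subseteq> ball x e" using \<open>r < min d e\<close> by (intro subset_ball) auto
    ultimately have "(x, r) \<in> K"
      using x unfolding K_def by blast
    then show ?thesis using \<open>0 < r\<close> \<open>r < min d e\<close> by (intro exI[of _ "(x, r)"]) auto
  qed
  then obtain D where D: "countable D" "D \<subseteq> K"
     "pairwise (\<lambda>i j. disjnt (ball (fst i) (snd i)) (ball (fst j) (snd j))) D"
     "negligible (?T - (\<Union>i \<in> D. ball (fst i) (snd i)))"
    using Vitali_covering_theorem_balls[of ?T K fst snd] by blast
  let ?B = "\<lambda>i. ball (fst i) (snd i) :: 'a set"
  let ?\<nu> = "density lebesgue (\<lambda>x. ennreal (f x))"
  have disj: "disjoint_family_on ?B D"
    using D(3) by (auto simp: disjoint_family_on_def pairwise_def disjnt_def)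
  have fm: "(\<lambda>x. ennreal (f x)) \<in> borel_measurable lebesgue"
    using f(1) by measurable
  have le1: "ennreal \<eta> * emeasure lebesgue (?B i) \<le> emeasure ?\<nu> (?B i)" if "i \<in> D" for i
  proof -
    have int: "set_integrable lebesgue (?B i) f"
      by (rule bounded_integrable_on_lmeasurable[where B=C]) (use f C0 in auto)
    have "\<eta> * measure lebesgue (?B i) \<le> (LINT w:?B i|lebesgue. f w)"
      using that D(2) by (auto simp: K_def)
    moreover have "emeasure ?\<nu> (?B i) = ennreal (LINT w:?B i|lebesgue. f w)"
      unfolding set_lebesgue_integral_def
      apply (subst emeasure_density[OF fm])
       apply simp
      apply (subst nn_integral_eq_integral[symmetric])
      using int f(2) by (auto simp: set_integrable_def indicator_def ennreal_mult' intro!: nn_integral_cong)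
    moreover have "emeasure lebesgue (?B i) = ennreal (measure lebesgue (?B i))"
      by (intro emeasure_eq_measure2) (auto simp: lmeasurable_ball)
    ultimately show ?thesis
      using \<open>0 < \<eta>\<close> by (metis ennreal_leI ennreal_mult' less_imp_le)
  qed
  have "ennreal \<eta> * emeasure lebesgue (\<Union>i\<in>D. ?B i) = (\<integral>\<^sup>+i. ennreal \<eta> * emeasure lebesgue (?B i) \<partial>count_space D)"
    using disj D(1) by (subst emeasure_UN_countable) (auto simp: nn_integral_cmult)
  also have "\<dots> \<le> (\<integral>\<^sup>+i. emeasure ?\<nu> (?B i) \<partial>count_space D)"
    using le1 by (intro nn_integral_mono) auto
  also have "\<dots> = emeasure ?\<nu> (\<Union>i\<in>D. ?B i)"
    using disj D(1) by (subst emeasure_UN_countable) auto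
  also have "\<dots> = (\<integral>\<^sup>+x. ennreal (f x) * indicator (\<Union>i\<in>D. ?B i) x \<partial>lebesgue)"
    using D(1) by (intro emeasure_density[OF fm] sets.countable_UN') auto
  \<comment> \<open>The balls lie in U and \<open>f\<close> is 0 on S, so only U - S
    contributes.\<close>
  also have "\<dots> \<le> (\<integral>\<^sup>+x. ennreal C * indicator (U - S) x \<partial>lebesgue)"
  proof (rule nn_integral_mono)
    fix x :: 'a
    have "?B i \<subseteq> U" if "i \<in> D" for i
      using D(2) that unfolding K_def by (metis (mono_tags, lifting) case_prod_beta mem_Collect_eq subsetD)
    then have "(\<Union>i\<in>D. ?B i) \<subseteq> U" by blast
    then show "ennreal (f x) * indicator (\<Union>i\<in>D. ?B i) x \<le> ennreal C * indicator (U - S) x"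
      using f(2)[of x] f(3)[of x] S(2)[of x] unfolding indicator_def
      using subsetD[OF \<open>(\<Union>i\<in>D. ?B i) \<subseteq> U\<close>, of x]
      by (cases "x \<in> (\<Union>i\<in>D. ?B i)"; cases "x \<in> S"; cases "x \<in> U")
         (auto simp: ennreal_leI simp del: UN_iff)
  qed
  also have "\<dots> = ennreal C * emeasure lebesgue (U - S)"
    using U(3) by (intro nn_integral_cmult_indicator) auto
  also have "\<dots> \<le> ennreal C * ennreal \<delta>"
    using U(4) by (intro mult_left_mono) auto
  also have "\<dots> \<le> ennreal (\<eta> * \<epsilon>)"
  proof -
    have "C * \<delta> \<le> \<eta> * \<epsilon>"
      using C0 \<open>0 < \<epsilon>\<close> \<open>0 < \<eta>\<close> by (simp add: \<delta>_def field_simps)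
    then show ?thesis using C0 \<open>0 < \<delta>\<close> by (metis ennreal_leI ennreal_mult')
  qed
  finally have le: "emeasure lebesgue (\<Union>i\<in>D. ?B i) \<le> ennreal \<epsilon>"
    using \<open>0 < \<eta>\<close> \<open>0 < \<epsilon>\<close> by (simp add: ennreal_mult ennreal_mult_le_mult_iff)
  let ?N = "?T - (\<Union>i \<in> D. ?B i)"
  have sets: "(\<Union>i\<in>D. ?B i) \<in> sets lebesgue" using D(1) by (intro sets.countable_UN') auto
  have "(\<Union>i\<in>D. ?B i) \<in> lmeasurable"
    using le sets by (auto simp: fmeasurable_def intro: le_less_trans)
  moreover have "?N \<in> null_sets lebesgue" using D(4) negligible_iff_null_sets by blast
  ultimately have "(\<Union>i\<in>D. ?B i) \<union> ?N \<in> lmeasurable" "measure lebesgue ((\<Union>i\<in>D. ?B i) \<union> ?N) = measure lebesgue (\<Union>i\<in>D. ?B i)"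
    using fmeasurable.Un[OF _ fmeasurableI_null_sets] measure_Un_null_set[OF sets] by blast+
  moreover have "measure lebesgue (\<Union>i\<in>D. ?B i) \<le> \<epsilon>"
    using le \<open>0 < \<epsilon>\<close> by (simp add: measure_def enn2real_leI)
  ultimately show "\<exists>T. ?T \<subseteq> T \<and> T \<in> lmeasurable \<and> measure lebesgue T \<le> \<epsilon>"
    by (intro exI[of _ "(\<Union>i\<in>D. ?B i) \<union> ?N"]) auto
qed

text \<open>Countably many pairs of a rational q and a level 1/(n+1) suffice. On
  \<open>S q n\<close> the function is close to q, and outside a null subset the part of small balls
  off \<open>S q n\<close> contributes little. A point outside all these null sets uses a q close to
  its own value; hence N does not depend on e.\<close>

lemma lebesgue_points:
  fixes F :: "'a::euclidean_space \<Rightarrow> real"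
  assumes F: "F \<in> borel_measurable lebesgue" "\<And>x. \<bar>F x\<bar> \<le> B"
  obtains N where "negligible N"
    "\<And>x e. x \<notin> N \<Longrightarrow> 0 < e \<Longrightarrow> \<exists>d>0. \<forall>r. 0 < r \<and> r < d \<longrightarrow>
       (LINT w:ball x r|lebesgue. \<bar>F w - F x\<bar>) \<le> e * measure lebesgue (ball x r)"
proof -
  define S where "S q n = {x. \<bar>F x - q\<bar> < inverse (Suc n)}" for q :: real and n :: nat
  define f where "f q n x = \<bar>F x - q\<bar> * indicator (- S q n) x" for q n x
  define T where "T q n = {x\<in>S q n. \<forall>d>0. \<exists>r. 0 < r \<and> r < d \<and>
           inverse (Suc n) * measure lebesgue (ball x r) < (LINT w:ball x r|lebesgue. f q n w)}" for q n
  have S_sets: "S q n \<in> sets lebesgue" for q n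
  proof -
    have "(\<lambda>x. \<bar>F x - q\<bar>) \<in> borel_measurable lebesgue" using F(1) by measurable
    then have "{x \<in> space lebesgue. \<bar>F x - q\<bar> < inverse (Suc n)} \<in> sets lebesgue"
      by (intro borel_measurable_less) auto
    then show ?thesis by (simp add: S_def)
  qed
  have f_meas: "f q n \<in> borel_measurable lebesgue" for q n
    unfolding f_def using F(1) S_sets by measurable
  have f_bound: "0 \<le> f q n x" "f q n x \<le> B + \<bar>q\<bar>" for q n x
  proof -
    show "0 \<le> f q n x" by (simp add: f_def)
    show "f q n x \<le> B + \<bar>q\<bar>"
      using F(2)[of x] by (auto simp: f_def indicator_def)
  qed
  have "negligible (T q n)" for q n
    unfolding T_def
    by (rule positive_upper_density_negligible[where C="B + \<bar>q\<bar>"])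
       (simp_all add: f_meas f_bound S_sets, simp add: f_def)
  then have "negligible (\<Union>(q, n)\<in>\<rat> \<times> UNIV. T q n)"
    by (intro negligible_countable_Union countable_image countable_SIGMA countable_rat)
       (auto simp: countable_rat)
  moreover have "\<exists>d>0. \<forall>r. 0 < r \<and> r < d \<longrightarrow>
       (LINT w:ball x r|lebesgue. \<bar>F w - F x\<bar>) \<le> e * measure lebesgue (ball x r)"
    if x: "x \<notin> (\<Union>(q, n)\<in>\<rat> \<times> UNIV. T q n)" and "0 < e" for x e
  proof -
    \<comment> \<open>Three errors of size 1/(n+1) have to fit into e: one from the complement of
      \<open>S q n\<close>, two from replacing F w by q and q by F x.\<close>
    obtain n where n: "inverse (Suc n) < e / 3" using \<open>0 < e\<close> reals_Archimedean[of "e / 3"] by auto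
    obtain q where q: "q \<in> \<rat>" "\<bar>F x - q\<bar> < inverse (Suc n)"
    proof -
      obtain q where "q \<in> \<rat>" "F x - inverse (Suc n) < q" "q < F x + inverse (Suc n)"
        using Rats_dense_in_real[of "F x - inverse (Suc n)" "F x + inverse (Suc n)"] by auto
      then show thesis using that by (auto simp: abs_less_iff)
    qed
    then have "x \<in> S q n" "x \<notin> T q n" using x by (auto simp: S_def)
    then have "\<exists>d>0. \<forall>r. 0 < r \<longrightarrow> r < d \<longrightarrow>
        (LINT w:ball x r|lebesgue. f q n w) \<le> inverse (Suc n) * measure lebesgue (ball x r)"
      unfolding T_def mem_Collect_eq by (meson not_less)
    then obtain d where d: "0 < d" "\<And>r. 0 < r \<Longrightarrow> r < d \<Longrightarrow>
        (LINT w:ball x r|lebesgue. f q n w) \<le> inverse (Suc n) * measure lebesgue (ball x r)"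
      by blast
    have "(LINT w:ball x r|lebesgue. \<bar>F w - F x\<bar>) \<le> e * measure lebesgue (ball x r)"
      if r: "0 < r" "r < d" for r
    proof -
      have B0: "0 \<le> B" using F(2) by (meson abs_ge_zero order_trans)
      have i1: "set_integrable lebesgue (ball x r) (f q n)"
        by (rule bounded_integrable_on_lmeasurable[where B="B + \<bar>q\<bar>"])
           (use f_meas[of q n] f_bound[of q n] in \<open>auto simp: lmeasurable_ball\<close>)
      have i2: "set_integrable lebesgue (ball x r) (\<lambda>w. \<bar>F w - F x\<bar>)"
      proof (rule bounded_integrable_on_lmeasurable[where B="2 * B"])
        show "(\<lambda>w. \<bar>F w - F x\<bar>) \<in> borel_measurable lebesgue" using F(1) by measurable
        show "\<bar>\<bar>F w - F x\<bar>\<bar> \<le> 2 * B" for w using F(2)[of w] F(2)[of x] by auto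
      qed (auto simp: lmeasurable_ball)
      have i3: "set_integrable lebesgue (ball x r) (\<lambda>w. 2 * inverse (Suc n))"
        by (rule bounded_integrable_on_lmeasurable[where B="2 * inverse (Suc n)"])
           (auto simp: lmeasurable_ball)
      have "(LINT w:ball x r|lebesgue. \<bar>F w - F x\<bar>) \<le> (LINT w:ball x r|lebesgue. f q n w + 2 * inverse (Suc n))"
      proof (rule set_integral_mono[OF i2 set_integral_add(1)[OF i1 i3]])
        fix w
        show "\<bar>F w - F x\<bar> \<le> f q n w + 2 * inverse (Suc n)"
          using q(2) by (auto simp: f_def S_def indicator_def)
      qed
      also have "\<dots> = (LINT w:ball x r|lebesgue. f q n w) + 2 * inverse (Suc n) * measure lebesgue (ball x r)"
        using set_integral_add(2)[OF i1 i3] by (simp add: set_lebesgue_integral_def mult.commute)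
      also have "\<dots> \<le> 3 * inverse (Suc n) * measure lebesgue (ball x r)"
        using d(2)[OF r] by simp
      also have "\<dots> \<le> e * measure lebesgue (ball x r)"
        using n by (intro mult_right_mono) auto
      finally show ?thesis .
    qed
    then show ?thesis using d(1) by blast
  qed
  ultimately show thesis using that by blast
qed

section \<open>Change of variables without an order on the index type\<close>

text \<open>
  The change of variables formula of the library needs a well-ordered index type.
\<close>

typedef 'a wellordered = "UNIV :: 'a set" morphisms from_wo to_wo ..

lemma to_wo_from_wo [simp]: "to_wo (from_wo i) = i" "from_wo (to_wo j) = j"
  by (simp_all add: from_wo_inverse to_wo_inverse)

instance wellordered :: (finite) finite
proof
  have "(UNIV :: 'a wellordered set) = range to_wo"
    using surjI[of to_wo from_wo, OF to_wo_from_wo(1)] by (rule sym)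
  moreover have "finite (range (to_wo :: 'a \<Rightarrow> _))" by simp
  ultimately show "finite (UNIV :: 'a wellordered set)" by argo
qed

instantiation wellordered :: (finite) wellorder
begin

text \<open>Any injection into the naturals serves: the order only has to satisfy the class
  constraint and has no geometric meaning.\<close>

definition wo_index :: "'a wellordered \<Rightarrow> nat" where "wo_index = (SOME f. inj f)"
definition less_eq_wellordered :: "'a wellordered \<Rightarrow> 'a wellordered \<Rightarrow> bool"
  where "less_eq_wellordered x y \<longleftrightarrow> wo_index x \<le> wo_index y"
definition less_wellordered :: "'a wellordered \<Rightarrow> 'a wellordered \<Rightarrow> bool"
  where "less_wellordered x y \<longleftrightarrow> wo_index x < wo_index y"

lemma inj_wo_index: "inj (wo_index :: 'a wellordered \<Rightarrow> nat)"
proof -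
  have "\<exists>f :: 'a wellordered \<Rightarrow> nat. inj f"
    using finite_imp_inj_to_nat_seg[of "UNIV :: 'a wellordered set"] by auto
  then show ?thesis unfolding wo_index_def by (rule someI_ex)
qed

instance
proof
  fix x y :: "'a wellordered"
  show "x \<le> y \<Longrightarrow> y \<le> x \<Longrightarrow> x = y"
    using inj_wo_index by (auto simp: less_eq_wellordered_def inj_def)
next
  fix P :: "'a wellordered \<Rightarrow> bool" and a :: "'a wellordered"
  assume step: "\<And>x. (\<And>y. y < x \<Longrightarrow> P y) \<Longrightarrow> P x"
  show "P a"
  proof (induction "wo_index a" arbitrary: a rule: less_induct)
    case less
    show ?case
      by (rule step, rule less) (simp add: less_wellordered_def)
  qed
qed (auto simp: less_eq_wellordered_def less_wellordered_def)

end

section \<open>Relabelling of coordinates preserves Lebesgue measure\<close>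

definition reindex :: "real^'n \<Rightarrow> real^('n::finite wellordered)"
  where "reindex v = (\<chi> i. v $ from_wo i)"

definition unindex :: "real^('n::finite wellordered) \<Rightarrow> real^'n"
  where "unindex w = (\<chi> i. w $ to_wo i)"

lemma reindex_unindex [simp]: "reindex (unindex w) = w" "unindex (reindex v) = v"
  by (simp_all add: reindex_def unindex_def vec_eq_iff)

lemma linear_reindex: "linear reindex" and linear_unindex: "linear unindex"
  by (auto simp: linear_iff reindex_def unindex_def vec_eq_iff)

lemma all_wellordered: "(\<forall>i. P i) \<longleftrightarrow> (\<forall>j. P (to_wo j))"
proof (intro iffI allI)
  fix i assume "\<forall>j. P (to_wo j)"
  then have "P (to_wo (from_wo i))" ..
  then show "P i" by simp
qed simp

lemma mem_reindex_image: "w \<in> reindex ` A \<longleftrightarrow> unindex w \<in> A"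
  using image_eqI[of w reindex "unindex w" A] by auto

lemma bij_to_wo: "bij to_wo"
  by (rule o_bij[where g=from_wo]) (auto simp: fun_eq_iff)

lemma card_wellordered [simp]: "CARD('n::finite wellordered) = CARD('n)"
  by (rule bij_betw_same_card[OF bij_to_wo, symmetric])

lemma reindex_mem_box: "reindex v \<in> box l u \<longleftrightarrow> v \<in> box (unindex l) (unindex u)"
  unfolding mem_box_cart reindex_def unindex_def by (simp add: all_wellordered)

text \<open>Boxes go to boxes with permuted side lengths, hence with the same volume, and the
  volumes of boxes determine \<open>lborel\<close>.\<close>

lemma lborel_distr_reindex: "distr lborel borel (reindex :: real^'n \<Rightarrow> _) = lborel"
proof (rule lborel_eqI[symmetric])
  fix l u :: "real^('n::finite wellordered)"
  assume le: "\<And>b. b \<in> Basis \<Longrightarrow> l \<bullet> b \<le> u \<bullet> b"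
  have le': "l $ i \<le> u $ i" for i
    using le[of "axis i 1"] by (simp add: inner_axis axis_in_Basis_iff)
  have meas: "reindex \<in> borel_measurable (borel :: (real^'n) measure)"
    by (intro borel_measurable_continuous_onI linear_continuous_on)
       (use linear_reindex linear_conv_bounded_linear in blast)
  have basis: "(\<Prod>b\<in>Basis. v \<bullet> b) = (\<Prod>i\<in>UNIV. v $ i)" for v :: "real^'k::finite"
    by (simp add: Basis_vec_def cart_eq_inner_axis axis_eq_axis prod.UNION_disjoint)
  have "emeasure (distr lborel borel reindex) (box l u)
      = emeasure lborel (box (unindex l) (unindex u) :: (real^'n) set)"
    using meas by (subst emeasure_distr) (auto simp: vimage_def reindex_mem_box)
  also have "\<dots> = ennreal (\<Prod>b\<in>Basis. (unindex u - unindex l :: real^'n) \<bullet> b)"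
    unfolding emeasure_lborel_box_eq
    using le' by (auto simp: Basis_vec_def cart_eq_inner_axis[symmetric] inner_axis unindex_def)
  also have "(\<Prod>b\<in>Basis. (unindex u - unindex l :: real^'n) \<bullet> b) = (\<Prod>i\<in>UNIV. (u - l) $ to_wo i)"
    unfolding basis by (simp add: unindex_def)
  also have "\<dots> = (\<Prod>b\<in>Basis. (u - l) \<bullet> b)"
    unfolding basis using prod.reindex_bij_betw[OF bij_to_wo, of "\<lambda>i. (u - l) $ i"] by simp
  finally show "emeasure (distr lborel borel reindex) (box l u) = ennreal (\<Prod>b\<in>Basis. (u - l) \<bullet> b)" .
qed simp

lemma reindex_measurable: "reindex \<in> lebesgue \<rightarrow>\<^sub>M (borel :: (real^('n::finite wellordered)) measure)"
  by (intro measurable_completion) (simp add: borel_measurable_continuous_onI linear_continuous_on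
      linear_conv_bounded_linear[symmetric] linear_reindex)

lemma lebesgue_distr_reindex: "distr lebesgue lebesgue (reindex :: real^'n::finite \<Rightarrow> _) = lebesgue"
proof -
  have r: "reindex \<in> (lborel :: (real^'n) measure) \<rightarrow>\<^sub>M lborel"
    by (simp add: borel_measurable_continuous_onI linear_continuous_on
      linear_conv_bounded_linear[symmetric] linear_reindex)
  have eq: "distr lebesgue lborel (reindex :: real^'n \<Rightarrow> _) = lborel"
    using lborel_distr_reindex distr_completion[OF r] by (simp cong: distr_cong)
  have "completion (distr lebesgue lborel (reindex :: real^'n \<Rightarrow> _)) = distr lebesgue (completion lborel) reindex"
    by (rule completion.completion_distr_eq) (use reindex_measurable eq in \<open>auto simp: measurable_lborel1\<close>)
  then show ?thesis using eq by simp
qed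

text \<open>Borel measurability does not suffice for completed sigma-algebras. The preimage is the
  image under the linear map \<open>unindex\<close>, and differentiable maps between spaces of equal
  dimension send Lebesgue sets to Lebesgue sets.\<close>

lemma reindex_lebesgue_measurable: "reindex \<in> lebesgue \<rightarrow>\<^sub>M (lebesgue :: (real^('n::finite wellordered)) measure)"
proof (rule measurableI)
  fix E :: "(real^('n wellordered)) set" assume "E \<in> sets lebesgue"
  then have "unindex ` E \<in> sets lebesgue"
    by (intro differentiable_image_in_sets_lebesgue linear_imp_differentiable_on linear_unindex) auto
  moreover have "reindex -` E = unindex ` E"
    by (auto simp: image_iff intro!: bexI[of _ "reindex _"])
  ultimately show "reindex -` E \<inter> space lebesgue \<in> sets lebesgue" by simp
qed auto

lemma unindex_lebesgue_measurable: "unindex \<in> lebesgue \<rightarrow>\<^sub>M (lebesgue :: (real^'n::finite) measure)"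
proof (rule measurableI)
  fix E :: "(real^'n) set" assume "E \<in> sets lebesgue"
  then have "reindex ` E \<in> sets lebesgue"
    by (intro differentiable_image_in_sets_lebesgue linear_imp_differentiable_on linear_reindex) auto
  moreover have "unindex -` E = reindex ` E"
    by (auto simp: mem_reindex_image)
  ultimately show "unindex -` E \<inter> space lebesgue \<in> sets lebesgue" by simp
qed auto

lemma lmeasurable_reindex_image:
  fixes A :: "(real^'n::finite) set"
  assumes "A \<in> lmeasurable"
  shows "reindex ` A \<in> lmeasurable" "measure lebesgue (reindex ` A) = measure lebesgue A"
proof -
  have vim: "reindex -` (reindex ` A) = A" "reindex ` A = unindex -` A"
    by (simp_all add: set_eq_iff mem_reindex_image)
  have s: "reindex ` A \<in> sets lebesgue"
    unfolding vim(2) using measurable_sets[OF unindex_lebesgue_measurable, of A] assms by auto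
  have "emeasure lebesgue (reindex ` A) = emeasure (distr lebesgue lebesgue reindex) (reindex ` A)"
    by (simp add: lebesgue_distr_reindex)
  also have "\<dots> = emeasure lebesgue A"
    using s by (subst emeasure_distr[OF reindex_lebesgue_measurable]) (auto simp: vim(1))
  finally have e: "emeasure lebesgue (reindex ` A) = emeasure lebesgue A" .
  with s assms show "reindex ` A \<in> lmeasurable" by (auto simp: fmeasurable_def)
  show "measure lebesgue (reindex ` A) = measure lebesgue A" using e by (simp add: measure_def)
qed

text \<open>This is applied to the function \<open>H\<close> of \<open>jacobian_on\<close>, about
  whose measurability nothing is assumed. A non-measurable integrand gives the default value 0 on
  both sides.\<close>

lemma set_integral_reindex:
  fixes F :: "real^'n::finite \<Rightarrow> real" and A :: "(real^'n) set"
  shows "(LINT w:reindex ` A|lebesgue. F (unindex w)) = (LINT w:A|lebesgue. F w)"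
proof -
  show ?thesis
  proof (cases "(\<lambda>w. indicator A w *\<^sub>R F w) \<in> borel_measurable lebesgue")
    case True
    let ?h = "\<lambda>w. indicator (reindex ` A) w *\<^sub>R F (unindex w)"
    have "?h = (\<lambda>w. indicator A w *\<^sub>R F w) \<circ> unindex"
      by (simp add: indicator_def fun_eq_iff mem_reindex_image)
    then have h: "?h \<in> borel_measurable lebesgue"
      using measurable_comp[OF unindex_lebesgue_measurable True] by simp
    have "(LINT w|lebesgue. ?h w) = (LINT w|distr lebesgue lebesgue reindex. ?h w)"
      by (simp add: lebesgue_distr_reindex)
    also have "\<dots> = (LINT w|lebesgue. ?h (reindex w))"
      by (rule integral_distr[OF reindex_lebesgue_measurable h])
    finally show ?thesis by (simp add: set_lebesgue_integral_def indicator_def mem_reindex_image)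
  next
    case False
    let ?h = "\<lambda>w. indicator (reindex ` A) w *\<^sub>R F (unindex w)"
    have "?h \<notin> borel_measurable lebesgue"
    proof
      assume "?h \<in> borel_measurable lebesgue"
      from measurable_comp[OF reindex_lebesgue_measurable this]
      have "(\<lambda>w. indicator A w *\<^sub>R F w) \<in> borel_measurable lebesgue"
        by (simp add: o_def indicator_def mem_reindex_image)
      with False show False by simp
    qed
    with False show ?thesis
      unfolding set_lebesgue_integral_def
      by (subst (1 2) not_integrable_integral_eq) (auto dest: borel_measurable_integrable)
  qed
qed

text \<open>Transport by \<open>T\<close> multiplies integrals by about J, uniformly over the
  subsets A of U. The integrand appears twice, as F before and as H after transport, related only on
  A: in the application both are functions on a manifold, read in two charts and extended by 0, and
  need not correspond elsewhere. The choice F = H = 1 compares measures.\<close>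

definition jacobian_on :: "('a::euclidean_space \<Rightarrow> 'a) \<Rightarrow> real \<Rightarrow> real \<Rightarrow> 'a set \<Rightarrow> bool"
  where "jacobian_on T J \<eta> U \<longleftrightarrow> (\<forall>A F H B. A \<in> lmeasurable \<longrightarrow> A \<subseteq> U \<longrightarrow>
    F \<in> borel_measurable lebesgue \<longrightarrow> (\<forall>w. \<bar>F w\<bar> \<le> B) \<longrightarrow> (\<forall>w\<in>A. H (T w) = F w) \<longrightarrow>
    T ` A \<in> lmeasurable \<and>
    \<bar>(LINT w:T ` A|lebesgue. H w) - J * (LINT w:A|lebesgue. F w)\<bar> \<le> \<eta> * B * measure lebesgue A)"

text \<open>J plays the part of |det T'(p)|, expressed through integrals. As no matrix occurs, the
  notion passes between index types, and it is just what quotients of integrals over small sets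
  require.\<close>

definition local_jacobian :: "('a::euclidean_space \<Rightarrow> 'a) \<Rightarrow> 'a \<Rightarrow> real \<Rightarrow> bool"
  where "local_jacobian T p J \<longleftrightarrow> (\<forall>\<eta>>0. \<exists>\<delta>>0. jacobian_on T J \<eta> (ball p \<delta>))"

lemma jacobian_onI:
  assumes "\<And>A F H B. A \<in> lmeasurable \<Longrightarrow> A \<subseteq> U \<Longrightarrow> F \<in> borel_measurable lebesgue \<Longrightarrow>
    (\<And>w. \<bar>F w\<bar> \<le> B) \<Longrightarrow> (\<And>w. w \<in> A \<Longrightarrow> H (T w) = F w) \<Longrightarrow> T ` A \<in> lmeasurable \<and>
    \<bar>(LINT w:T ` A|lebesgue. H w) - J * (LINT w:A|lebesgue. F w)\<bar> \<le> \<eta> * B * measure lebesgue A"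
  shows "jacobian_on T J \<eta> U"
  unfolding jacobian_on_def by (intro allI impI, rule assms) blast+

lemma jacobian_onD:
  assumes "jacobian_on T J \<eta> U" "A \<in> lmeasurable" "A \<subseteq> U" "F \<in> borel_measurable lebesgue"
    "\<And>w. \<bar>F w\<bar> \<le> B" "\<And>w. w \<in> A \<Longrightarrow> H (T w) = F w"
  shows "T ` A \<in> lmeasurable \<and>
    \<bar>(LINT w:T ` A|lebesgue. H w) - J * (LINT w:A|lebesgue. F w)\<bar> \<le> \<eta> * B * measure lebesgue A"
  using assms(1)[unfolded jacobian_on_def, rule_format, OF assms(2-6)] .

text \<open>Take J = |det T'(x0)|, positive since the derivative at x0 is injective. By continuity
  |det T'| differs from J by less than \<eta> on a ball, and there the change of variables formula
  leaves an error of at most \<eta> B |A|.\<close>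

lemma local_change_of_variables_wellorder:
  fixes T :: "real^'n::{finite,wellorder} \<Rightarrow> real^'n::_"
    and T' :: "real^'n::_ \<Rightarrow> (real^'n::_) \<Rightarrow>\<^sub>L (real^'n::_)"
  assumes W: "open W" "x0 \<in> W"
    and der: "\<And>w. w \<in> W \<Longrightarrow> (T has_derivative blinfun_apply (T' w)) (at w)"
    and cont: "continuous_on W T'"
    and inj: "inj_on T W"
    and nondeg: "inj (blinfun_apply (T' x0))"
  shows "\<exists>J>0. local_jacobian T x0 J"
proof -
  define j where "j w = \<bar>det (matrix (blinfun_apply (T' w)))\<bar>" for w
  have cj: "continuous_on W j"
    unfolding j_def matrix_def det_def
    by (intro continuous_intros cont)
  have J: "0 < j x0"
    using det_nz_iff_inj[OF blinfun.bounded_linear_right[of "T' x0", THEN bounded_linear.linear]] nondeg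
    by (simp add: j_def)
  have "local_jacobian T x0 (j x0)"
    unfolding local_jacobian_def
  proof (intro allI impI)
    fix \<eta> :: real assume "0 < \<eta>"
    obtain \<delta> where \<delta>: "0 < \<delta>" "ball x0 \<delta> \<subseteq> W" "\<And>w. w \<in> ball x0 \<delta> \<Longrightarrow> \<bar>j w - j x0\<bar> < \<eta>"
    proof -
      obtain d1 where "0 < d1" "ball x0 d1 \<subseteq> W" using W open_contains_ball by blast
      moreover obtain d2 where "0 < d2" "\<And>w. w \<in> W \<Longrightarrow> dist w x0 < d2 \<Longrightarrow> dist (j w) (j x0) < \<eta>"
        using cj \<open>0 < \<eta>\<close> W(2) unfolding continuous_on_iff by blast
      ultimately show thesis
        by (intro that[of "min d1 d2"]) (auto simp: dist_commute dist_real_def subset_iff)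
    qed
    have key: "T ` A \<in> lmeasurable \<and>
        \<bar>(LINT w:T ` A|lebesgue. H w) - j x0 * (LINT w:A|lebesgue. F w)\<bar> \<le> \<eta> * B * measure lebesgue A"
      if A: "A \<in> lmeasurable" "A \<subseteq> ball x0 \<delta> \<inter> W" and F: "F \<in> borel_measurable lebesgue" "\<And>w. \<bar>F w\<bar> \<le> B"
        and H: "\<And>w. w \<in> A \<Longrightarrow> H (T w) = F w" for A F H B
    proof -
      \<comment> \<open>Cut off outside the ball, the density is measurable and bounded on the whole
        space, whereas \<open>j\<close> is controlled only near x0.\<close>
      define k where "k w = indicator (ball x0 \<delta>) w *\<^sub>R j w" for w
      have k_meas: "k \<in> borel_measurable lebesgue"
      proof (rule measurable_completion)
        have "k \<in> borel_measurable borel"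
          unfolding k_def
          by (intro borel_measurable_continuous_on_indicator continuous_on_subset[OF cj \<delta>(2)]) simp
        then show "k \<in> borel_measurable lborel" by simp
      qed
      have kj: "k w = j w" if "w \<in> A" for w
        using that A(2) by (auto simp: k_def)
      have j0: "0 \<le> j w" for w by (simp add: j_def)
      have k_bound: "\<bar>k w\<bar> \<le> j x0 + \<eta>" for w
        using \<delta>(3)[of w] j0[of w] j0[of x0] \<open>0 < \<eta>\<close> by (auto simp: k_def indicator_def abs_less_iff)
      have B0: "0 \<le> B" using F(2) by (meson abs_ge_zero order_trans)
      have kF: "set_integrable lebesgue A (\<lambda>w. k w * F w)"
        by (rule bounded_integrable_on_lmeasurable[where B="(j x0 + \<eta>) * B", OF _ _ A(1)])
           (use k_meas F(1) k_bound F(2) j0[of x0] \<open>0 < \<eta>\<close> in \<open>auto simp: abs_mult intro!: mult_mono\<close>)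
      have jA: "set_integrable lebesgue A j"
      proof -
        have "set_integrable lebesgue A k"
          by (rule bounded_integrable_on_lmeasurable[OF k_meas k_bound A(1)])
        then show ?thesis
          by (rule set_integrable_cong[THEN iffD1, rotated -1]) (auto simp: kj)
      qed
      have jF: "set_integrable lebesgue A (\<lambda>w. j w * F w)"
        using kF by (rule set_integrable_cong[THEN iffD1, rotated -1]) (auto simp: kj)
      have FA: "set_integrable lebesgue A F"
        by (rule bounded_integrable_on_lmeasurable[OF F A(1)])
      have A_sets: "A \<in> sets lebesgue" using A(1) by auto
      have derA: "(T has_derivative blinfun_apply (T' w)) (at w within A)" if "w \<in> A" for w
        using der A(2) that by (blast intro: has_derivative_at_withinI)
      have injA: "inj_on T A" using inj A(2) by (meson inj_on_subset le_inf_iff)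
      have TA: "T ` A \<in> lmeasurable"
        using measurable_differentiable_image_alt[OF A_sets derA injA] jA by (simp add: j_def[abs_def])
      have jH: "set_integrable lebesgue A (\<lambda>w. j w * H (T w))"
        using jF by (rule set_integrable_cong[THEN iffD1, rotated -1]) (auto simp: H)
      \<comment> \<open>The change of variables formula is stated for vector values, so scalars pass
        through \<open>real^1\<close>.\<close>
      let ?h = "\<lambda>w. vec (H w) :: real^1"
      have "?h absolutely_integrable_on (T ` A) \<and> integral (T ` A) ?h = vec (integral A (\<lambda>w. j w * H (T w)))"
        using has_absolute_integral_change_of_variables[OF A_sets derA injA, where f="?h" and b="vec (integral A (\<lambda>w. j w * H (T w)))"] jH
        by (simp add: absolutely_integrable_on_1_iff integral_on_1_eq j_def[abs_def])
      then have HT: "set_integrable lebesgue (T ` A) H" and HT': "integral (T ` A) H = integral A (\<lambda>w. j w * H (T w))"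
        by (simp_all add: absolutely_integrable_on_1_iff integral_on_1_eq vec_eq_iff)
      have "(LINT w:T ` A|lebesgue. H w) = (LINT w:A|lebesgue. j w * H (T w))"
        using HT HT' jH by (simp add: set_lebesgue_integral_eq_integral)
      also have "\<dots> = (LINT w:A|lebesgue. k w * F w)"
        by (rule set_lebesgue_integral_cong[OF A_sets]) (simp add: kj H)
      finally have "(LINT w:T ` A|lebesgue. H w) - j x0 * (LINT w:A|lebesgue. F w)
          = (LINT w:A|lebesgue. k w * F w - j x0 * F w)"
        using set_integral_diff(2)[OF kF, of "\<lambda>w. j x0 * F w"] FA
        by simp
      also have "\<bar>\<dots>\<bar> \<le> (LINT w:A|lebesgue. \<eta> * B)"
      proof -
        have i1: "set_integrable lebesgue A (\<lambda>w. k w * F w - j x0 * F w)"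
          using set_integral_diff(1)[OF kF, of "\<lambda>w. j x0 * F w"] FA by simp
        have "\<bar>LINT w:A|lebesgue. k w * F w - j x0 * F w\<bar> \<le> (LINT w:A|lebesgue. \<bar>k w * F w - j x0 * F w\<bar>)"
          using set_integral_norm_bound[OF i1] by simp
        also have "\<dots> \<le> (LINT w:A|lebesgue. \<eta> * B)"
        proof (rule set_integral_mono)
          show "set_integrable lebesgue A (\<lambda>w. \<bar>k w * F w - j x0 * F w\<bar>)"
            using set_integrable_abs[OF i1] .
          show "set_integrable lebesgue A (\<lambda>w. \<eta> * B)"
            by (rule bounded_integrable_on_lmeasurable[where B="\<bar>\<eta> * B\<bar>", OF _ _ A(1)]) auto
          fix w assume "w \<in> A"
          then have "\<bar>k w - j x0\<bar> \<le> \<eta>"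
            using \<delta>(3)[of w] A(2) kj by fastforce
          then have "\<bar>k w - j x0\<bar> * \<bar>F w\<bar> \<le> \<eta> * B"
            using F(2)[of w] \<open>0 < \<eta>\<close> by (intro mult_mono) auto
          then show "\<bar>k w * F w - j x0 * F w\<bar> \<le> \<eta> * B"
            by (simp add: abs_mult[symmetric] left_diff_distrib)
        qed
        finally show ?thesis .
      qed
      also have "\<dots> = \<eta> * B * measure lebesgue A"
        using A(1) by (simp add: set_lebesgue_integral_def)
      finally show ?thesis using TA by blast
    qed
    have "jacobian_on T (j x0) \<eta> (ball x0 \<delta>)"
      by (rule jacobian_onI, rule key) (use \<delta>(2) in auto)
    then show "\<exists>\<delta>>0. jacobian_on T (j x0) \<eta> (ball x0 \<delta>)" using \<delta>(1) by blast
  qed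
  with J show ?thesis by blast
qed

text \<open>Conjugation by \<open>reindex\<close> transfers the situation to a well-ordered index
  type. As relabelling preserves Lebesgue measure, J and the error bound are unchanged.\<close>

lemma local_change_of_variables:
  fixes T :: "real^'n::finite \<Rightarrow> real^'n"
    and T' :: "real^'n \<Rightarrow> (real^'n) \<Rightarrow>\<^sub>L (real^'n)"
  assumes W: "open W" "x0 \<in> W"
    and der: "\<And>w. w \<in> W \<Longrightarrow> (T has_derivative blinfun_apply (T' w)) (at w)"
    and cont: "continuous_on W T'"
    and inj: "inj_on T W"
    and nondeg: "inj (blinfun_apply (T' x0))"
  shows "\<exists>J>0. local_jacobian T x0 J"
proof -
  have bl: "bounded_linear (reindex :: real^'n \<Rightarrow> _)" "bounded_linear (unindex :: _ \<Rightarrow> real^'n)"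
    using linear_reindex linear_unindex linear_conv_bounded_linear by blast+
  define S where "S w = reindex (T (unindex w))" for w
  define S' where "S' w = Blinfun reindex o\<^sub>L (T' (unindex w) o\<^sub>L Blinfun unindex)" for w
  let ?W = "reindex ` W"
  have W': "?W = unindex -` W" by (auto simp: mem_reindex_image)
  have cu: "continuous_on X (unindex :: _ \<Rightarrow> real^'n)" for X
    using bl(2) by (intro linear_continuous_on)
  have s1: "open ?W" unfolding W' using cu W(1) by (intro open_vimage) auto
  have s2: "reindex x0 \<in> ?W" using W(2) by simp
  have s3: "(S has_derivative blinfun_apply (S' w)) (at w)" if "w \<in> ?W" for w
  proof -
    have "(T has_derivative blinfun_apply (T' (unindex w))) (at (unindex w))"
      using der that by (auto simp: mem_reindex_image)
    from has_derivative_compose[OF bounded_linear_imp_has_derivative[OF bl(2)] this]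
    have "((\<lambda>w. T (unindex w)) has_derivative (\<lambda>v. T' (unindex w) (unindex v))) (at w)" .
    from bounded_linear.has_derivative[OF bl(1) this]
    moreover have "blinfun_apply (S' w) = (\<lambda>v. reindex (T' (unindex w) (unindex v)))"
      by (simp add: fun_eq_iff S'_def bounded_linear_Blinfun_apply bl)
    ultimately show ?thesis by (simp add: S_def[abs_def])
  qed
  have s4: "continuous_on ?W S'"
    unfolding S'_def
    by (intro bounded_bilinear.continuous_on[OF bounded_bilinear_blinfun_compose] continuous_on_const
        continuous_on_compose2[OF cont cu]) (auto simp: mem_reindex_image)
  have s5: "inj_on S ?W"
  proof (rule inj_onI)
    fix a b assume "a \<in> ?W" "b \<in> ?W" "S a = S b"
    then have "unindex a \<in> W" "unindex b \<in> W" "T (unindex a) = T (unindex b)"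
      by (auto simp: mem_reindex_image S_def dest: arg_cong[of _ _ unindex])
    then have "unindex a = unindex b" using inj by (simp add: inj_on_def)
    then have "reindex (unindex a) = reindex (unindex b)" by (rule arg_cong)
    then show "a = b" by simp
  qed
  have s6: "inj (blinfun_apply (S' (reindex x0)))"
  proof (rule injI)
    fix a b assume "S' (reindex x0) a = S' (reindex x0) b"
    then have "T' x0 (unindex a) = T' x0 (unindex b)"
      by (auto simp: S'_def bounded_linear_Blinfun_apply bl dest: arg_cong[of _ _ unindex])
    then have "unindex a = unindex b" using nondeg by (simp add: inj_def)
    then have "reindex (unindex a) = reindex (unindex b)" by (rule arg_cong)
    then show "a = b" by simp
  qed
  obtain J where J: "0 < J" "local_jacobian S (reindex x0) J"
    using local_change_of_variables_wellorder[OF s1 s2 s3 s4 s5 s6] by blast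
  have "local_jacobian T x0 J"
    unfolding local_jacobian_def
  proof (intro allI impI)
    fix \<eta> :: real assume "0 < \<eta>"
    then obtain \<delta> where "0 < \<delta>" and \<delta>: "jacobian_on S J \<eta> (ball (reindex x0) \<delta>)"
      using J(2) unfolding local_jacobian_def by blast
    have "open (reindex -` ball (reindex x0) \<delta> :: (real^'n) set)"
      using bl(1) by (intro open_vimage linear_continuous_on) auto
    then obtain d where d: "0 < d" "ball x0 d \<subseteq> reindex -` ball (reindex x0) \<delta>"
      using \<open>0 < \<delta>\<close> unfolding open_contains_ball by (auto dest!: bspec[of _ _ x0])
    have key: "T ` A \<in> lmeasurable \<and>
        \<bar>(LINT w:T ` A|lebesgue. H w) - J * (LINT w:A|lebesgue. F w)\<bar> \<le> \<eta> * B * measure lebesgue A"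
      if A: "A \<in> lmeasurable" "A \<subseteq> ball x0 d" and F: "F \<in> borel_measurable lebesgue" "\<And>w. \<bar>F w\<bar> \<le> B"
        and H: "\<And>w. w \<in> A \<Longrightarrow> H (T w) = F w" for A F H B
    proof -
      have SA: "S ` (reindex ` A) = reindex ` (T ` A)" by (auto simp: S_def image_image)
      have *: "S ` (reindex ` A) \<in> lmeasurable \<and>
        \<bar>(LINT w:S ` (reindex ` A)|lebesgue. H (unindex w)) - J * (LINT w:reindex ` A|lebesgue. F (unindex w))\<bar>
          \<le> \<eta> * B * measure lebesgue (reindex ` A)"
      proof (rule jacobian_onD[OF \<delta>])
        show "reindex ` A \<in> lmeasurable" by (rule lmeasurable_reindex_image[OF A(1)])
        show "reindex ` A \<subseteq> ball (reindex x0) \<delta>" using A(2) d(2) by blast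
        show "(\<lambda>w. F (unindex w)) \<in> borel_measurable lebesgue"
          by (rule measurable_compose[OF unindex_lebesgue_measurable F(1)])
      qed (auto simp: F(2) S_def H)
      have "T ` A = unindex ` (S ` (reindex ` A))" by (auto simp: S_def image_image)
      moreover have "unindex ` X \<in> lmeasurable" if "X \<in> lmeasurable" for X :: "(real^('n wellordered)) set"
      proof -
        have eq: "unindex ` X = reindex -` X" by (auto simp: image_iff intro!: bexI[of _ "reindex _"])
        have "emeasure lebesgue (reindex -` X :: (real^'n) set) = emeasure (distr lebesgue lebesgue (reindex :: real^'n \<Rightarrow> _)) X"
          using that by (subst emeasure_distr[OF reindex_lebesgue_measurable]) auto
        then show ?thesis
          using that measurable_sets[OF reindex_lebesgue_measurable, of X] unfolding eq
          by (auto simp: fmeasurable_def lebesgue_distr_reindex)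
      qed
      ultimately have "T ` A \<in> lmeasurable" using * by simp
      then show ?thesis
        using * unfolding SA set_integral_reindex lmeasurable_reindex_image(2)[OF A(1)] by simp
    qed
    have "jacobian_on T J \<eta> (ball x0 d)" by (rule jacobian_onI, rule key)
    then show "\<exists>\<delta>>0. jacobian_on T J \<eta> (ball x0 \<delta>)" using d(1) by blast
  qed
  with J(1) show ?thesis by blast
qed

section \<open>Charts and sections\<close>

lemma open_eq_Union_compacts:
  fixes S :: "'a::euclidean_space set"
  assumes "open S"
  shows "\<exists>C :: nat \<Rightarrow> 'a set. (\<forall>n. compact (C n) \<and> C n \<subseteq> S) \<and> incseq C \<and> \<Union>(range C) = S"
proof (rule open_Union_compact_subsets[OF assms])
  fix C :: "nat \<Rightarrow> 'a set"
  assume "\<And>n. compact (C n)" "\<And>n. C n \<subseteq> S" "\<And>n. C n \<subseteq> interior (C (Suc n))" "\<Union>(range C) = S"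
  note C = this
  have "incseq C"
    by (intro incseq_SucI order_trans[OF C(3) interior_subset])
  then show ?thesis
    using C(1,2,4) by (intro exI[of _ C] conjI allI)
qed

text \<open>A compact part of one section with measure above a stays, by the tube lemma, inside all
  neighbouring sections. No separability of the parameter space enters, so the lemma serves
  arbitrary groups. As \<open>ennreal\<close> cuts off negative values, \<open>f\<close> always is a
  density.\<close>

lemma open_superlevel_sections:
  fixes \<Omega> :: "('g::topological_space \<times> 'a::euclidean_space) set" and f :: "'a \<Rightarrow> real"
  assumes \<Omega>: "open \<Omega>" and f: "f \<in> borel_measurable lebesgue"
  shows "open {g. a < (\<integral>\<^sup>+w. ennreal (f w) * indicator {w. (g, w) \<in> \<Omega>} w \<partial>lebesgue)}"
proof -
  define \<nu> where "\<nu> = density lebesgue (\<lambda>w. ennreal (f w))"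
  have fm: "(\<lambda>w. ennreal (f w)) \<in> borel_measurable lebesgue" using f by measurable
  have op: "open {w. (g, w) \<in> \<Omega>}" for g
  proof -
    have "continuous_on UNIV (\<lambda>w :: 'a. (g, w))" by (intro continuous_intros)
    from open_vimage[OF \<Omega> this] show ?thesis by (simp add: vimage_def)
  qed
  have eq: "(\<integral>\<^sup>+w. ennreal (f w) * indicator {w. (g, w) \<in> \<Omega>} w \<partial>lebesgue) = emeasure \<nu> {w. (g, w) \<in> \<Omega>}" for g
    unfolding \<nu>_def using op by (subst emeasure_density[OF fm]) auto
  show ?thesis
    unfolding eq
  proof (subst open_subopen, intro ballI)
    fix g0 assume "g0 \<in> {g. a < emeasure \<nu> {w. (g, w) \<in> \<Omega>}}"
    then have a: "a < emeasure \<nu> {w. (g0, w) \<in> \<Omega>}" by simp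
    obtain C :: "nat \<Rightarrow> 'a set" where "(\<forall>n. compact (C n) \<and> C n \<subseteq> {w. (g0, w) \<in> \<Omega>}) \<and>
        incseq C \<and> \<Union>(range C) = {w. (g0, w) \<in> \<Omega>}"
      using open_eq_Union_compacts[OF op[of g0]] by (rule exE)
    then have C: "\<And>n. compact (C n)" "\<And>n. C n \<subseteq> {w. (g0, w) \<in> \<Omega>}"
        "incseq C" "\<Union>(range C) = {w. (g0, w) \<in> \<Omega>}" by simp_all
    have "range C \<subseteq> sets \<nu>"
      using borel_closed[OF compact_imp_closed[OF C(1)]] unfolding \<nu>_def by auto
    then have "(SUP n. emeasure \<nu> (C n)) = emeasure \<nu> {w. (g0, w) \<in> \<Omega>}"
      using SUP_emeasure_incseq[of C \<nu>] C(3,4) by simp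
    then have "a < (SUP n. emeasure \<nu> (C n))" using a by simp
    then obtain n where n: "a < emeasure \<nu> (C n)" by (auto simp: less_SUP_iff)
    have "{g0} \<times> C n \<subseteq> \<Omega>" using C(2) by auto
    then have "\<exists>U V. openin euclidean U \<and> openin euclidean V \<and> g0 \<in> U \<and> C n \<subseteq> V \<and> U \<times> V \<subseteq> \<Omega>"
      using \<Omega> C(1)[of n] by (intro tube_lemma_right) (simp_all add: prod_topology_euclidean)
    then obtain U V where UV: "open U" "g0 \<in> U" "C n \<subseteq> V" "U \<times> V \<subseteq> \<Omega>"
      by auto
    show "\<exists>T. open T \<and> g0 \<in> T \<and> T \<subseteq> {g. a < emeasure \<nu> {w. (g, w) \<in> \<Omega>}}"
    proof (intro exI conjI subsetI)
      fix g assume "g \<in> U"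
      then have "C n \<subseteq> {w. (g, w) \<in> \<Omega>}" using UV by auto
      then have "emeasure \<nu> (C n) \<le> emeasure \<nu> {w. (g, w) \<in> \<Omega>}"
        using op by (intro emeasure_mono) (auto simp: \<nu>_def)
      then show "g \<in> {g. a < emeasure \<nu> {w. (g, w) \<in> \<Omega>}}" using n by auto
    qed (use UV in auto)
  qed
qed

text \<open>Every matrix on the segment from the identity to P is positive definite, hence
  invertible, so the determinant cannot change sign along it.\<close>

lemma det_pos_of_positive_definite:
  fixes P :: "real^'n::finite^'n"
  assumes pos: "\<And>v. v \<noteq> 0 \<Longrightarrow> 0 < v \<bullet> (P *v v)"
  shows "0 < det P"
proof (rule ccontr)
  assume "\<not> ?thesis"
  then have "det P \<le> 0" by simp
  define Q where "Q t = t *\<^sub>R P + (1 - t) *\<^sub>R mat 1" for t :: real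
  have "continuous_on {0..1} (\<lambda>t. det (Q t))"
    unfolding Q_def det_def by (intro continuous_intros)
  moreover have "det (Q 1) \<le> 0" "0 \<le> det (Q 0)" using \<open>det P \<le> 0\<close> by (simp_all add: Q_def)
  ultimately obtain t where t: "0 \<le> t" "t \<le> 1" "det (Q t) = 0"
    using IVT2'[of "\<lambda>t. det (Q t)" 1 0 0] by auto
  then have "\<not> invertible (Q t)" by (simp add: invertible_det_nz)
  then obtain v where v: "v \<noteq> 0" "Q t *v v = 0"
    unfolding invertible_left_inverse matrix_left_invertible_ker by auto
  have "v \<bullet> (Q t *v v) = t * (v \<bullet> (P *v v)) + (1 - t) * (v \<bullet> v)"
    by (simp add: Q_def matrix_vector_mult_add_rdistrib scaleR_matrix_vector_assoc[symmetric] inner_add_right)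
  moreover have "0 < t * (v \<bullet> (P *v v)) + (1 - t) * (v \<bullet> v)"
  proof (cases "t = 0")
    case False
    then show ?thesis using t pos[OF v(1)] by (intro add_pos_nonneg mult_pos_pos mult_nonneg_nonneg) auto
  qed (use v in simp)
  ultimately show False using v(2) by simp
qed

text \<open>The constant is a bound for f' plus 1 for the remainder. Differentiability at one point
  only allows comparison with the value at that point.\<close>

lemma has_derivative_imp_lipschitz_at:
  assumes "(f has_derivative f') (at x)"
  obtains K d where "0 < K" "0 < d" "\<And>y. dist y x < d \<Longrightarrow> dist (f y) (f x) \<le> K * dist y x"
proof -
  obtain k where k: "\<And>v. norm (f' v) \<le> norm v * k"
    using bounded_linear.bounded[OF has_derivative_bounded_linear[OF assms]] by blast
  obtain d where d: "0 < d" "\<And>y. norm (y - x) < d \<Longrightarrow> norm (f y - f x - f' (y - x)) \<le> 1 * norm (y - x)"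
  proof -
    from assms have "\<forall>e>0. \<exists>d>0. \<forall>y. norm (y - x) < d \<longrightarrow>
        norm (f y - f x - f' (y - x)) \<le> e * norm (y - x)"
      by (simp add: has_derivative_at_alt)
    then have "\<exists>d>0. \<forall>y. norm (y - x) < d \<longrightarrow> norm (f y - f x - f' (y - x)) \<le> 1 * norm (y - x)"
      by (rule allE[of _ "1::real"]) (erule mp, rule zero_less_one)
    then show thesis using that by auto
  qed
  show thesis
  proof (rule that[of "\<bar>k\<bar> + 1" d])
    fix y assume "dist y x < d"
    then have "norm (f y - f x - f' (y - x)) \<le> norm (y - x)" using d(2) by (simp add: dist_norm)
    moreover have "norm (f' (y - x)) \<le> \<bar>k\<bar> * norm (y - x)"
      by (rule order_trans[OF k]) (simp add: mult.commute mult_right_mono)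
    moreover have "norm (f y - f x) \<le> norm (f y - f x - f' (y - x)) + norm (f' (y - x))"
      using norm_triangle_sub[of "f y - f x" "f' (y - x)"] by simp
    ultimately show "dist (f y) (f x) \<le> (\<bar>k\<bar> + 1) * dist y x"
      by (simp add: dist_norm algebra_simps)
  qed (use d(1) in auto)
qed

lemma
  fixes \<A> :: "('x::topological_space, 'n::finite) chart set"
  assumes atlas: "C1_atlas UNIV \<A>"
  shows C1_atlas_cover: "\<Union>(fst ` \<A>) = UNIV"
    and C1_atlas_open: "d \<in> \<A> \<Longrightarrow> open (fst d)"
    and C1_atlas_homeomorphism:
      "d \<in> \<A> \<Longrightarrow> homeomorphism (fst d) (snd d ` fst d) (snd d) (inv_into (fst d) (snd d))"
    and C1_atlas_open_image: "d \<in> \<A> \<Longrightarrow> open (snd d ` fst d)"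
proof -
  note a = atlas[unfolded C1_atlas_def]
  note c = a[THEN conjunct1] and l = a[THEN conjunct2, THEN conjunct1]
  show "\<Union>(fst ` \<A>) = UNIV" using c by (simp add: case_prod_beta')
  show "open (fst d)" "homeomorphism (fst d) (snd d ` fst d) (snd d) (inv_into (fst d) (snd d))"
    "open (snd d ` fst d)" if "d \<in> \<A>"
    using bspec[OF l that] by (simp_all add: case_prod_beta)
qed

text \<open>
  Neither \<open>'g\<close> nor \<open>'x\<close> is assumed to be second countable, so \<open>c\<close> may take uncountably many values.
  It is locally constant on each of countably many closed sets covering \<open>'x\<close>, which gives the Borel
  property.
\<close>

lemma chart_selection:
  fixes \<A> :: "('x::t2_space, 'n::finite) chart set"
  assumes para: "paracompact_type TYPE('x)" and atlas: "C1_atlas UNIV \<A>"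
  obtains c :: "'x \<Rightarrow> ('x, 'n) chart" where
    "\<And>x. c x \<in> \<A>" "\<And>x. x \<in> fst (c x)"
    "\<And>x. \<exists>V. open V \<and> x \<in> V \<and> finite (c ` V)"
    "\<And>(p :: 'g::topological_space \<Rightarrow> 'x) P. continuous_on UNIV p \<Longrightarrow> (\<And>d. open (P d)) \<Longrightarrow>
       {g. g \<in> P (c (p g))} \<in> sets borel"
proof -
  note cover = C1_atlas_cover[OF atlas] and opens = C1_atlas_open[OF atlas]
    and opens' = C1_atlas_open_image[OF atlas] and homeo = C1_atlas_homeomorphism[OF atlas]
  obtain \<V> where V: "\<And>V. V \<in> \<V> \<Longrightarrow> open V" "\<And>V. V \<in> \<V> \<Longrightarrow> \<exists>d\<in>\<A>. V \<subseteq> fst d" "\<Union>\<V> = UNIV"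
      "locally_finite_in euclidean \<V>"
  proof -
    have "(\<forall>U\<in>fst ` \<A>. open U) \<and> \<Union>(fst ` \<A>) = UNIV" using cover opens by auto
    then obtain \<V> where "\<forall>V\<in>\<V>. open V \<and> (\<exists>U\<in>fst ` \<A>. V \<subseteq> U)" "\<Union>\<V> = UNIV" "locally_finite_in euclidean \<V>"
      using para[unfolded paracompact_type_def, rule_format, of "fst ` \<A>"] by blast
    then show thesis by (intro that[of \<V>]) auto
  qed
  obtain d where d: "\<And>V. V \<in> \<V> \<Longrightarrow> d V \<in> \<A>" "\<And>V. V \<in> \<V> \<Longrightarrow> V \<subseteq> fst (d V)"
    using V(2) by metis
  \<comment> \<open>A member V is homeomorphic to an open subset of a Euclidean space, hence a
    countable union of compact sets. These are closed in the Hausdorff space \<open>'x\<close>,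
    while V itself is only open.\<close>
  have "\<exists>K :: nat \<Rightarrow> 'x set. (\<forall>n. compact (K n)) \<and> \<Union>(range K) = V" if "V \<in> \<V>" for V
  proof -
    let ?U = "fst (d V)" and ?\<phi> = "snd (d V)"
    let ?\<psi> = "inv_into ?U ?\<phi>"
    have hom: "homeomorphism ?U (?\<phi> ` ?U) ?\<phi> ?\<psi>" using homeo d(1) that by blast
    have "openin (top_of_set ?U) V" using V(1) d(2) that by (simp add: open_subset)
    then have "openin (top_of_set (?\<phi> ` ?U)) (?\<phi> ` V)"
      using homeomorphism_imp_open_map[OF hom] by blast
    then have "open (?\<phi> ` V)" by (rule openin_open_trans[OF _ opens'[OF d(1)[OF that]]])
    from open_eq_Union_compacts[OF this] obtain C :: "nat \<Rightarrow> (real^'n) set"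
      where "(\<forall>n. compact (C n) \<and> C n \<subseteq> ?\<phi> ` V) \<and> incseq C \<and> \<Union>(range C) = ?\<phi> ` V"
      by (rule exE)
    then have C: "\<And>n. compact (C n)" "\<And>n. C n \<subseteq> ?\<phi> ` V" "\<Union>(range C) = ?\<phi> ` V"
      by simp_all
    have "compact (?\<psi> ` C n)" for n
    proof (rule compact_continuous_image)
      show "continuous_on (C n) ?\<psi>"
        by (rule continuous_on_subset[OF homeomorphism_cont2[OF hom]])
           (rule order_trans[OF C(2) image_mono[OF d(2)[OF that]]])
    qed (rule C(1))
    moreover have "\<Union>(range (\<lambda>n. ?\<psi> ` C n)) = ?\<psi> ` ?\<phi> ` V" by (simp only: C(3)[symmetric] image_UN image_image)
    moreover have "?\<psi> ` ?\<phi> ` V = V"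
    proof -
      have "?\<psi> ` ?\<phi> ` V = (\<lambda>x. x) ` V"
        unfolding image_image
        by (rule image_cong[OF refl]) (use homeomorphism_apply1[OF hom] d(2)[OF that] in blast)
      then show ?thesis by simp
    qed
    ultimately show ?thesis by (intro exI[of _ "\<lambda>n. ?\<psi> ` C n"]) auto
  qed
  then obtain K :: "'x set \<Rightarrow> nat \<Rightarrow> 'x set" where K: "\<And>V n. V \<in> \<V> \<Longrightarrow> compact (K V n)"
      "\<And>V. V \<in> \<V> \<Longrightarrow> \<Union>(range (K V)) = V"
    by metis
  obtain r :: "'x set rel" where "Well_order r \<and> Field r = UNIV"
    using well_ordering by (rule exE)
  then have r: "well_order_on UNIV r" by metis
  \<comment> \<open>The well-order singles out the earliest member of \<V> containing a given point.
    \<open>F V\<close> is the closed set of points lying in no member before V, so V is the one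
    selected at the points of V that lie in \<open>F V\<close>.\<close>
  define F where "F V = - \<Union>{V'\<in>\<V>. (V', V) \<in> r - Id}" for V
  have "\<exists>V\<in>\<V>. x \<in> V \<inter> F V" for x
  proof -
    have wf: "wf (r - Id)" using r by (simp add: well_order_on_def)
    have "x \<in> \<Union>\<V>" unfolding V(3) by simp
    then obtain V0 where "V0 \<in> {V\<in>\<V>. x \<in> V}" by auto
    then obtain V where "V \<in> {V\<in>\<V>. x \<in> V}"
        "\<And>V'. (V', V) \<in> r - Id \<Longrightarrow> V' \<notin> {V\<in>\<V>. x \<in> V}"
      by (rule wfE_min[OF wf]) blast
    then show ?thesis by (intro bexI[of _ V]) (auto simp: F_def)
  qed
  then obtain e where e: "\<And>x. e x \<in> \<V>" "\<And>x. x \<in> e x" "\<And>x. x \<in> F (e x)" by (metis IntD1 IntD2)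
  have uniq: "V = V'" if "V \<in> \<V>" "V' \<in> \<V>" "x \<in> V" "x \<in> F V" "x \<in> V'" "x \<in> F V'" for V V' x
  proof (rule ccontr)
    assume "V \<noteq> V'"
    moreover have "total_on UNIV r" using r by (simp add: well_order_on_def linear_order_on_def)
    ultimately have "(V, V') \<in> r - Id \<or> (V', V) \<in> r - Id" by (auto simp: total_on_def)
    then show False using that by (auto simp: F_def)
  qed
  define L where "L n V = K V n \<inter> F V" for n V
  have L_sub: "L n V \<subseteq> V" if "V \<in> \<V>" for n V using K(2)[OF that] by (auto simp: L_def)
  have L_e: "x \<in> L n V \<Longrightarrow> e x = V" if "V \<in> \<V>" for x n V
    using uniq[of "e x" V x] e that L_sub[OF that, of n] by (auto simp: L_def)
  have e_L: "\<exists>n. x \<in> L n (e x)" for x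
    using K(2)[OF e(1)[of x]] e(2,3)[of x] by (auto simp: L_def)
  have L_closed: "closed (L n V)" if "V \<in> \<V>" for n V
    unfolding L_def F_def using K(1)[OF that] V(1)
    by (intro closed_Int compact_imp_closed closed_Compl open_Union) auto
  \<comment> \<open>Local finiteness makes a union of these closed sets closed, however many there
    are.\<close>
  have L_Union: "closed (\<Union>V\<in>\<W>. L n V)" if "\<W> \<subseteq> \<V>" for \<W> n
  proof -
    have "locally_finite_in euclidean (L n ` \<W>)"
      using locally_finite_in_refinement[OF locally_finite_in_subset[OF V(4) that], of "L n"] L_sub that by blast
    then show ?thesis
      using closedin_locally_finite_Union[of "L n ` \<W>" euclidean] L_closed that by auto
  qed
  show thesis
  proof (rule that[of "\<lambda>x. d (e x)"])
    show "d (e x) \<in> \<A>" "x \<in> fst (d (e x))" for x using d e by blast+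
    show "\<exists>N. open N \<and> x \<in> N \<and> finite ((\<lambda>x. d (e x)) ` N)" for x
    proof -
      obtain N where N: "open N" "x \<in> N" "finite {U \<in> \<V>. U \<inter> N \<noteq> {}}"
        using V(4) by (auto simp: locally_finite_in_def)
      have "(\<lambda>x. d (e x)) ` N \<subseteq> d ` {U \<in> \<V>. U \<inter> N \<noteq> {}}" using e by blast
      then show ?thesis using N finite_subset by blast
    qed
    fix p :: "'g \<Rightarrow> 'x" and P :: "('x, 'n) chart \<Rightarrow> 'g set"
    assume p: "continuous_on UNIV p" and P: "\<And>d. open (P d)"
    have clp: "closed (p -` X)" if "closed X" for X
      using p that by (simp add: closed_vimage)
    have "{g. g \<in> P (d (e (p g)))} = (\<Union>n. \<Union>V\<in>\<V>. P (d V) \<inter> p -` L n V)"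
      using e(1) e_L L_e by fastforce
    \<comment> \<open>For fixed n the sets \<open>L n V\<close> are pairwise disjoint and every
      union of them is closed, so each is relatively open in the union of all. Thus for each n the
      set is the intersection of a closed and an open set, and only the countable union over n
      remains.\<close>
    also have "\<dots> = (\<Union>n. p -` (\<Union>V\<in>\<V>. L n V) \<inter> (\<Union>V\<in>\<V>. P (d V) - p -` (\<Union>V'\<in>\<V>-{V}. L n V')))"
    proof (intro SUP_cong refl set_eqI iffI)
      fix n g assume "g \<in> (\<Union>V\<in>\<V>. P (d V) \<inter> p -` L n V)"
      then obtain V where "V \<in> \<V>" "g \<in> P (d V)" "p g \<in> L n V" by auto
      moreover have "p g \<notin> L n V'" if "V' \<in> \<V> - {V}" for V'
        using L_e[of V "p g" n] L_e[of V' "p g" n] that \<open>V \<in> \<V>\<close> \<open>p g \<in> L n V\<close> by auto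
      ultimately show "g \<in> p -` (\<Union>V\<in>\<V>. L n V) \<inter> (\<Union>V\<in>\<V>. P (d V) - p -` (\<Union>V'\<in>\<V>-{V}. L n V'))"
        by blast
    next
      fix n g assume "g \<in> p -` (\<Union>V\<in>\<V>. L n V) \<inter> (\<Union>V\<in>\<V>. P (d V) - p -` (\<Union>V'\<in>\<V>-{V}. L n V'))"
      then show "g \<in> (\<Union>V\<in>\<V>. P (d V) \<inter> p -` L n V)" by blast
    qed
    also have "\<dots> \<in> sets borel"
    proof -
      have "p -` (\<Union>V\<in>\<V>. L n V) \<inter> (\<Union>V\<in>\<V>. P (d V) - p -` (\<Union>V'\<in>\<V>-{V}. L n V')) \<in> sets borel" for n
      proof (rule sets.Int)
        show "p -` (\<Union>V\<in>\<V>. L n V) \<in> sets borel" by (intro borel_closed clp L_Union order_refl)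
        show "(\<Union>V\<in>\<V>. P (d V) - p -` (\<Union>V'\<in>\<V>-{V}. L n V')) \<in> sets borel"
          by (intro borel_open open_UN ballI open_Diff P clp L_Union Diff_subset)
      qed
      then show ?thesis by (intro sets.countable_UN image_subsetI)
    qed
    finally show "{g. g \<in> P (d (e (p g)))} \<in> sets borel" .
  qed
qed

section \<open>Actions in charts\<close>

abbreviation chart_inv :: "('x, 'n) chart \<Rightarrow> real^'n \<Rightarrow> 'x"
  where "chart_inv d \<equiv> inv_into (fst d) (snd d)"

text \<open>The Riemannian measure enters the construction only through its sigma-algebra and its
  local null sets, both described in charts by Lebesgue measure. The lift therefore does not depend
  on the Riemannian structure.\<close>

locale charted_action =
  fixes \<A> :: "('x::t2_space, 'n::finite) chart set"
    and act :: "'g::{topological_group_add,t2_space} \<Rightarrow> 'x \<Rightarrow> 'x"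
    and M :: "'x measure"
  assumes atlas: "C1_atlas UNIV \<A>"
    and action: "C1_continuous_action UNIV \<A> act"
    and space_M: "space M = UNIV"
    and sets_M: "\<And>E. E \<in> sets M \<longleftrightarrow> (\<forall>d\<in>\<A>. snd d ` (E \<inter> fst d) \<in> sets lebesgue)"
    and locally_AE_M: "\<And>P. locally_AE M P \<longleftrightarrow> (\<forall>d\<in>\<A>. negligible (snd d ` {x\<in>fst d. \<not> P x}))"
begin

lemma chart_inv_chart [simp]: "d \<in> \<A> \<Longrightarrow> x \<in> fst d \<Longrightarrow> chart_inv d (snd d x) = x"
  using homeomorphism_apply1[OF C1_atlas_homeomorphism[OF atlas]] .

lemma inj_on_chart: "d \<in> \<A> \<Longrightarrow> inj_on (snd d) (fst d)"
  by (rule inj_on_inverseI[of _ "chart_inv d"]) simp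

lemma continuous_chart: "d \<in> \<A> \<Longrightarrow> continuous_on (fst d) (snd d)"
  using homeomorphism_cont1[OF C1_atlas_homeomorphism[OF atlas]] .

lemma continuous_chart_inv: "d \<in> \<A> \<Longrightarrow> continuous_on (snd d ` fst d) (chart_inv d)"
  using homeomorphism_cont2[OF C1_atlas_homeomorphism[OF atlas]] .

lemma open_chart: "d \<in> \<A> \<Longrightarrow> open (fst d)" and open_chart_image: "d \<in> \<A> \<Longrightarrow> open (snd d ` fst d)"
  by (fact C1_atlas_open[OF atlas], fact C1_atlas_open_image[OF atlas])

lemma exists_chart: "\<exists>d\<in>\<A>. x \<in> fst d"
  using C1_atlas_cover[OF atlas] by (auto simp: set_eq_iff)

lemma open_chart_subimage:
  assumes "d \<in> \<A>" "open X"
  shows "open (snd d ` (X \<inter> fst d))"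
proof -
  have "snd d ` (X \<inter> fst d) = snd d ` fst d \<inter> chart_inv d -` X"
  proof (intro set_eqI iffI)
    fix w assume "w \<in> snd d ` (X \<inter> fst d)"
    then show "w \<in> snd d ` fst d \<inter> chart_inv d -` X" using assms(1) by auto
  next
    fix w assume "w \<in> snd d ` fst d \<inter> chart_inv d -` X"
    then show "w \<in> snd d ` (X \<inter> fst d)" using assms(1) by auto
  qed
  then show ?thesis
    using continuous_open_preimage[OF continuous_chart_inv open_chart_image] assms by metis
qed

lemma open_sets_M: "open X \<Longrightarrow> X \<in> sets M"
  unfolding sets_M by (intro ballI sets_completionI_sets) (simp add: open_chart_subimage borel_open)

lemma continuous_act_pair: "continuous_on UNIV (\<lambda>(g, x). act g x)"
  and act_zero [simp]: "act 0 x = x" and act_plus: "act (g + h) x = act g (act h x)"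
  using action unfolding C1_continuous_action_def continuous_action_def by auto

lemma act_minus [simp]: "act (- g) (act g x) = x" "act g (act (- g) x) = x"
  by (simp_all flip: act_plus)

lemma continuous_act: "continuous_on UNIV (act g)"
proof -
  have "continuous_on UNIV (\<lambda>x. (g, x))" by (intro continuous_intros)
  from continuous_on_compose2[OF continuous_act_pair this] show ?thesis by simp
qed

lemma continuous_act_neg: "continuous_on UNIV (\<lambda>g. act (- g) x)"
proof -
  have "continuous_on UNIV (\<lambda>g :: 'g. (- g, x))"
    by (intro continuous_on_Pair continuous_on_const continuous_on_minus[OF continuous_on_id])
  from continuous_on_compose2[OF continuous_act_pair this] show ?thesis by simp
qed

lemma act_derivative:
  assumes "d \<in> \<A>" "e \<in> \<A>"
  shows "\<exists>D :: 'g \<times> 'x \<Rightarrow> (real^'n) \<Rightarrow>\<^sub>L (real^'n).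
      (\<forall>g x. x \<in> fst d \<longrightarrow> act g x \<in> fst e \<longrightarrow>
        ((\<lambda>w. snd e (act g (chart_inv d w))) has_derivative blinfun_apply (D (g, x))) (at (snd d x))) \<and>
      continuous_on {(g, x). x \<in> fst d \<and> act g x \<in> fst e} D"
proof -
  have "\<forall>(U, \<phi>)\<in>\<A>. \<forall>(V, \<psi>)\<in>\<A>. \<exists>D :: 'g \<times> 'x \<Rightarrow> (real^'n) \<Rightarrow>\<^sub>L (real^'n).
      (\<forall>g x. x \<in> U \<and> act g x \<in> V \<longrightarrow>
        ((\<psi> \<circ> act g \<circ> inv_into U \<phi>) has_derivative blinfun_apply (D (g, x)))
          (at (\<phi> x) within UNIV)) \<and>
      continuous_on {(g, x). x \<in> U \<and> act g x \<in> V} D"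
    using action unfolding C1_continuous_action_def by (rule conjunct2)
  from bspec[OF this assms(1)]
  have *: "\<forall>(V, \<psi>)\<in>\<A>. \<exists>D :: 'g \<times> 'x \<Rightarrow> (real^'n) \<Rightarrow>\<^sub>L (real^'n).
      (\<forall>g x. x \<in> fst d \<and> act g x \<in> V \<longrightarrow>
        ((\<psi> \<circ> act g \<circ> chart_inv d) has_derivative blinfun_apply (D (g, x)))
          (at (snd d x) within UNIV)) \<and>
      continuous_on {(g, x). x \<in> fst d \<and> act g x \<in> V} D"
    unfolding case_prod_beta .
  have "\<exists>D :: 'g \<times> 'x \<Rightarrow> (real^'n) \<Rightarrow>\<^sub>L (real^'n).
      (\<forall>g x. x \<in> fst d \<and> act g x \<in> fst e \<longrightarrow>
        ((snd e \<circ> act g \<circ> chart_inv d) has_derivative blinfun_apply (D (g, x)))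
          (at (snd d x) within UNIV)) \<and>
      continuous_on {(g, x). x \<in> fst d \<and> act g x \<in> fst e} D"
    using bspec[OF * assms(2)] unfolding case_prod_beta .
  then show ?thesis unfolding o_def imp_conjL .
qed

lemma act_differentiable_on:
  assumes "d \<in> \<A>" "e \<in> \<A>"
  shows "(\<lambda>w. snd e (act g (chart_inv d w))) differentiable_on snd d ` {x\<in>fst d. act g x \<in> fst e}"
proof -
  obtain D :: "'g \<times> 'x \<Rightarrow> (real^'n) \<Rightarrow>\<^sub>L (real^'n)" where
    "(\<forall>g x. x \<in> fst d \<longrightarrow> act g x \<in> fst e \<longrightarrow>
        ((\<lambda>w. snd e (act g (chart_inv d w))) has_derivative blinfun_apply (D (g, x))) (at (snd d x))) \<and>
      continuous_on {(g, x). x \<in> fst d \<and> act g x \<in> fst e} D"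
    using act_derivative[OF assms] by (rule exE)
  note D = this[THEN conjunct1, rule_format]
  show ?thesis
    unfolding differentiable_on_def
  proof
    fix w assume "w \<in> snd d ` {x\<in>fst d. act g x \<in> fst e}"
    then obtain x where x: "x \<in> fst d" "act g x \<in> fst e" "w = snd d x" by blast
    show "(\<lambda>w. snd e (act g (chart_inv d w))) differentiable at w within snd d ` {x\<in>fst d. act g x \<in> fst e}"
      unfolding x(3) by (rule differentiableI[OF has_derivative_at_withinI[OF D[OF x(1,2)]]])
  qed
qed

text \<open>A chart domain is second countable through its coordinates even when the manifold is
  not, so Lindelof's theorem is applied to images in the model space and pulled back by injectivity
  of the chart.\<close>

lemma countable_subcover:
  assumes d: "d \<in> \<A>" and op: "\<And>i. i \<in> I \<Longrightarrow> open (X i)" and cov: "fst d \<subseteq> (\<Union>i\<in>I. X i)"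
  shows "\<exists>C\<subseteq>I. countable C \<and> fst d \<subseteq> (\<Union>i\<in>C. X i)"
proof -
  let ?X = "\<lambda>i. snd d ` (X i \<inter> fst d)"
  have "open S" if "S \<in> ?X ` I" for S
    using that op open_chart_subimage[OF d] by auto
  then obtain \<F> where F: "\<F> \<subseteq> ?X ` I" "countable \<F>" "\<Union>\<F> = \<Union>(?X ` I)"
    by (rule Lindelof) blast
  then obtain C where C: "countable C" "C \<subseteq> I" "\<F> = ?X ` C"
    using countable_subset_image[of \<F> ?X I] by auto
  have "fst d \<subseteq> (\<Union>i\<in>C. X i)"
  proof
    fix x assume x: "x \<in> fst d"
    with cov have "snd d x \<in> \<Union>(?X ` I)" by blast
    then have "snd d x \<in> \<Union>(?X ` C)" using F(3) C(3) by simp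
    then obtain i where "i \<in> C" "snd d x \<in> snd d ` (X i \<inter> fst d)" by blast
    then show "x \<in> (\<Union>i\<in>C. X i)"
      using x inj_on_chart[OF d] by (auto simp: inj_on_def)
  qed
  with C show ?thesis by blast
qed

text \<open>In a chart the preimage under g is a countable union of images under - g, and
  differentiable images of Lebesgue sets are Lebesgue sets. Countability comes from covering the
  chart domain by the open sets which g maps into a single chart.\<close>

lemma vimage_act_sets_M:
  assumes E: "E \<in> sets M"
  shows "act g -` E \<in> sets M"
  unfolding sets_M
proof
  fix d assume d: "d \<in> \<A>"
  let ?X = "\<lambda>e. act g -` fst e"
  have "open (?X e)" if "e \<in> \<A>" for e
    using continuous_act that by (intro open_vimage open_chart)
  moreover have "fst d \<subseteq> (\<Union>e\<in>\<A>. ?X e)" using exists_chart by auto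
  ultimately have "\<exists>C\<subseteq>\<A>. countable C \<and> fst d \<subseteq> (\<Union>e\<in>C. ?X e)"
    by (rule countable_subcover[OF d])
  then obtain C where C: "countable C" "C \<subseteq> \<A>" "fst d \<subseteq> (\<Union>e\<in>C. ?X e)" by blast
  have "snd d ` (act g -` E \<inter> fst d) =
      (\<Union>e\<in>C. (\<lambda>w. snd d (act (- g) (chart_inv e w))) ` (snd e ` (E \<inter> fst e) \<inter> snd e ` (act (- g) -` fst d \<inter> fst e)))"
    (is "?L = (\<Union>e\<in>C. ?R e)")
  proof (intro set_eqI iffI)
    fix w assume "w \<in> ?L"
    then obtain x where x: "x \<in> fst d" "act g x \<in> E" "w = snd d x" by auto
    with C(3) obtain e where "e \<in> C" "act g x \<in> fst e" by auto
    then have "w \<in> ?R e"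
      using x C(2) by (intro image_eqI[of _ _ "snd e (act g x)"]) auto
    then show "w \<in> (\<Union>e\<in>C. ?R e)" using \<open>e \<in> C\<close> by auto
  next
    fix w assume "w \<in> (\<Union>e\<in>C. ?R e)"
    then obtain e where "e \<in> C" "w \<in> ?R e" by blast
    then obtain v where e: "e \<in> C" "v \<in> snd e ` (E \<inter> fst e)" "v \<in> snd e ` (act (- g) -` fst d \<inter> fst e)"
        "w = snd d (act (- g) (chart_inv e v))" by blast
    then have "e \<in> \<A>" using C(2) by blast
    from e(2) obtain y where y: "y \<in> E" "y \<in> fst e" "v = snd e y" by auto
    then have "chart_inv e v = y" using \<open>e \<in> \<A>\<close> by simp
    moreover from e(3) obtain z where "z \<in> fst e" "act (- g) z \<in> fst d" "v = snd e z" by auto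
    then have "chart_inv e v = z" using \<open>e \<in> \<A>\<close> by simp
    ultimately show "w \<in> ?L"
      using y(1) e(4) \<open>act (- g) z \<in> fst d\<close> by (intro image_eqI[of _ _ "act (- g) y"]) auto
  qed
  moreover have "?R e \<in> sets lebesgue" if "e \<in> C" for e
  proof (rule differentiable_image_in_sets_lebesgue)
    have eA: "e \<in> \<A>" using that C(2) by blast
    have "open (act (- g) -` fst d)"
      using continuous_act d by (intro open_vimage open_chart)
    then have "open (snd e ` (act (- g) -` fst d \<inter> fst e))" by (rule open_chart_subimage[OF eA])
    then show "snd e ` (E \<inter> fst e) \<inter> snd e ` (act (- g) -` fst d \<inter> fst e) \<in> sets lebesgue"
      using E eA unfolding sets_M by (intro sets.Int) auto
    show "(\<lambda>w. snd d (act (- g) (chart_inv e w))) differentiable_on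
        snd e ` (E \<inter> fst e) \<inter> snd e ` (act (- g) -` fst d \<inter> fst e)"
      by (rule differentiable_on_subset[OF act_differentiable_on[OF eA d]]) auto
  qed simp
  ultimately show "?L \<in> sets lebesgue" using C(1) by (simp only:) (intro sets.countable_UN', auto)
qed

lemma translate_bounded_measurable:
  fixes f :: "'x \<Rightarrow> real"
  assumes "f \<in> bounded_measurable M"
  shows "translate act s f \<in> bounded_measurable M"
proof -
  have "act (- s) \<in> M \<rightarrow>\<^sub>M M"
    by (rule measurableI) (use vimage_act_sets_M space_M in auto)
  moreover have "range (translate act s f) \<subseteq> range f" by (auto simp: translate_def)
  ultimately show ?thesis
    using assms bounded_subset unfolding bounded_measurable_def translate_def by auto
qed

text \<open>Subsets of local null sets are measurable in every chart, hence in M. This gives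
  measurability to functions built from generalised limits, by comparison with a measurable
  function.\<close>

lemma borel_measurable_cong_locally_AE:
  fixes f f' :: "'x \<Rightarrow> 'k::real_normed_field"
  assumes f: "f \<in> borel_measurable M" and eq: "locally_AE M (\<lambda>x. f x = f' x)"
  shows "f' \<in> borel_measurable M"
proof (rule measurableI)
  fix B :: "'k set" assume "B \<in> sets borel"
  then have fB: "f -` B \<in> sets M" using measurable_sets[OF f] space_M by auto
  show "f' -` B \<inter> space M \<in> sets M"
    unfolding sets_M
  proof
    fix d assume d: "d \<in> \<A>"
    define N where "N = snd d ` {x\<in>fst d. f x \<noteq> f' x}"
    have N: "negligible N" using eq d unfolding locally_AE_M N_def by blast
    have 1: "snd d ` (f -` B \<inter> fst d) \<in> sets lebesgue" using fB d unfolding sets_M by blast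
    have 2: "snd d ` (f' -` B \<inter> fst d) \<inter> N \<in> sets lebesgue"
      using negligible_subset[OF N] negligible_imp_sets by (meson inf_le2)
    have "snd d ` (f' -` B \<inter> fst d) = (snd d ` (f -` B \<inter> fst d) - N) \<union> (snd d ` (f' -` B \<inter> fst d) \<inter> N)"
      using inj_on_chart[OF d] unfolding N_def by (auto simp: inj_on_def)
    then show "snd d ` (f' -` B \<inter> space M \<inter> fst d) \<in> sets lebesgue"
      using 1 2 negligible_imp_sets[OF N] unfolding space_M
      by (metis Int_UNIV_right sets.Diff sets.Un)
  qed
qed auto

definition pull :: "('x, 'n) chart \<Rightarrow> ('x \<Rightarrow> real) \<Rightarrow> real^'n \<Rightarrow> real"
  where "pull d f w = (if w \<in> snd d ` fst d then f (chart_inv d w) else 0)"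

lemma pull_chart [simp]: "d \<in> \<A> \<Longrightarrow> x \<in> fst d \<Longrightarrow> pull d f (snd d x) = f x"
  by (simp add: pull_def)

lemma pull_measurable:
  assumes d: "d \<in> \<A>" and f: "f \<in> borel_measurable M"
  shows "pull d f \<in> borel_measurable lebesgue"
proof (rule measurableI)
  fix B :: "real set" assume "B \<in> sets borel"
  then have "f -` B \<in> sets M" using measurable_sets[OF f] space_M by auto
  then have 1: "snd d ` (f -` B \<inter> fst d) \<in> sets lebesgue" using d unfolding sets_M by blast
  have "pull d f -` B = snd d ` (f -` B \<inter> fst d) \<union> (if 0 \<in> B then - (snd d ` fst d) else {})"
  proof (rule set_eqI)
    fix w
    show "w \<in> pull d f -` B \<longleftrightarrow> w \<in> snd d ` (f -` B \<inter> fst d) \<union> (if 0 \<in> B then - (snd d ` fst d) else {})"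
    proof (cases "w \<in> snd d ` fst d")
      case True
      then obtain x where "x \<in> fst d" "w = snd d x" by blast
      then show ?thesis using d inj_on_image_mem_iff[OF inj_on_chart[OF d], of x "f -` B \<inter> fst d"] by auto
    next
      case False
      then show ?thesis by (auto simp: pull_def)
    qed
  qed
  moreover have "- (snd d ` fst d) \<in> sets lebesgue"
    using open_chart_image[OF d] by auto
  ultimately show "pull d f -` B \<inter> space lebesgue \<in> sets lebesgue" using 1 by auto
qed auto

lemma pull_bound:
  assumes "\<And>x. \<bar>f x\<bar> \<le> B"
  shows "\<bar>pull d f w\<bar> \<le> B"
  using assms[of "chart_inv d w"] unfolding pull_def by (cases "w \<in> snd d ` fst d") auto

lemma pull_cong_negligible:
  assumes d: "d \<in> \<A>" and eq: "locally_AE M (\<lambda>x. f x = f' x)"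
  shows "negligible {w. pull d f w \<noteq> pull d f' w}"
proof -
  have "{w. pull d f w \<noteq> pull d f' w} \<subseteq> snd d ` {x\<in>fst d. f x \<noteq> f' x}"
    using d by (auto simp: pull_def)
  moreover have "negligible (snd d ` {x\<in>fst d. f x \<noteq> f' x})" using eq d unfolding locally_AE_M by blast
  ultimately show ?thesis by (rule negligible_subset[rotated])
qed

end

section \<open>Averages over small cells\<close>

definition average :: "('a::euclidean_space \<Rightarrow> real) \<Rightarrow> 'a set \<Rightarrow> real"
  where "average F A = (LINT w:A|lebesgue. F w) / measure lebesgue A"

lemma average_add:
  assumes "set_integrable lebesgue A F" "set_integrable lebesgue A G"
  shows "average (\<lambda>w. F w + G w) A = average F A + average G A"
  using set_integral_add(2)[OF assms] by (simp add: average_def add_divide_distrib)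

lemma average_cmult: "average (\<lambda>w. a * F w) A = a * average F A"
  by (simp add: average_def)

lemma average_nonneg: "(\<And>w. 0 \<le> F w) \<Longrightarrow> 0 \<le> average F A"
  unfolding average_def set_lebesgue_integral_def
  by (intro divide_nonneg_nonneg Bochner_Integration.integral_nonneg) (auto simp: indicator_def)

lemma average_cong_negligible:
  assumes "F \<in> borel_measurable lebesgue" "G \<in> borel_measurable lebesgue" "A \<in> sets lebesgue"
    and "negligible {w. F w \<noteq> G w}"
  shows "average F A = average G A"
proof -
  have "AE w in lebesgue. F w = G w"
    using assms(4) by (simp add: AE_iff_null_sets negligible_iff_null_sets eventually_ae_filter) blast
  then have "AE w in lebesgue. indicator A w *\<^sub>R F w = indicator A w *\<^sub>R G w" by eventually_elim simp
  then have "(LINT w|lebesgue. indicator A w *\<^sub>R F w) = (LINT w|lebesgue. indicator A w *\<^sub>R G w)"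
    using assms(1,2,3) by (intro integral_cong_AE) auto
  then show ?thesis by (simp add: average_def set_lebesgue_integral_def)
qed

lemma set_integral_bound:
  fixes F :: "'a::euclidean_space \<Rightarrow> real"
  assumes "F \<in> borel_measurable lebesgue" "\<And>w. \<bar>F w\<bar> \<le> B" "A \<in> lmeasurable"
  shows "\<bar>LINT w:A|lebesgue. F w\<bar> \<le> B * measure lebesgue A"
proof -
  have i: "set_integrable lebesgue A F" by (rule bounded_integrable_on_lmeasurable[OF assms])
  have "\<bar>LINT w:A|lebesgue. F w\<bar> \<le> (LINT w:A|lebesgue. \<bar>F w\<bar>)"
    using set_integral_norm_bound[OF i] by simp
  also have "\<dots> \<le> (LINT w:A|lebesgue. B)"
    by (rule set_integral_mono[OF set_integrable_abs[OF i]
          bounded_integrable_on_lmeasurable[where B="\<bar>B\<bar>", OF _ _ assms(3)]]) (use assms(2) in auto)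
  also have "\<dots> = B * measure lebesgue A" using assms(3) by (simp add: set_lebesgue_integral_def)
  finally show ?thesis .
qed

lemma average_bound:
  fixes F :: "'a::euclidean_space \<Rightarrow> real"
  assumes "F \<in> borel_measurable lebesgue" "\<And>w. \<bar>F w\<bar> \<le> B" "A \<in> lmeasurable"
  shows "\<bar>average F A\<bar> \<le> B"
proof (cases "measure lebesgue A = 0")
  case True
  \<comment> \<open>Any value of F shows B \<ge> 0, and a quotient by 0 is 0.\<close>
  then show ?thesis using assms(2)[of undefined] by (simp add: average_def)
next
  case False
  then have "0 < measure lebesgue A" by (simp add: zero_less_measure_iff)
  then show ?thesis using set_integral_bound[OF assms] by (simp add: average_def pos_divide_le_eq)
qed

text \<open>A set squeezed between concentric balls of radii s and t fills at least the fraction (s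
  / t)^n of the larger ball, so the mean deviation over it exceeds that over the ball at most by the
  inverse factor.\<close>

lemma average_near_value:
  fixes F :: "'a::euclidean_space \<Rightarrow> real"
  assumes F: "F \<in> borel_measurable lebesgue" "\<And>w. \<bar>F w\<bar> \<le> B" and A: "A \<in> lmeasurable"
    and inner: "ball p s \<subseteq> A" "0 < s" and outer: "A \<subseteq> ball p t"
    and leb: "(LINT w:ball p t|lebesgue. \<bar>F w - a\<bar>) \<le> e * measure lebesgue (ball p t)"
  shows "\<bar>average F A - a\<bar> \<le> e * (t / s) ^ DIM('a)"
proof -
  let ?v = "measure lebesgue (ball (0::'a) 1)"
  have v: "0 < ?v" using content_ball_pos[of 1 "0::'a"] by simp
  have t: "0 < t" using inner outer by (metis ball_eq_empty centre_in_ball not_le subset_empty subset_trans)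
  have vol: "measure lebesgue (ball p r) = r ^ DIM('a) * ?v" if "0 < r" for r
    using content_ball_conv_unit_ball[of r p] that by simp
  have mA: "s ^ DIM('a) * ?v \<le> measure lebesgue A"
    using measure_mono_fmeasurable[OF inner(1) _ A] vol[OF inner(2)] by simp
  then have mA0: "0 < measure lebesgue A" using v inner(2) by (smt (verit) mult_pos_pos zero_less_power)
  have Fa1: "(\<lambda>w. F w - a) \<in> borel_measurable lebesgue"
    using F(1) by measurable
  have Fa2: "\<bar>F w - a\<bar> \<le> B + \<bar>a\<bar>" for w
    using F(2)[of w] by linarith
  note Fa = Fa1 Fa2
  have i: "set_integrable lebesgue A (\<lambda>w. F w - a)" "set_integrable lebesgue (ball p t) (\<lambda>w. F w - a)"
    by (rule bounded_integrable_on_lmeasurable[OF Fa], use A in auto)+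
  have iF: "set_integrable lebesgue A F" by (rule bounded_integrable_on_lmeasurable[OF F A])
  have ia: "set_integrable lebesgue A (\<lambda>w. a)"
    by (rule bounded_integrable_on_lmeasurable[where B="\<bar>a\<bar>", OF _ _ A]) auto
  have "(LINT w:A|lebesgue. F w - a) = (LINT w:A|lebesgue. F w) - a * measure lebesgue A"
    using set_integral_diff(2)[OF iF ia] A by (simp add: set_lebesgue_integral_def mult.commute)
  then have "average F A - a = (LINT w:A|lebesgue. F w - a) / measure lebesgue A"
    using mA0 by (simp add: average_def diff_divide_distrib)
  also have "\<bar>\<dots>\<bar> \<le> (LINT w:A|lebesgue. \<bar>F w - a\<bar>) / measure lebesgue A"
    using set_integral_norm_bound[OF i(1)] mA0 by (simp add: abs_divide divide_right_mono)
  also have "\<dots> \<le> (LINT w:ball p t|lebesgue. \<bar>F w - a\<bar>) / measure lebesgue A"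
  proof (rule divide_right_mono)
    show "(LINT w:A|lebesgue. \<bar>F w - a\<bar>) \<le> (LINT w:ball p t|lebesgue. \<bar>F w - a\<bar>)"
      using set_integrable_abs[OF i(1)] set_integrable_abs[OF i(2)] outer
      unfolding set_lebesgue_integral_def set_integrable_def
      by (intro integral_mono) (auto simp: indicator_def)
  qed simp
  also have "\<dots> \<le> e * measure lebesgue (ball p t) / measure lebesgue A"
    using leb by (intro divide_right_mono) auto
  also have "\<dots> \<le> e * measure lebesgue (ball p t) / (s ^ DIM('a) * ?v)"
  proof (rule divide_left_mono[OF mA])
    have "0 \<le> (LINT w:ball p t|lebesgue. \<bar>F w - a\<bar>)"
      unfolding set_lebesgue_integral_def by (intro Bochner_Integration.integral_nonneg) (auto simp: indicator_def)
    then show "0 \<le> e * measure lebesgue (ball p t)" using leb by linarith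
    show "0 < measure lebesgue A * (s ^ DIM('a) * ?v)" using mA0 v inner(2) by simp
  qed
  also have "\<dots> = e * (t / s) ^ DIM('a)"
    using v inner(2) by (simp add: vol[OF t] power_divide)
  finally show ?thesis .
qed

text \<open>X and m stand for an integral and a measure, X' and m' for their transports. All are
  distorted by nearly the same factor J, which cancels in the quotient. Each of the two errors
  contributes \<eta> B m / m', and m' \<ge> J m / 2 turns the sum into 4 \<eta> B / J.\<close>

lemma average_compare:
  fixes m m' J \<eta> B X X' :: real
  assumes "\<bar>X' - J * X\<bar> \<le> \<eta> * B * m" "\<bar>m' - J * m\<bar> \<le> \<eta> * m" "\<bar>X\<bar> \<le> B * m"
    and "0 < m" "0 < J" "\<eta> \<le> J / 2" "0 \<le> B"
  shows "\<bar>X' / m' - X / m\<bar> \<le> 4 * \<eta> * B / J"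
proof -
  have "(J - \<eta>) * m \<le> m'" using assms(2) by (simp add: abs_le_iff algebra_simps)
  moreover have "J / 2 * m \<le> (J - \<eta>) * m" using assms(4,6) by (intro mult_right_mono) auto
  ultimately have m': "J / 2 * m \<le> m'" by linarith
  have pos: "0 < J / 2 * m" using assms(4,5) by simp
  then have m'0: "0 < m'" using m' by linarith
  have "X' / m' - X / m = ((X' - J * X) * m + X * (J * m - m')) / (m' * m)"
    using assms(4) m'0 by (simp add: field_simps)
  also have "\<bar>\<dots>\<bar> \<le> (\<eta> * B * m * m + B * m * (\<eta> * m)) / (m' * m)"
  proof -
    have "\<bar>(X' - J * X) * m + X * (J * m - m')\<bar> \<le> \<bar>X' - J * X\<bar> * m + \<bar>X\<bar> * \<bar>m' - J * m\<bar>"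
      using assms(4) abs_triangle_ineq[of "(X' - J * X) * m" "X * (J * m - m')"]
      by (simp add: abs_mult abs_minus_commute)
    also have "\<dots> \<le> \<eta> * B * m * m + B * m * (\<eta> * m)"
      using assms by (intro add_mono mult_mono) auto
    finally have "\<bar>(X' - J * X) * m + X * (J * m - m')\<bar> / (m' * m)
        \<le> (\<eta> * B * m * m + B * m * (\<eta> * m)) / (m' * m)"
      using assms(4) m'0 by (intro divide_right_mono) auto
    moreover have "\<bar>m' * m\<bar> = m' * m" using assms(4) m'0 by simp
    ultimately show ?thesis by (simp only: abs_divide)
  qed
  also have "\<dots> = 2 * \<eta> * B * m / m'" using assms(4) by (simp add: field_simps)
  also have "\<dots> \<le> 2 * \<eta> * B * m / (J / 2 * m)"
  proof (rule divide_left_mono[OF m'])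
    have "0 \<le> \<eta> * m" using assms(2) by linarith
    then show "0 \<le> 2 * \<eta> * B * m" using assms(7) by (metis mult.assoc mult.left_commute mult_nonneg_nonneg zero_le_numeral)
    show "0 < m' * (J / 2 * m)" using m'0 pos by simp
  qed
  also have "\<dots> = 4 * \<eta> * B / J" using assms(4,5) by (simp add: field_simps)
  finally show ?thesis .
qed

section \<open>Small cells read in charts\<close>

context charted_action
begin

text \<open>In the coordinates of d this is the preimage under \<open>act h\<close> of the ball of
  radius r around \<open>act h x\<close> in the chart e; for h = - g it is the neighbourhood g
  B(g\<inverse>x, r) of x. The cut at distance 1 keeps it bounded, hence of finite measure, whatever
  r is.\<close>

definition region :: "('x, 'n) chart \<Rightarrow> ('x, 'n) chart \<Rightarrow> 'x \<Rightarrow> 'g \<Rightarrow> real \<Rightarrow> (real^'n) set"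
  where "region d e x h r = {w \<in> snd d ` fst d. dist w (snd d x) < 1 \<and>
    act h (chart_inv d w) \<in> fst e \<and> dist (snd e (act h (chart_inv d w))) (snd e (act h x)) < r}"

text \<open>Joint openness in (g, w) is what lower semicontinuity in g needs. The chart e is fixed
  here, and the condition that \<open>act (- g) x\<close> lies in its domain makes the centre of the
  ball depend continuously on g.\<close>

lemma open_region_family:
  assumes d: "d \<in> \<A>" and e: "e \<in> \<A>"
  shows "open {(g, w). act (- g) x \<in> fst e \<and> w \<in> region d e x (- g) r}"
proof -
  let ?S = "UNIV \<times> (snd d ` fst d \<inter> ball (snd d x) 1) :: ('g \<times> (real^'n)) set"
  let ?f = "\<lambda>p :: 'g \<times> (real^'n). act (- fst p) (chart_inv d (snd p))"
  let ?h = "\<lambda>p :: 'g \<times> (real^'n). act (- fst p) x"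
  have S: "open ?S" using open_chart_image[OF d] by (intro open_Times open_Int) auto
  have neg: "continuous_on X (\<lambda>p :: 'g \<times> (real^'n). - fst p)" for X
    by (intro continuous_on_minus continuous_on_fst continuous_on_id)
  have "continuous_on ?S (\<lambda>p. (- fst p, chart_inv d (snd p)))"
    by (intro continuous_on_Pair neg continuous_on_compose2[OF continuous_chart_inv[OF d]]
        continuous_on_snd continuous_on_id) auto
  from continuous_on_compose2[OF continuous_act_pair this]
  have cf: "continuous_on ?S ?f" by simp
  have "continuous_on UNIV (\<lambda>p :: 'g \<times> (real^'n). (- fst p, x))"
    by (intro continuous_on_Pair neg continuous_on_const)
  from continuous_on_compose2[OF continuous_act_pair this]
  have ch: "continuous_on UNIV ?h" by simp
  let ?T = "(?S \<inter> ?f -` fst e) \<inter> ?h -` fst e"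
  have T: "open ?T"
    by (intro open_Int continuous_open_preimage[OF cf S open_chart[OF e]] open_vimage[OF open_chart[OF e] ch])
  have cg: "continuous_on ?T (\<lambda>p. dist (snd e (?f p)) (snd e (?h p)))"
  proof (rule continuous_on_dist)
    show "continuous_on ?T (\<lambda>p. snd e (?f p))"
      by (rule continuous_on_compose2[OF continuous_chart[OF e] continuous_on_subset[OF cf]]) auto
    show "continuous_on ?T (\<lambda>p. snd e (?h p))"
      by (rule continuous_on_compose2[OF continuous_chart[OF e] continuous_on_subset[OF ch]]) auto
  qed
  have "open (?T \<inter> (\<lambda>p. dist (snd e (?f p)) (snd e (?h p))) -` {..<r})"
    by (rule continuous_open_preimage[OF cg T open_lessThan])
  also have "?T \<inter> (\<lambda>p. dist (snd e (?f p)) (snd e (?h p))) -` {..<r}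
      = {(g, w). act (- g) x \<in> fst e \<and> w \<in> region d e x (- g) r}"
    by (auto simp: region_def dist_commute)
  finally show ?thesis .
qed

lemma open_region:
  assumes "d \<in> \<A>" "e \<in> \<A>" "act h x \<in> fst e"
  shows "open (region d e x h r)"
proof -
  have "continuous_on UNIV (\<lambda>w :: real^'n. (- h, w))" by (intro continuous_intros)
  from open_vimage[OF open_region_family[OF assms(1,2), of x r] this]
  show ?thesis using assms(3) by (simp add: vimage_def)
qed

lemma region_subset_ball: "region d e x h r \<subseteq> ball (snd d x) 1"
  by (auto simp: region_def dist_commute)

lemma lmeasurable_region:
  assumes "d \<in> \<A>" "e \<in> \<A>" "act h x \<in> fst e"
  shows "region d e x h r \<in> lmeasurable"
  using open_region[OF assms] bounded_subset[OF bounded_ball region_subset_ball]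
  by (intro lmeasurable_open) auto

lemma region_center:
  assumes "d \<in> \<A>" "x \<in> fst d" "act h x \<in> fst e" "0 < r"
  shows "snd d x \<in> region d e x h r"
  using assms by (auto simp: region_def)

lemma measure_region_pos:
  assumes "d \<in> \<A>" "e \<in> \<A>" "x \<in> fst d" "act h x \<in> fst e" "0 < r"
  shows "0 < measure lebesgue (region d e x h r)"
proof -
  have "\<not> negligible (region d e x h r)"
    using open_not_negligible[OF open_region[OF assms(1,2,4)]] region_center[OF assms(1,3,4,5)] by auto
  then show ?thesis
    using lmeasurable_region[OF assms(1,2,4)] negligible_iff_measure0 by (metis zero_less_measure_iff)
qed

lemma act_differentiable_at:
  assumes "d \<in> \<A>" "e \<in> \<A>" "x \<in> fst d" "act h x \<in> fst e"
  obtains D where "((\<lambda>w. snd e (act h (chart_inv d w))) has_derivative D) (at (snd d x))"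
proof -
  obtain D :: "'g \<times> 'x \<Rightarrow> (real^'n) \<Rightarrow>\<^sub>L (real^'n)" where
    "(\<forall>g x. x \<in> fst d \<longrightarrow> act g x \<in> fst e \<longrightarrow>
        ((\<lambda>w. snd e (act g (chart_inv d w))) has_derivative blinfun_apply (D (g, x))) (at (snd d x))) \<and>
      continuous_on {(g, x). x \<in> fst d \<and> act g x \<in> fst e} D"
    using act_derivative[OF assms(1,2)] by (rule exE)
  from this[THEN conjunct1, rule_format, OF assms(3,4)] show thesis by (rule that)
qed

text \<open>In charts \<open>act h\<close> and its inverse are differentiable at the centre, hence
  satisfy Lipschitz estimates there with constants K1 and K2. These give c = 1 / K1 for the inner
  and K = K2 for the outer ball.\<close>

lemma region_regular:
  assumes d: "d \<in> \<A>" and e: "e \<in> \<A>" and x: "x \<in> fst d" and y: "act h x \<in> fst e"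
  shows "\<exists>K>0. \<exists>c>0. \<exists>r0>0. \<forall>r. 0 < r \<and> r < r0 \<longrightarrow>
    ball (snd d x) (c * r) \<subseteq> region d e x h r \<and> region d e x h r \<subseteq> ball (snd d x) (K * r)"
proof -
  let ?\<theta> = "\<lambda>w. snd e (act h (chart_inv d w))" and ?\<theta>' = "\<lambda>w. snd d (act (- h) (chart_inv e w))"
  obtain D where "(?\<theta> has_derivative D) (at (snd d x))"
    by (rule act_differentiable_at[OF d e x y])
  then obtain K1 d1 where K1: "0 < K1" "0 < d1"
      "\<And>w. dist w (snd d x) < d1 \<Longrightarrow> dist (?\<theta> w) (?\<theta> (snd d x)) \<le> K1 * dist w (snd d x)"
    by (rule has_derivative_imp_lipschitz_at) blast
  have "act (- h) (act h x) \<in> fst d" using x by simp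
  then obtain D' where "(?\<theta>' has_derivative D') (at (snd e (act h x)))"
    by (rule act_differentiable_at[OF e d y])
  then obtain K2 d2 where K2: "0 < K2" "0 < d2"
      "\<And>v. dist v (snd e (act h x)) < d2 \<Longrightarrow>
        dist (?\<theta>' v) (?\<theta>' (snd e (act h x))) \<le> K2 * dist v (snd e (act h x))"
    by (rule has_derivative_imp_lipschitz_at) blast
  have "open (region d e x h 1)" by (rule open_region[OF d e y])
  moreover have "snd d x \<in> region d e x h 1" by (rule region_center[OF d x y]) simp
  ultimately obtain \<rho> where \<rho>: "0 < \<rho>" "ball (snd d x) \<rho> \<subseteq> region d e x h 1"
    using open_contains_ball by blast
  \<comment> \<open>Below d2 the estimate for the inverse map applies to the ball in e. Below K1
    min(\<rho>, d1) the ball of radius r / K1 lies in \<open>region d e x h 1\<close>, where the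
    remaining conditions hold, and in the range of the estimate for \<open>act h\<close>.\<close>
  define r0 where "r0 = min d2 (K1 * min \<rho> d1)"
  have "ball (snd d x) (inverse K1 * r) \<subseteq> region d e x h r \<and> region d e x h r \<subseteq> ball (snd d x) (K2 * r)"
    if r: "0 < r" "r < r0" for r
  proof
    show "ball (snd d x) (inverse K1 * r) \<subseteq> region d e x h r"
    proof
      fix w assume "w \<in> ball (snd d x) (inverse K1 * r)"
      then have w: "dist w (snd d x) < inverse K1 * r" by (simp add: dist_commute)
      have "r < K1 * \<rho>" "r < K1 * d1"
        using r(2) K1(1) unfolding r0_def by (simp_all add: min_mult_distrib_left)
      then have "inverse K1 * r < \<rho>" "inverse K1 * r < d1"
        using K1(1) by (simp_all add: field_simps)
      then have "w \<in> region d e x h 1" "dist w (snd d x) < d1"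
        using w \<rho>(2) by (auto simp: dist_commute)
      moreover have "dist (?\<theta> w) (?\<theta> (snd d x)) < r"
      proof -
        have "dist (?\<theta> w) (?\<theta> (snd d x)) \<le> K1 * dist w (snd d x)" using K1(3) calculation(2) by blast
        also have "\<dots> < K1 * (inverse K1 * r)" using w K1(1) by simp
        also have "\<dots> = r" using K1(1) by simp
        finally show ?thesis .
      qed
      ultimately show "w \<in> region d e x h r" using d x by (simp add: region_def)
    qed
    show "region d e x h r \<subseteq> ball (snd d x) (K2 * r)"
    proof
      fix w assume w: "w \<in> region d e x h r"
      let ?z = "chart_inv d w"
      have z: "?z \<in> fst d" "snd d ?z = w" "act h ?z \<in> fst e" "dist (snd e (act h ?z)) (snd e (act h x)) < r"
        using w d by (auto simp: region_def)
      have "dist (?\<theta>' (snd e (act h ?z))) (?\<theta>' (snd e (act h x))) \<le> K2 * dist (snd e (act h ?z)) (snd e (act h x))"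
        using z(4) r(2) by (intro K2(3)) (simp add: r0_def)
      then have "dist w (snd d x) \<le> K2 * dist (snd e (act h ?z)) (snd e (act h x))"
        using e z y by simp
      also have "\<dots> < K2 * r" using z(4) K2(1) by simp
      finally show "w \<in> ball (snd d x) (K2 * r)" by (simp add: dist_commute)
    qed
  qed
  moreover have "0 < r0" using K1 K2 \<rho> by (simp add: r0_def)
  ultimately have "\<exists>r0>0. \<forall>r. 0 < r \<and> r < r0 \<longrightarrow>
    ball (snd d x) (inverse K1 * r) \<subseteq> region d e x h r \<and> region d e x h r \<subseteq> ball (snd d x) (K2 * r)"
    by blast
  moreover have "0 < inverse K1" using K1(1) by simp
  ultimately show ?thesis using K2(1) by blast
qed

text \<open>The cells shrink regularly, so differentiation along balls implies differentiation along
  cells.\<close>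

lemma region_average_tendsto:
  assumes d: "d \<in> \<A>" and e: "e \<in> \<A>" and x: "x \<in> fst d" and y: "act h x \<in> fst e"
    and F: "F \<in> borel_measurable lebesgue" "\<And>w. \<bar>F w\<bar> \<le> B"
    and leb: "\<And>\<epsilon>. 0 < \<epsilon> \<Longrightarrow> \<exists>\<delta>>0. \<forall>r. 0 < r \<and> r < \<delta> \<longrightarrow>
       (LINT w:ball (snd d x) r|lebesgue. \<bar>F w - F (snd d x)\<bar>) \<le> \<epsilon> * measure lebesgue (ball (snd d x) r)"
  shows "((\<lambda>r. average F (region d e x h r)) \<longlongrightarrow> F (snd d x)) (at_right 0)"
proof (rule tendstoI)
  fix \<epsilon> :: real assume "0 < \<epsilon>"
  obtain K c r0 where K: "0 < K" "0 < c" "0 < r0"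
    and reg: "\<And>r. 0 < r \<Longrightarrow> r < r0 \<Longrightarrow>
      ball (snd d x) (c * r) \<subseteq> region d e x h r \<and> region d e x h r \<subseteq> ball (snd d x) (K * r)"
    using region_regular[OF d e x y] by (elim exE conjE) blast
  \<comment> \<open>The factor (K / c)^n lost in passing from balls to cells leaves \<epsilon> /
    2.\<close>
  define \<epsilon>' where "\<epsilon>' = \<epsilon> / 2 / (K / c) ^ DIM(real^'n)"
  have "0 < \<epsilon>'" using K \<open>0 < \<epsilon>\<close> by (simp add: \<epsilon>'_def)
  from leb[OF this] obtain \<delta> where \<delta>: "0 < \<delta>" "\<And>r. 0 < r \<Longrightarrow> r < \<delta> \<Longrightarrow>
       (LINT w:ball (snd d x) r|lebesgue. \<bar>F w - F (snd d x)\<bar>) \<le> \<epsilon>' * measure lebesgue (ball (snd d x) r)"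
    by auto
  have "dist (average F (region d e x h r)) (F (snd d x)) < \<epsilon>"
    if r: "0 < r" "r < min r0 (\<delta> / K)" for r
  proof -
    have "K * r < \<delta>" using r K by (simp add: field_simps)
    have "\<bar>average F (region d e x h r) - F (snd d x)\<bar> \<le> \<epsilon>' * ((K * r) / (c * r)) ^ DIM(real^'n)"
      by (rule average_near_value[OF F lmeasurable_region[OF d e y]])
         (use reg[of r] r K \<delta>(2)[of "K * r"] \<open>K * r < \<delta>\<close> in auto)
    also have "\<dots> = \<epsilon> / 2" using r K by (simp add: \<epsilon>'_def)
    finally show ?thesis using \<open>0 < \<epsilon>\<close> by (simp add: dist_real_def)
  qed
  moreover have "0 < min r0 (\<delta> / K)" using K \<delta>(1) by simp
  ultimately show "\<forall>\<^sub>F r in at_right 0. dist (average F (region d e x h r)) (F (snd d x)) < \<epsilon>"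
    unfolding eventually_at_right_field by blast
qed

end

section \<open>Averages over cells under translation\<close>

context charted_action
begin

lemma open_transition_domain:
  assumes "d \<in> \<A>" "d' \<in> \<A>"
  shows "open (snd d ` {z\<in>fst d. act s z \<in> fst d'})"
proof -
  have "open (act s -` fst d')" by (rule open_vimage[OF open_chart[OF assms(2)] continuous_act])
  from open_chart_subimage[OF assms(1) this]
  show ?thesis by (simp add: vimage_def Int_def conj_commute)
qed

lemma transition_nbhd:
  assumes d: "d \<in> \<A>" and d': "d' \<in> \<A>" and x: "x \<in> fst d" "act s x \<in> fst d'" and "0 < \<eta>"
  obtains \<delta> where "0 < \<delta>"
    "\<And>w. w \<in> ball (snd d x) \<delta> \<Longrightarrow> w \<in> snd d ` {z\<in>fst d. act s z \<in> fst d'} \<and>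
       dist (snd d' (act s (chart_inv d w))) (snd d' (act s x)) < \<eta>"
proof -
  let ?W = "snd d ` {z\<in>fst d. act s z \<in> fst d'}" and ?T = "\<lambda>w. snd d' (act s (chart_inv d w))"
  have "continuous_on ?W ?T"
    by (rule differentiable_imp_continuous_on[OF act_differentiable_on[OF d d']])
  from continuous_open_preimage[OF this open_transition_domain[OF d d'] open_ball]
  have "open (?W \<inter> ?T -` ball (snd d' (act s x)) \<eta>)" .
  moreover have "snd d x \<in> ?W \<inter> ?T -` ball (snd d' (act s x)) \<eta>"
    using d x \<open>0 < \<eta>\<close> by auto
  ultimately obtain \<delta> where "0 < \<delta>" "ball (snd d x) \<delta> \<subseteq> ?W \<inter> ?T -` ball (snd d' (act s x)) \<eta>"
    using open_contains_ball by blast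
  then show thesis by (intro that[of \<delta>]) (auto simp: dist_commute subset_iff)
qed

text \<open>The derivative at the centre is injective because \<open>act (- s)\<close>, read in the
  charts, provides a left inverse of it by the chain rule.\<close>

lemma transition_change_of_variables:
  assumes d: "d \<in> \<A>" and d': "d' \<in> \<A>" and x: "x \<in> fst d" "act s x \<in> fst d'"
  defines "T \<equiv> \<lambda>w. snd d' (act s (chart_inv d w))"
  shows "\<exists>J>0. local_jacobian T (snd d x) J"
proof -
  let ?W = "snd d ` {z\<in>fst d. act s z \<in> fst d'}"
  obtain D :: "'g \<times> 'x \<Rightarrow> (real^'n) \<Rightarrow>\<^sub>L (real^'n)" where
    "(\<forall>g x. x \<in> fst d \<longrightarrow> act g x \<in> fst d' \<longrightarrow>
        ((\<lambda>w. snd d' (act g (chart_inv d w))) has_derivative blinfun_apply (D (g, x))) (at (snd d x))) \<and>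
      continuous_on {(g, x). x \<in> fst d \<and> act g x \<in> fst d'} D"
    using act_derivative[OF d d'] by (rule exE)
  note D = this[THEN conjunct1, rule_format] and contD = this[THEN conjunct2]
  define T' where "T' w = D (s, chart_inv d w)" for w
  have oW: "open ?W" by (rule open_transition_domain[OF d d'])
  have xW: "snd d x \<in> ?W" using x by blast
  have der: "(T has_derivative blinfun_apply (T' w)) (at w)" if "w \<in> ?W" for w
    using that D d by (auto simp: T'_def T_def)
  have cont: "continuous_on ?W T'"
    unfolding T'_def
  proof (rule continuous_on_compose2[OF contD])
    show "continuous_on ?W (\<lambda>w. (s, chart_inv d w))"
      by (intro continuous_on_Pair continuous_on_const continuous_on_subset[OF continuous_chart_inv[OF d]]) auto
  qed (use d in auto)
  have inj: "inj_on T ?W"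
  proof (rule inj_onI)
    fix v w assume "v \<in> ?W" "w \<in> ?W" "T v = T w"
    then obtain y z where "y \<in> fst d" "act s y \<in> fst d'" "v = snd d y"
      "z \<in> fst d" "act s z \<in> fst d'" "w = snd d z" by blast
    moreover from this have "act s y = act s z"
      using \<open>T v = T w\<close> d inj_on_chart[OF d'] by (simp add: T_def inj_on_def)
    then have "act (- s) (act s y) = act (- s) (act s z)" by simp
    ultimately show "v = w" by simp
  qed
  have nondeg: "inj (blinfun_apply (T' (snd d x)))"
  proof -
    let ?S = "\<lambda>v. snd d (act (- s) (chart_inv d' v))"
    have "act (- s) (act s x) \<in> fst d" using x by simp
    then obtain D2 where D2: "(?S has_derivative D2) (at (snd d' (act s x)))"
      by (rule act_differentiable_at[OF d' d x(2)])
    have "T (snd d x) = snd d' (act s x)" using d x by (simp add: T_def)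
    with D2 have "(?S has_derivative D2) (at (T (snd d x)))" by simp
    from has_derivative_compose[OF der[OF xW] this]
    have "((\<lambda>w. ?S (T w)) has_derivative (\<lambda>v. D2 (T' (snd d x) v))) (at (snd d x))" .
    then have "((\<lambda>w. w) has_derivative (\<lambda>v. D2 (T' (snd d x) v))) (at (snd d x))"
      by (rule has_derivative_transform_within_open[OF _ oW xW]) (use d d' in \<open>auto simp: T_def\<close>)
    then have "(\<lambda>v. D2 (T' (snd d x) v)) = (\<lambda>v. v)"
      by (rule has_derivative_unique[OF _ has_derivative_ident])
    then have "D2 (T' (snd d x) v) = v" for v by (rule fun_cong)
    then show ?thesis by (rule inj_on_inverseI)
  qed
  show ?thesis by (rule local_change_of_variables[OF oW xW der cont inj nondeg])
qed

text \<open>As h = h' + s, the point z under h and its translate \<open>act s z\<close> under h' end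
  at the same point, so the defining inequalities in e coincide. Only chart domains and the cuts at
  distance 1 could differ, which the last two assumptions exclude.\<close>

lemma region_image:
  assumes d: "d \<in> \<A>" and d': "d' \<in> \<A>" and x: "x \<in> fst d" "act s x \<in> fst d'"
    and h: "h = h' + s"
    and A: "\<And>w. w \<in> region d e x h r \<Longrightarrow> w \<in> snd d ` {z\<in>fst d. act s z \<in> fst d'} \<and>
       dist (snd d' (act s (chart_inv d w))) (snd d' (act s x)) < 1"
    and A': "\<And>v. v \<in> region d' e (act s x) h' r \<Longrightarrow> v \<in> snd d' ` {z\<in>fst d'. act (- s) z \<in> fst d} \<and>
       dist (snd d (act (- s) (chart_inv d' v))) (snd d x) < 1"
  shows "(\<lambda>w. snd d' (act s (chart_inv d w))) ` region d e x h r = region d' e (act s x) h' r"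
proof (intro set_eqI iffI)
  fix v assume "v \<in> (\<lambda>w. snd d' (act s (chart_inv d w))) ` region d e x h r"
  then obtain w where w: "w \<in> region d e x h r" "v = snd d' (act s (chart_inv d w))" by blast
  from A[OF w(1)] obtain z where z: "z \<in> fst d" "act s z \<in> fst d'" "w = snd d z" by blast
  show "v \<in> region d' e (act s x) h' r"
    using w A[OF w(1)] z d d' unfolding region_def by (auto simp: h act_plus)
next
  fix v assume v: "v \<in> region d' e (act s x) h' r"
  from A'[OF v] obtain z where z: "z \<in> fst d'" "act (- s) z \<in> fst d" "v = snd d' z" by blast
  have "snd d (act (- s) z) \<in> region d e x h r"
    using v A'[OF v] z d d' unfolding region_def by (auto simp: h act_plus)
  moreover have "v = snd d' (act s (chart_inv d (snd d (act (- s) z))))" using z d by simp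
  ultimately show "v \<in> (\<lambda>w. snd d' (act s (chart_inv d w))) ` region d e x h r" by blast
qed

text \<open>For small r the two regions correspond exactly, so the averages differ only by the
  inaccuracy \<eta> of treating the Jacobian of the transition as a constant near x. The constant
  itself cancels.\<close>

lemma region_translate_average:
  assumes d: "d \<in> \<A>" and d': "d' \<in> \<A>" and e: "e \<in> \<A>" and x: "x \<in> fst d" "act s x \<in> fst d'"
    and y: "act h x \<in> fst e" and h: "h = h' + s"
    and f: "f \<in> borel_measurable M" "\<And>x. \<bar>f x\<bar> \<le> B"
  shows "((\<lambda>r. average (pull d' (translate act s f)) (region d' e (act s x) h' r)
            - average (pull d f) (region d e x h r)) \<longlongrightarrow> 0) (at_right 0)"
proof (rule tendstoI)
  fix \<epsilon> :: real assume "0 < \<epsilon>"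
  let ?T = "\<lambda>w. snd d' (act s (chart_inv d w))"
  have B0: "0 \<le> B" using f(2)[of undefined] by linarith
  have y': "act h' (act s x) \<in> fst e" using y by (simp add: h act_plus)
  have x': "act (- s) (act s x) \<in> fst d" using x by simp
  obtain J where "0 < J" and J: "local_jacobian ?T (snd d x) J"
    using transition_change_of_variables[OF d d' x] by (elim exE conjE)
  \<comment> \<open>The first term is the condition of \<open>average_compare\<close>; the second
    makes its bound at most \<epsilon> B / (2 (B + 1)), which is below \<epsilon> also for B =
    0.\<close>
  define \<eta> where "\<eta> = min (J / 2) (\<epsilon> * J / (8 * (B + 1)))"
  have "0 < \<eta>" using \<open>0 < J\<close> \<open>0 < \<epsilon>\<close> B0 by (simp add: \<eta>_def)
  moreover have "\<eta> \<le> J / 2" unfolding \<eta>_def by (rule min.cobounded1)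
  ultimately have \<eta>: "0 < \<eta>" "\<eta> \<le> J / 2" by simp_all
  have "4 * \<eta> * B / J \<le> 4 * (\<epsilon> * J / (8 * (B + 1))) * B / J"
    using \<open>0 < J\<close> B0 by (intro divide_right_mono mult_right_mono) (auto simp: \<eta>_def)
  also have "\<dots> < \<epsilon>" using \<open>0 < J\<close> \<open>0 < \<epsilon>\<close> B0 by (simp add: field_simps add_pos_nonneg)
  finally have \<eta>\<epsilon>: "4 * \<eta> * B / J < \<epsilon>" .
  obtain \<delta> where "0 < \<delta>" and \<delta>: "jacobian_on ?T J \<eta> (ball (snd d x) \<delta>)"
    using J \<eta>(1) unfolding local_jacobian_def by blast
  obtain \<delta>1 where \<delta>1: "0 < \<delta>1" "\<And>w. w \<in> ball (snd d x) \<delta>1 \<Longrightarrow> w \<in> snd d ` {z\<in>fst d. act s z \<in> fst d'} \<and>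
       dist (?T w) (snd d' (act s x)) < 1"
    by (rule transition_nbhd[OF d d' x zero_less_one]) blast
  obtain \<delta>2 where \<delta>2: "0 < \<delta>2" "\<And>w. w \<in> ball (snd d' (act s x)) \<delta>2 \<Longrightarrow> w \<in> snd d' ` {z\<in>fst d'. act (- s) z \<in> fst d} \<and>
       dist (snd d (act (- s) (chart_inv d' w))) (snd d (act (- s) (act s x))) < 1"
    by (rule transition_nbhd[OF d' d x(2) x' zero_less_one]) blast
  obtain K c r0 where "0 < K" "0 < c" "0 < r0"
    and reg: "\<forall>r. 0 < r \<and> r < r0 \<longrightarrow>
      ball (snd d x) (c * r) \<subseteq> region d e x h r \<and> region d e x h r \<subseteq> ball (snd d x) (K * r)"
    using region_regular[OF d e x(1) y] by (elim exE conjE)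
  obtain K' c' r0' where "0 < K'" "0 < c'" "0 < r0'"
    and reg': "\<forall>r. 0 < r \<and> r < r0' \<longrightarrow>
      ball (snd d' (act s x)) (c' * r) \<subseteq> region d' e (act s x) h' r \<and>
      region d' e (act s x) h' r \<subseteq> ball (snd d' (act s x)) (K' * r)"
    using region_regular[OF d' e x(2) y'] by (elim exE conjE)
  \<comment> \<open>Below R both regions lie so near their centres that the Jacobian estimate and
    the side conditions of \<open>region_image\<close> hold.\<close>
  define R where "R = min (min r0 (min \<delta> \<delta>1 / K)) (min r0' (\<delta>2 / K'))"
  have "0 < R"
    using \<open>0 < K\<close> \<open>0 < K'\<close> \<open>0 < r0\<close> \<open>0 < r0'\<close> \<open>0 < \<delta>\<close> \<delta>1(1) \<delta>2(1) by (simp add: R_def)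
  moreover have "dist (average (pull d' (translate act s f)) (region d' e (act s x) h' r)
            - average (pull d f) (region d e x h r)) 0 < \<epsilon>" if r: "0 < r" "r < R" for r
  proof -
    let ?A = "region d e x h r" and ?A' = "region d' e (act s x) h' r"
    have rr: "r < r0" "r < r0'" "K * r < min \<delta> \<delta>1" "K' * r < \<delta>2"
      using r(2) \<open>0 < K\<close> \<open>0 < K'\<close> by (simp_all add: R_def pos_less_divide_eq mult.commute)
    have sA: "?A \<subseteq> ball (snd d x) (min \<delta> \<delta>1)"
      by (rule subset_trans[OF reg[rule_format, THEN conjunct2] subset_ball]) (use r rr in auto)
    have sA': "?A' \<subseteq> ball (snd d' (act s x)) \<delta>2"
      by (rule subset_trans[OF reg'[rule_format, THEN conjunct2] subset_ball]) (use r rr in auto)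
    have mA: "?A \<in> lmeasurable" by (rule lmeasurable_region[OF d e y])
    have TA: "?T ` ?A = ?A'"
    proof (rule region_image[OF d d' x h])
      fix w assume "w \<in> ?A"
      then show "w \<in> snd d ` {z\<in>fst d. act s z \<in> fst d'} \<and> dist (?T w) (snd d' (act s x)) < 1"
        using sA by (intro \<delta>1(2)) auto
    next
      fix v assume "v \<in> ?A'"
      with sA' have "v \<in> ball (snd d' (act s x)) \<delta>2" by blast
      from \<delta>2(2)[OF this] show "v \<in> snd d' ` {z\<in>fst d'. act (- s) z \<in> fst d} \<and>
          dist (snd d (act (- s) (chart_inv d' v))) (snd d x) < 1" by simp
    qed
    have "\<bar>(LINT w:?A'|lebesgue. pull d' (translate act s f) w) - J * (LINT w:?A|lebesgue. pull d f w)\<bar>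
        \<le> \<eta> * B * measure lebesgue ?A"
      unfolding TA[symmetric]
    proof (rule jacobian_onD[OF \<delta>, THEN conjunct2])
      show "?A \<subseteq> ball (snd d x) \<delta>" using sA by auto
      show "pull d f \<in> borel_measurable lebesgue" by (rule pull_measurable[OF d f(1)])
      show "\<bar>pull d f w\<bar> \<le> B" for w by (rule pull_bound[OF f(2)])
      fix w assume "w \<in> ?A"
      then have "w \<in> ball (snd d x) \<delta>1" using sA by auto
      then obtain z where "z \<in> fst d" "act s z \<in> fst d'" "w = snd d z" using \<delta>1(2) by blast
      then show "pull d' (translate act s f) (?T w) = pull d f w"
        using d d' by (simp add: translate_def)
    qed (rule mA)
    moreover have "\<bar>measure lebesgue ?A' - J * measure lebesgue ?A\<bar> \<le> \<eta> * measure lebesgue ?A"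
    proof -
      have m1: "(LINT w:X|lebesgue. (1::real)) = measure lebesgue X" if "X \<in> lmeasurable" for X :: "(real^'n) set"
        using that by (simp add: set_lebesgue_integral_def)
      \<comment> \<open>The constant function 1 turns the comparison of integrals into one of
        measures.\<close>
      have "\<bar>(LINT w:?T ` ?A|lebesgue. 1) - J * (LINT w:?A|lebesgue. 1)\<bar> \<le> \<eta> * 1 * measure lebesgue ?A"
        by (rule jacobian_onD[OF \<delta>, THEN conjunct2]) (use sA mA in auto)
      then show ?thesis
        unfolding TA m1[OF mA] m1[OF lmeasurable_region[OF d' e y']] by simp
    qed
    moreover have "\<bar>LINT w:?A|lebesgue. pull d f w\<bar> \<le> B * measure lebesgue ?A"
      by (rule set_integral_bound[OF pull_measurable[OF d f(1)] pull_bound[OF f(2)] mA])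
    ultimately have "\<bar>average (pull d' (translate act s f)) ?A' - average (pull d f) ?A\<bar> \<le> 4 * \<eta> * B / J"
      unfolding average_def
      by (rule average_compare[OF _ _ _ measure_region_pos[OF d e x(1) y r(1)] \<open>0 < J\<close> \<eta>(2) B0])
    then show ?thesis using \<eta>\<epsilon> by (simp add: dist_real_def)
  qed
  ultimately show "\<forall>\<^sub>F r in at_right 0. dist (average (pull d' (translate act s f)) (region d' e (act s x) h' r)
            - average (pull d f) (region d e x h r)) 0 < \<epsilon>"
    unfolding eventually_at_right_field by blast
qed

end

section \<open>A Borel choice of charts\<close>

text \<open>The choice c need not be continuous. \<open>c_finite\<close> leaves countably many
  charts over each chart domain, which keeps exceptional sets null, and \<open>c_borel\<close> makes
  the choice measurable along orbits.\<close>

locale chart_choice = charted_action \<A> act M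
  for \<A> :: "('x::t2_space, 'n::finite) chart set"
    and act :: "'g::{topological_group_add,t2_space} \<Rightarrow> 'x \<Rightarrow> 'x"
    and M :: "'x measure" +
  fixes c :: "'x \<Rightarrow> ('x, 'n) chart"
  assumes c_chart: "c x \<in> \<A>" and c_mem: "x \<in> fst (c x)"
    and c_finite: "\<exists>V. open V \<and> x \<in> V \<and> finite (c ` V)"
    and c_borel: "continuous_on UNIV p \<Longrightarrow> (\<And>d. open (P d)) \<Longrightarrow> {g :: 'g. g \<in> P (c (p g))} \<in> sets borel"
begin

text \<open>Charts are chosen at both ends: at x to read the cell, at \<open>act (- g) x\<close> to
  define the ball. The second is unchanged when (g, x) becomes (s + g, \<open>act s x\<close>),
  which is the source of equivariance. The radii form a sequence so that dominated convergence
  applies.\<close>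

definition cell :: "nat \<Rightarrow> 'g \<Rightarrow> 'x \<Rightarrow> (real^'n) set"
  where "cell k g x = region (c x) (c (act (- g) x)) x (- g) (inverse (real (Suc k)))"

definition local_average :: "nat \<Rightarrow> 'g \<Rightarrow> 'x \<Rightarrow> ('x \<Rightarrow> real) \<Rightarrow> real"
  where "local_average k g x f = average (pull (c x) f) (cell k g x)"

lemma lmeasurable_cell: "cell k g x \<in> lmeasurable"
  unfolding cell_def by (rule lmeasurable_region[OF c_chart c_chart c_mem])

lemma local_average_bound:
  assumes "f \<in> borel_measurable M" "\<And>x. \<bar>f x\<bar> \<le> B"
  shows "\<bar>local_average k g x f\<bar> \<le> B"
  unfolding local_average_def
  by (rule average_bound[OF pull_measurable[OF c_chart assms(1)] pull_bound[OF assms(2)] lmeasurable_cell])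

lemma bounded_measurableE:
  fixes f :: "'x \<Rightarrow> real"
  assumes "f \<in> bounded_measurable M"
  obtains B where "f \<in> borel_measurable M" "0 \<le> B" "\<And>x. \<bar>f x\<bar> \<le> B"
proof -
  obtain B where "\<forall>x. \<bar>f x\<bar> \<le> B" using assms by (auto simp: bounded_measurable_def bounded_iff)
  moreover from this have "0 \<le> B" using abs_ge_zero order_trans by blast
  ultimately show thesis using that[of B] assms by (simp add: bounded_measurable_def)
qed

lemma set_integrable_pull:
  assumes "f \<in> bounded_measurable M"
  shows "set_integrable lebesgue (cell k g x) (pull (c x) f)"
proof -
  obtain B where B: "f \<in> borel_measurable M" "0 \<le> B" "\<And>x. \<bar>f x\<bar> \<le> B"
    by (rule bounded_measurableE[OF assms]) blast
  show ?thesis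
    by (rule bounded_integrable_on_lmeasurable[OF pull_measurable[OF c_chart B(1)] pull_bound[OF B(3)] lmeasurable_cell])
qed

lemma local_average_add:
  assumes "f \<in> bounded_measurable M" "f' \<in> bounded_measurable M"
  shows "local_average k g x (\<lambda>x. f x + f' x) = local_average k g x f + local_average k g x f'"
proof -
  have "pull (c x) (\<lambda>x. f x + f' x) = (\<lambda>w. pull (c x) f w + pull (c x) f' w)"
    by (auto simp: pull_def)
  then show ?thesis
    unfolding local_average_def using average_add[OF set_integrable_pull[OF assms(1)] set_integrable_pull[OF assms(2)]]
    by simp
qed

lemma local_average_cmult: "local_average k g x (\<lambda>x. a * f x) = a * local_average k g x f"
proof -
  have "pull (c x) (\<lambda>x. a * f x) = (\<lambda>w. a * pull (c x) f w)" by (auto simp: pull_def)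
  then show ?thesis unfolding local_average_def by (simp add: average_cmult)
qed

lemma local_average_nonneg: "(\<And>x. 0 \<le> f x) \<Longrightarrow> 0 \<le> local_average k g x f"
  unfolding local_average_def by (rule average_nonneg) (simp add: pull_def)

lemma local_average_cong:
  assumes "f \<in> borel_measurable M" "f' \<in> borel_measurable M" "locally_AE M (\<lambda>x. f x = f' x)"
  shows "local_average k g x f = local_average k g x f'"
  unfolding local_average_def
  using lmeasurable_cell by (intro average_cong_negligible pull_measurable pull_cong_negligible assms c_chart) auto

text \<open>For a fixed chart at \<open>act (- g) x\<close> the integral is lower semicontinuous in
  g. \<open>c_borel\<close> assembles the open superlevel sets belonging to the various charts into
  one Borel set.\<close>

lemma cell_integral_measurable:
  assumes "F \<in> borel_measurable lebesgue"
  shows "(\<lambda>g. \<integral>\<^sup>+w. ennreal (F w) * indicator (cell k g x) w \<partial>lebesgue) \<in> borel_measurable borel"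
proof (rule borel_measurableI_greater)
  fix a
  define \<Omega> where "\<Omega> e = {(g, w). act (- g) x \<in> fst e \<and> w \<in> region (c x) e x (- g) (inverse (real (Suc k)))}" for e
  \<comment> \<open>The empty set is a default: \<open>c_borel\<close> asks for an open set for
    every pair, in the atlas or not.\<close>
  define P where "P e = (if e \<in> \<A> then {g. a < (\<integral>\<^sup>+w. ennreal (F w) * indicator {w. (g, w) \<in> \<Omega> e} w \<partial>lebesgue)} else {})" for e
  have oP: "open (P e)" for e
  proof (cases "e \<in> \<A>")
    case True
    have "open (\<Omega> e)" unfolding \<Omega>_def by (rule open_region_family[OF c_chart True])
    from open_superlevel_sections[OF this assms] show ?thesis by (simp add: P_def True)
  qed (simp add: P_def)
  from c_borel[of "\<lambda>g. act (- g) x" P, OF continuous_act_neg oP]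
  have "{g. g \<in> P (c (act (- g) x))} \<in> sets borel" .
  moreover have "{w. (g, w) \<in> \<Omega> (c (act (- g) x))} = cell k g x" for g
    using c_mem[of "act (- g) x"] by (auto simp: \<Omega>_def cell_def)
  then have "{g. g \<in> P (c (act (- g) x))} = {g. a < (\<integral>\<^sup>+w. ennreal (F w) * indicator (cell k g x) w \<partial>lebesgue)}"
    by (simp add: P_def c_chart)
  ultimately show "{g \<in> space borel. a < (\<integral>\<^sup>+w. ennreal (F w) * indicator (cell k g x) w \<partial>lebesgue)} \<in> sets borel"
    by simp
qed

lemma local_average_measurable:
  assumes "f \<in> bounded_measurable M"
  shows "(\<lambda>g. local_average k g x f) \<in> borel_measurable borel"
proof -
  obtain B where B: "f \<in> borel_measurable M" "0 \<le> B" "\<And>x. \<bar>f x\<bar> \<le> B"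
    by (rule bounded_measurableE[OF assms]) blast
  have LINT: "(LINT w:cell k g x|lebesgue. F w) = enn2real (\<integral>\<^sup>+w. ennreal (F w) * indicator (cell k g x) w \<partial>lebesgue)"
    if F: "F \<in> borel_measurable lebesgue" "\<And>w. 0 \<le> F w" for F :: "real^'n \<Rightarrow> real" and g
  proof -
    have "(\<lambda>w. indicator (cell k g x) w *\<^sub>R F w) \<in> borel_measurable lebesgue"
      using lmeasurable_cell F(1) by (intro borel_measurable_scaleR borel_measurable_indicator) auto
    then have "(LINT w:cell k g x|lebesgue. F w) = enn2real (\<integral>\<^sup>+w. ennreal (indicator (cell k g x) w *\<^sub>R F w) \<partial>lebesgue)"
      unfolding set_lebesgue_integral_def using F(2) by (intro integral_eq_nn_integral) (auto simp: indicator_def)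
    also have "(\<lambda>w. ennreal (indicator (cell k g x) w *\<^sub>R F w)) = (\<lambda>w. ennreal (F w) * indicator (cell k g x) w)"
      by (auto simp: indicator_def fun_eq_iff)
    finally show ?thesis .
  qed
  have meas: "(\<lambda>g. LINT w:cell k g x|lebesgue. F w) \<in> borel_measurable borel"
    if F: "F \<in> borel_measurable lebesgue" "\<And>w. 0 \<le> F w" for F :: "real^'n \<Rightarrow> real"
    unfolding LINT[OF F] by (intro borel_measurable_enn2real cell_integral_measurable F(1))
  have pf: "pull (c x) f \<in> borel_measurable lebesgue" by (rule pull_measurable[OF c_chart B(1)])
  \<comment> \<open>Adding B makes the integrand nonnegative, as \<open>meas\<close> requires; its
    contribution is subtracted below.\<close>
  have "0 \<le> pull (c x) f w + B" for w using pull_bound[of f B "c x" w, OF B(3)] by linarith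
  moreover have "(\<lambda>w. pull (c x) f w + B) \<in> borel_measurable lebesgue" using pf by measurable
  ultimately have 1: "(\<lambda>g. LINT w:cell k g x|lebesgue. pull (c x) f w + B) \<in> borel_measurable borel"
    by (intro meas)
  have 2: "(\<lambda>g. LINT w:cell k g x|lebesgue. (1::real)) \<in> borel_measurable borel"
    by (intro meas) auto
  have one: "(LINT w:cell k g x|lebesgue. (1::real)) = measure lebesgue (cell k g x)" for g
    using lmeasurable_cell by (simp add: set_lebesgue_integral_def)
  have "local_average k g x f = ((LINT w:cell k g x|lebesgue. pull (c x) f w + B)
      - B * (LINT w:cell k g x|lebesgue. 1)) / (LINT w:cell k g x|lebesgue. 1)" for g
  proof -
    have "set_integrable lebesgue (cell k g x) (\<lambda>w. B)"
      by (rule bounded_integrable_on_lmeasurable[where B="\<bar>B\<bar>", OF _ _ lmeasurable_cell]) auto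
    from set_integral_add(2)[OF set_integrable_pull[OF assms] this]
    have "(LINT w:cell k g x|lebesgue. pull (c x) f w + B) = (LINT w:cell k g x|lebesgue. pull (c x) f w)
        + B * measure lebesgue (cell k g x)"
      using lmeasurable_cell by (simp add: set_lebesgue_integral_def mult.commute)
    then show ?thesis unfolding one by (simp add: local_average_def average_def)
  qed
  then show ?thesis using 1 2 by simp
qed

lemma inverse_Suc_at_right: "filterlim (\<lambda>k. inverse (real (Suc k))) (at_right 0) sequentially"
  by (rule tendsto_imp_filterlim_at_right[OF LIMSEQ_inverse_real_of_nat]) simp

text \<open>The points \<open>act (- g) (act s x)\<close> and \<open>act (- (- s + g)) x\<close> are
  equal, so both cells are defined by the same ball in the same chart and
  \<open>region_translate_average\<close> applies. Convergence is pointwise in g.\<close>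

lemma local_average_translate:
  assumes "f \<in> borel_measurable M" "\<And>x. \<bar>f x\<bar> \<le> B"
  shows "(\<lambda>k. local_average k g (act s x) (translate act s f) - local_average k (- s + g) x f) \<longlonglongrightarrow> 0"
proof -
  have h: "- (- s + g) = - g + s" by (simp add: minus_add)
  then have eq: "act (- g) (act s x) = act (- (- s + g)) x" by (simp flip: act_plus)
  show ?thesis
    unfolding local_average_def cell_def eq
    by (rule filterlim_compose[OF region_translate_average[OF c_chart c_chart c_chart c_mem c_mem c_mem h assms]
          inverse_Suc_at_right])
qed

text \<open>Each point is tested in its own selected chart, so this is not the condition for one
  single function on the model space.\<close>

definition lebesgue_point :: "('x \<Rightarrow> real) \<Rightarrow> 'x \<Rightarrow> bool"
  where "lebesgue_point f x \<longleftrightarrow> (\<forall>\<epsilon>>0. \<exists>\<delta>>0. \<forall>r. 0 < r \<and> r < \<delta> \<longrightarrow>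
     (LINT w:ball (snd (c x) x) r|lebesgue. \<bar>pull (c x) f w - f x\<bar>) \<le> \<epsilon> * measure lebesgue (ball (snd (c x) x) r))"

lemma local_average_tendsto:
  assumes f: "f \<in> borel_measurable M" "\<And>x. \<bar>f x\<bar> \<le> B" and "lebesgue_point f x"
  shows "(\<lambda>k. local_average k g x f) \<longlonglongrightarrow> f x"
proof -
  have p: "pull (c x) f (snd (c x) x) = f x" using c_chart c_mem by simp
  have "((\<lambda>r. average (pull (c x) f) (region (c x) (c (act (- g) x)) x (- g) r)) \<longlongrightarrow> f x) (at_right 0)"
    using region_average_tendsto[OF c_chart c_chart c_mem c_mem pull_measurable[OF c_chart f(1)] pull_bound[OF f(2)], of x x "- g"]
      assms(3) unfolding p lebesgue_point_def by blast
  from filterlim_compose[OF this inverse_Suc_at_right]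
  show ?thesis unfolding local_average_def cell_def .
qed

lemma lebesgue_point_continuous:
  assumes f: "continuous_on UNIV f" "f \<in> borel_measurable M" "\<And>x. \<bar>f x\<bar> \<le> B"
  shows "lebesgue_point f x"
  unfolding lebesgue_point_def
proof (intro allI impI)
  fix \<epsilon> :: real assume "0 < \<epsilon>"
  let ?d = "c x"
  let ?p = "snd ?d x"
  have "continuous_on (snd ?d ` fst ?d) (\<lambda>w. f (chart_inv ?d w))"
    by (rule continuous_on_compose2[OF f(1) continuous_chart_inv[OF c_chart]]) auto
  from continuous_open_preimage[OF this open_chart_image[OF c_chart] open_ball]
  have "open (snd ?d ` fst ?d \<inter> (\<lambda>w. f (chart_inv ?d w)) -` ball (f x) \<epsilon>)" .
  moreover have "?p \<in> snd ?d ` fst ?d \<inter> (\<lambda>w. f (chart_inv ?d w)) -` ball (f x) \<epsilon>"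
    using c_chart c_mem \<open>0 < \<epsilon>\<close> by auto
  ultimately obtain \<delta> where \<delta>: "0 < \<delta>" "ball ?p \<delta> \<subseteq> snd ?d ` fst ?d \<inter> (\<lambda>w. f (chart_inv ?d w)) -` ball (f x) \<epsilon>"
    using open_contains_ball by blast
  have "(LINT w:ball ?p r|lebesgue. \<bar>pull ?d f w - f x\<bar>) \<le> \<epsilon> * measure lebesgue (ball ?p r)" if r: "0 < r" "r < \<delta>" for r
  proof -
    have "(LINT w:ball ?p r|lebesgue. \<bar>pull ?d f w - f x\<bar>) \<le> (LINT w:ball ?p r|lebesgue. \<epsilon>)"
    proof (rule set_integral_mono)
      have pm: "pull ?d f \<in> borel_measurable lebesgue" by (rule pull_measurable[OF c_chart f(2)])
      have "\<bar>pull ?d f w - f x\<bar> \<le> B + B" for w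
        using pull_bound[of f B ?d w, OF f(3)] f(3)[of x] by linarith
      then show "set_integrable lebesgue (ball ?p r) (\<lambda>w. \<bar>pull ?d f w - f x\<bar>)"
        using pm by (intro bounded_integrable_on_lmeasurable[where B="B + B"]) auto
      show "set_integrable lebesgue (ball ?p r) (\<lambda>w. \<epsilon>)"
        by (rule bounded_integrable_on_lmeasurable[where B="\<bar>\<epsilon>\<bar>"]) auto
      fix w assume "w \<in> ball ?p r"
      then have "w \<in> ball ?p \<delta>" using r by auto
      then have "w \<in> snd ?d ` fst ?d" "dist (f x) (f (chart_inv ?d w)) < \<epsilon>" using \<delta>(2) by auto
      then show "\<bar>pull ?d f w - f x\<bar> \<le> \<epsilon>" by (simp add: pull_def dist_real_def abs_minus_commute)
    qed
    also have "\<dots> = \<epsilon> * measure lebesgue (ball ?p r)" by (simp add: set_lebesgue_integral_def mult.commute)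
    finally show ?thesis .
  qed
  then show "\<exists>\<delta>>0. \<forall>r. 0 < r \<and> r < \<delta> \<longrightarrow>
     (LINT w:ball ?p r|lebesgue. \<bar>pull ?d f w - f x\<bar>) \<le> \<epsilon> * measure lebesgue (ball ?p r)"
    using \<delta>(1) by blast
qed

text \<open>Near each point c has finitely many values, and countably many such neighbourhoods cover
  a chart domain.\<close>

lemma countable_charts: "d \<in> \<A> \<Longrightarrow> countable (c ` fst d)"
proof -
  assume d: "d \<in> \<A>"
  obtain V where V: "\<And>x. open (V x)" "\<And>x. x \<in> V x" "\<And>x. finite (c ` V x)" using c_finite by metis
  have "\<exists>C\<subseteq>UNIV. countable C \<and> fst d \<subseteq> (\<Union>i\<in>C. V i)"
    by (rule countable_subcover[OF d V(1)]) (use V(2) in blast)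
  then obtain C where C: "countable C" "fst d \<subseteq> (\<Union>i\<in>C. V i)" by blast
  then have "c ` fst d \<subseteq> (\<Union>i\<in>C. c ` V i)" by blast
  moreover have "countable (\<Union>i\<in>C. c ` V i)" by (rule countable_UN[OF C(1)]) (rule countable_finite[OF V(3)])
  ultimately show ?thesis by (rule countable_subset)
qed

text \<open>Over one chart domain only countably many charts e are selected. For each of them the
  exceptional set is null in the coordinates of e, and the differentiable transition to d preserves
  null sets.\<close>

lemma locally_AE_lebesgue_point:
  assumes f: "f \<in> borel_measurable M" "\<And>x. \<bar>f x\<bar> \<le> B"
  shows "locally_AE M (lebesgue_point f)"
  unfolding locally_AE_M
proof
  fix d assume d: "d \<in> \<A>"
  define N where "N e = {p. \<not> (\<forall>\<epsilon>>0. \<exists>\<delta>>0. \<forall>r. 0 < r \<and> r < \<delta> \<longrightarrow>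
     (LINT w:ball p r|lebesgue. \<bar>pull e f w - pull e f p\<bar>) \<le> \<epsilon> * measure lebesgue (ball p r))}" for e
  have N: "negligible (N e)" if "e \<in> \<A>" for e
  proof (rule lebesgue_points[OF pull_measurable[OF that f(1)] pull_bound[OF f(2)]])
    fix N' assume "negligible N'" and N': "\<And>p \<epsilon>. p \<notin> N' \<Longrightarrow> 0 < \<epsilon> \<Longrightarrow> \<exists>\<delta>>0. \<forall>r. 0 < r \<and> r < \<delta> \<longrightarrow>
       (LINT w:ball p r|lebesgue. \<bar>pull e f w - pull e f p\<bar>) \<le> \<epsilon> * measure lebesgue (ball p r)"
    have "N e \<subseteq> N'" unfolding N_def using N' by blast
    with \<open>negligible N'\<close> show ?thesis by (rule negligible_subset)
  qed
  \<comment> \<open>The chart transition is written as the action of 0, so that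
    \<open>act_differentiable_on\<close> covers it.\<close>
  let ?T = "\<lambda>e w. snd d (act 0 (chart_inv e w))"
  let ?W = "\<lambda>e. snd e ` {z\<in>fst e. act 0 z \<in> fst d}"
  have neg: "negligible (?T e ` (N e \<inter> ?W e))" if "e \<in> \<A>" for e
  proof (rule negligible_differentiable_image_negligible)
    show "negligible (N e \<inter> ?W e)" using negligible_subset[OF N[OF that]] by blast
    show "?T e differentiable_on N e \<inter> ?W e"
      by (rule differentiable_on_subset[OF act_differentiable_on[OF that d]]) blast
  qed simp
  have "negligible (\<Union>e\<in>c ` fst d. ?T e ` (N e \<inter> ?W e))"
  proof (rule negligible_countable_Union)
    show "countable ((\<lambda>e. ?T e ` (N e \<inter> ?W e)) ` c ` fst d)"
      by (rule countable_image[OF countable_charts[OF d]])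
    fix X assume "X \<in> (\<lambda>e. ?T e ` (N e \<inter> ?W e)) ` c ` fst d"
    then obtain x where "X = ?T (c x) ` (N (c x) \<inter> ?W (c x))" by (elim imageE) simp
    then show "negligible X" using neg[OF c_chart] by simp
  qed
  moreover have "snd d ` {x \<in> fst d. \<not> lebesgue_point f x} \<subseteq> (\<Union>e\<in>c ` fst d. ?T e ` (N e \<inter> ?W e))"
  proof
    fix w assume "w \<in> snd d ` {x \<in> fst d. \<not> lebesgue_point f x}"
    then obtain x where x: "x \<in> fst d" "\<not> lebesgue_point f x" "w = snd d x" by blast
    have p: "pull (c x) f (snd (c x) x) = f x" using c_chart c_mem by simp
    have "snd (c x) x \<in> N (c x)" using x(2) unfolding N_def mem_Collect_eq p lebesgue_point_def .
    moreover have "snd (c x) x \<in> ?W (c x)" using c_mem x(1) by auto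
    moreover have "w = ?T (c x) (snd (c x) x)" using x(3) c_chart c_mem by simp
    ultimately have "w \<in> ?T (c x) ` (N (c x) \<inter> ?W (c x))" by blast
    then show "w \<in> (\<Union>e\<in>c ` fst d. ?T e ` (N e \<inter> ?W e))" using x(1) by blast
  qed
  ultimately show "negligible (snd d ` {x \<in> fst d. \<not> lebesgue_point f x})" by (rule negligible_subset)
qed

end

section \<open>The lifting on functions\<close>

text \<open>\<open>\<Lambda>\<^sub>1\<close> is the generalised limit over the radii,
  \<open>\<Lambda>\<^sub>2\<close> the one along the net. Both are fixed before any function is
  considered, so that the operator built from them is linear.\<close>

locale amenable_chart_choice = chart_choice \<A> act M c
  for \<A> :: "('x::t2_space, 'n::finite) chart set"
    and act :: "'g::{topological_group_add,t2_space} \<Rightarrow> 'x \<Rightarrow> 'x"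
    and M :: "'x measure" and c :: "'x \<Rightarrow> ('x, 'n) chart" +
  fixes haar :: "'g measure" and F :: "'i filter" and m :: "'i \<Rightarrow> 'g \<times> 'x \<Rightarrow> real"
    and \<Lambda>\<^sub>1 :: "(nat \<Rightarrow> real) \<Rightarrow> real" and \<Lambda>\<^sub>2 :: "('i \<Rightarrow> real) \<Rightarrow> real"
  assumes sets_haar: "sets haar = sets borel"
    and haar_invariant: "distr haar haar ((+) s) = haar"
    and m_nonneg: "0 \<le> m i p"
    and m_integral: "has_bochner_integral haar (\<lambda>g. m i (g, x)) 1"
    and m_asymp_invariant:
      "((\<lambda>i. LINT g|haar. \<bar>m i (s + g, act s x) - m i (g, x)\<bar>) \<longlongrightarrow> 0) F"
    and \<Lambda>\<^sub>1_add: "bounded (range u) \<Longrightarrow> bounded (range v) \<Longrightarrow> \<Lambda>\<^sub>1 (\<lambda>i. u i + v i) = \<Lambda>\<^sub>1 u + \<Lambda>\<^sub>1 v"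
    and \<Lambda>\<^sub>1_cmult: "bounded (range u) \<Longrightarrow> \<Lambda>\<^sub>1 (\<lambda>i. a * u i) = a * \<Lambda>\<^sub>1 u"
    and \<Lambda>\<^sub>1_bound: "(\<And>i. \<bar>u i\<bar> \<le> B) \<Longrightarrow> \<bar>\<Lambda>\<^sub>1 u\<bar> \<le> B"
    and \<Lambda>\<^sub>1_nonneg: "bounded (range u) \<Longrightarrow> (\<And>i. 0 \<le> u i) \<Longrightarrow> 0 \<le> \<Lambda>\<^sub>1 u"
    and \<Lambda>\<^sub>1_lim: "u \<longlonglongrightarrow> l \<Longrightarrow> \<Lambda>\<^sub>1 u = l"
    and \<Lambda>\<^sub>2_add: "bounded (range u') \<Longrightarrow> bounded (range v') \<Longrightarrow> \<Lambda>\<^sub>2 (\<lambda>i. u' i + v' i) = \<Lambda>\<^sub>2 u' + \<Lambda>\<^sub>2 v'"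
    and \<Lambda>\<^sub>2_cmult: "bounded (range u') \<Longrightarrow> \<Lambda>\<^sub>2 (\<lambda>i. a * u' i) = a * \<Lambda>\<^sub>2 u'"
    and \<Lambda>\<^sub>2_bound: "(\<And>i. \<bar>u' i\<bar> \<le> B) \<Longrightarrow> \<bar>\<Lambda>\<^sub>2 u'\<bar> \<le> B"
    and \<Lambda>\<^sub>2_nonneg: "bounded (range u') \<Longrightarrow> (\<And>i. 0 \<le> u' i) \<Longrightarrow> 0 \<le> \<Lambda>\<^sub>2 u'"
    and \<Lambda>\<^sub>2_lim: "(u' \<longlongrightarrow> l) F \<Longrightarrow> \<Lambda>\<^sub>2 u' = l"
begin

lemma m_integrable: "integrable haar (\<lambda>g. m i (g, x))"
  and m_integral_eq: "(LINT g|haar. m i (g, x)) = 1"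
  using m_integral[of i x] by (auto simp: has_bochner_integral_iff)

lemma integrable_m_times:
  assumes "\<phi> \<in> borel_measurable borel" "\<And>g. \<bar>\<phi> g\<bar> \<le> B"
  shows "integrable haar (\<lambda>g. m i (g, x) * \<phi> g)"
proof (rule Bochner_Integration.integrable_bound)
  show "integrable haar (\<lambda>g. B * m i (g, x))" using m_integrable by simp
  have "\<phi> \<in> borel_measurable haar" using assms(1) measurable_cong_sets[OF sets_haar refl] by blast
  then show "(\<lambda>g. m i (g, x) * \<phi> g) \<in> borel_measurable haar"
    using borel_measurable_integrable[OF m_integrable[of i x]] by simp
  have "0 \<le> B" using assms(2) abs_ge_zero order_trans by blast
  then show "AE g in haar. norm (m i (g, x) * \<phi> g) \<le> norm (B * m i (g, x))"
    using assms(2) m_nonneg by (intro AE_I2) (simp add: abs_mult mult.commute mult_right_mono)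
qed

lemma integral_m_times_bound:
  assumes "\<phi> \<in> borel_measurable borel" "\<And>g. \<bar>\<phi> g\<bar> \<le> B"
  shows "\<bar>LINT g|haar. m i (g, x) * \<phi> g\<bar> \<le> B"
proof -
  have "\<bar>LINT g|haar. m i (g, x) * \<phi> g\<bar> \<le> (LINT g|haar. \<bar>m i (g, x) * \<phi> g\<bar>)"
    by (rule integral_abs_bound)
  also have "\<dots> \<le> (LINT g|haar. B * m i (g, x))"
  proof (rule integral_mono)
    show "integrable haar (\<lambda>g. \<bar>m i (g, x) * \<phi> g\<bar>)" using integrable_m_times[OF assms] by simp
    show "integrable haar (\<lambda>g. B * m i (g, x))" using m_integrable by simp
    show "\<bar>m i (g, x) * \<phi> g\<bar> \<le> B * m i (g, x)" for g
      using assms(2)[of g] m_nonneg[of i "(g, x)"] by (simp add: abs_mult mult.commute mult_right_mono)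
  qed
  also have "\<dots> = B" by (simp add: m_integral_eq)
  finally show ?thesis .
qed

text \<open>For each x the weight \<open>m i (g, x)\<close> is a probability density in g, so B
  times it is an integrable majorant.\<close>

lemma integral_m_times_tendsto:
  assumes "\<And>k. \<phi> k \<in> borel_measurable borel" "\<And>k g. \<bar>\<phi> k g\<bar> \<le> B" "\<And>g. (\<lambda>k. \<phi> k g) \<longlonglongrightarrow> l"
  shows "(\<lambda>k. LINT g|haar. m i (g, x) * \<phi> k g) \<longlonglongrightarrow> l"
proof -
  have "(\<lambda>k. LINT g|haar. m i (g, x) * \<phi> k g) \<longlonglongrightarrow> (LINT g|haar. m i (g, x) * l)"
  proof (rule integral_dominated_convergence)
    show "(\<lambda>g. m i (g, x) * l) \<in> borel_measurable haar"
      using borel_measurable_integrable[OF m_integrable[of i x]] by simp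
    show "(\<lambda>g. m i (g, x) * \<phi> k g) \<in> borel_measurable haar" for k
      by (rule borel_measurable_integrable[OF integrable_m_times[OF assms(1,2)]])
    show "integrable haar (\<lambda>g. B * m i (g, x))" using m_integrable by simp
    show "AE g in haar. (\<lambda>k. m i (g, x) * \<phi> k g) \<longlonglongrightarrow> m i (g, x) * l"
      by (intro AE_I2 tendsto_mult tendsto_const assms(3))
    show "AE g in haar. norm (m i (g, x) * \<phi> k g) \<le> B * m i (g, x)" for k
      using assms(2)[of k] m_nonneg by (intro AE_I2) (simp add: abs_mult mult.commute mult_right_mono)
  qed
  then show ?thesis by (simp add: m_integral_eq)
qed

definition orbit_average :: "'i \<Rightarrow> nat \<Rightarrow> 'x \<Rightarrow> ('x \<Rightarrow> real) \<Rightarrow> real"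
  where "orbit_average i k x f = (LINT g|haar. m i (g, x) * local_average k g x f)"

lemma orbit_average_bound:
  assumes "f \<in> bounded_measurable M" "\<And>x. \<bar>f x\<bar> \<le> B"
  shows "\<bar>orbit_average i k x f\<bar> \<le> B"
  unfolding orbit_average_def
  using assms(1) by (intro integral_m_times_bound local_average_measurable local_average_bound assms)
    (simp_all add: bounded_measurable_def)

lemma bounded_orbit_average:
  assumes "f \<in> bounded_measurable M"
  shows "bounded (range (\<lambda>k. orbit_average i k x f))"
proof -
  obtain B where B: "f \<in> borel_measurable M" "0 \<le> B" "\<And>x. \<bar>f x\<bar> \<le> B"
    by (rule bounded_measurableE[OF assms]) blast
  show ?thesis using orbit_average_bound[OF assms B(3)] by (auto simp: bounded_iff)
qed

text \<open>The inner limit is the one over radii: with the density \<open>m i\<close> fixed,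
  dominated convergence removes the defect under translation. The remaining defect of invariance is
  bounded independently of k and disappears in the outer limit.\<close>

definition lift :: "('x \<Rightarrow> real) \<Rightarrow> 'x \<Rightarrow> real"
  where "lift f x = \<Lambda>\<^sub>2 (\<lambda>i. \<Lambda>\<^sub>1 (\<lambda>k. orbit_average i k x f))"

lemma bounded_inner_limit:
  assumes "f \<in> bounded_measurable M"
  shows "bounded (range (\<lambda>i. \<Lambda>\<^sub>1 (\<lambda>k. orbit_average i k x f)))"
proof -
  obtain B where B: "f \<in> borel_measurable M" "0 \<le> B" "\<And>x. \<bar>f x\<bar> \<le> B"
    by (rule bounded_measurableE[OF assms]) blast
  have "\<bar>\<Lambda>\<^sub>1 (\<lambda>k. orbit_average i k x f)\<bar> \<le> B" for i
    by (rule \<Lambda>\<^sub>1_bound) (rule orbit_average_bound[OF assms B(3)])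
  then show ?thesis by (auto simp: bounded_iff)
qed

lemma lift_bound:
  assumes "f \<in> bounded_measurable M" "\<And>x. \<bar>f x\<bar> \<le> B"
  shows "\<bar>lift f x\<bar> \<le> B"
  unfolding lift_def by (intro \<Lambda>\<^sub>2_bound \<Lambda>\<^sub>1_bound orbit_average_bound assms)

lemma integrable_m_local_average:
  assumes "f \<in> bounded_measurable M"
  shows "integrable haar (\<lambda>g. m i (g, x) * local_average k g x f)"
proof -
  obtain B where B: "f \<in> borel_measurable M" "0 \<le> B" "\<And>x. \<bar>f x\<bar> \<le> B"
    by (rule bounded_measurableE[OF assms]) blast
  show ?thesis
    by (rule integrable_m_times[OF local_average_measurable[OF assms] local_average_bound[OF B(1,3)]])
qed

lemma lift_add:
  assumes "f \<in> bounded_measurable M" "f' \<in> bounded_measurable M"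
  shows "lift (\<lambda>x. f x + f' x) x = lift f x + lift f' x"
proof -
  have "orbit_average i k x (\<lambda>x. f x + f' x) = orbit_average i k x f + orbit_average i k x f'" for i k
    unfolding orbit_average_def local_average_add[OF assms] distrib_left
    by (rule Bochner_Integration.integral_add) (intro integrable_m_local_average assms)+
  then show ?thesis
    unfolding lift_def
    by (simp add: \<Lambda>\<^sub>1_add \<Lambda>\<^sub>2_add bounded_orbit_average bounded_inner_limit assms)
qed

lemma lift_cmult:
  assumes "f \<in> bounded_measurable M"
  shows "lift (\<lambda>x. a * f x) x = a * lift f x"
proof -
  have "orbit_average i k x (\<lambda>x. a * f x) = a * orbit_average i k x f" for i k
    unfolding orbit_average_def local_average_cmult by (simp add: mult.left_commute)
  then show ?thesis
    unfolding lift_def by (simp add: \<Lambda>\<^sub>1_cmult \<Lambda>\<^sub>2_cmult bounded_orbit_average bounded_inner_limit assms)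
qed

lemma lift_nonneg:
  assumes "f \<in> bounded_measurable M" "\<And>x. 0 \<le> f x"
  shows "0 \<le> lift f x"
  unfolding lift_def
  by (intro \<Lambda>\<^sub>2_nonneg \<Lambda>\<^sub>1_nonneg bounded_orbit_average bounded_inner_limit assms)
     (simp add: orbit_average_def m_nonneg local_average_nonneg assms)

lemma lift_cong:
  assumes "f \<in> bounded_measurable M" "f' \<in> bounded_measurable M" "locally_AE M (\<lambda>x. f x = f' x)"
  shows "lift f = lift f'"
proof -
  have "local_average k g x f = local_average k g x f'" for k g x
    using assms by (intro local_average_cong) (auto simp: bounded_measurable_def)
  then show ?thesis by (simp add: lift_def orbit_average_def fun_eq_iff)
qed

text \<open>The averages tend to f x for every g, so integration against a probability density and
  both generalised limits return f x.\<close>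

lemma lift_lebesgue_point:
  assumes f: "f \<in> bounded_measurable M" and "lebesgue_point f x"
  shows "lift f x = f x"
proof -
  obtain B where B: "f \<in> borel_measurable M" "0 \<le> B" "\<And>x. \<bar>f x\<bar> \<le> B"
    by (rule bounded_measurableE[OF f]) blast
  have "(\<lambda>k. orbit_average i k x f) \<longlonglongrightarrow> f x" for i
    unfolding orbit_average_def
    by (rule integral_m_times_tendsto[OF local_average_measurable[OF f] local_average_bound[OF B(1,3)]
          local_average_tendsto[OF B(1,3) assms(2)]])
  then have "\<Lambda>\<^sub>1 (\<lambda>k. orbit_average i k x f) = f x" for i by (rule \<Lambda>\<^sub>1_lim)
  then show ?thesis unfolding lift_def by (simp add: \<Lambda>\<^sub>2_lim)
qed

lemma lift_locally_AE_eq: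
  assumes "f \<in> bounded_measurable M"
  shows "locally_AE M (\<lambda>x. lift f x = f x)"
proof -
  obtain B where B: "f \<in> borel_measurable M" "0 \<le> B" "\<And>x. \<bar>f x\<bar> \<le> B"
    by (rule bounded_measurableE[OF assms]) blast
  have "locally_AE M (lebesgue_point f)" by (rule locally_AE_lebesgue_point[OF B(1,3)])
  then show ?thesis
    unfolding locally_AE_def using lift_lebesgue_point[OF assms] by (auto elim!: eventually_mono)
qed

text \<open>Generalised limits of measurable functions need not be measurable; here measurability
  follows from equality with f outside a local null set.\<close>

lemma lift_bounded_measurable:
  assumes "f \<in> bounded_measurable M"
  shows "lift f \<in> bounded_measurable M"
proof -
  obtain B where B: "f \<in> borel_measurable M" "0 \<le> B" "\<And>x. \<bar>f x\<bar> \<le> B"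
    by (rule bounded_measurableE[OF assms]) blast
  have "locally_AE M (\<lambda>x. f x = lift f x)"
    using lift_locally_AE_eq[OF assms] by (simp add: eq_commute)
  from borel_measurable_cong_locally_AE[OF B(1) this]
  show ?thesis
    using lift_bound[OF assms B(3)] by (auto simp: bounded_measurable_def bounded_iff)
qed

lemma lift_continuous:
  assumes "continuous_on UNIV f" "f \<in> bounded_measurable M"
  shows "lift f = f"
proof
  fix x
  obtain B where B: "f \<in> borel_measurable M" "0 \<le> B" "\<And>x. \<bar>f x\<bar> \<le> B"
    by (rule bounded_measurableE[OF assms(2)]) blast
  show "lift f x = f x"
    by (rule lift_lebesgue_point[OF assms(2) lebesgue_point_continuous[OF assms(1) B(1,3)]])
qed

section \<open>Equivariance of the lift\<close>

lemma translation_measurable: "(+) s \<in> haar \<rightarrow>\<^sub>M haar"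
proof -
  have "continuous_on UNIV ((+) s :: 'g \<Rightarrow> 'g)"
    by (intro continuous_on_add continuous_on_const continuous_on_id)
  then have "(+) s \<in> borel_measurable borel" by (rule borel_measurable_continuous_onI)
  then show ?thesis using measurable_cong_sets[OF sets_haar sets_haar] by blast
qed

lemma haar_integral_translate:
  fixes \<phi> :: "'g \<Rightarrow> real"
  assumes "\<phi> \<in> borel_measurable haar"
  shows "(LINT g|haar. \<phi> g) = (LINT g|haar. \<phi> (s + g))"
    and "integrable haar \<phi> \<Longrightarrow> integrable haar (\<lambda>g. \<phi> (s + g))"
  using integral_distr[OF translation_measurable[of s] assms]
    integrable_distr_eq[OF translation_measurable[of s] assms]
  by (simp_all add: haar_invariant)

text \<open>The intermediate quantity \<open>b\<close> combines the weights at
  \<open>act s x\<close> with averages of f at x. It differs from the orbit average of the translate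
  by a sequence tending to 0 in k. After Haar substitution of s + g for g it differs from the orbit
  average of f by at most \<open>B * \<delta> i\<close>, for every k.\<close>

lemma lift_translate_at:
  assumes f: "f \<in> bounded_measurable M"
  shows "lift (translate act s f) (act s x) = lift f x"
proof -
  obtain B where B: "f \<in> borel_measurable M" "0 \<le> B" "\<And>x. \<bar>f x\<bar> \<le> B"
    by (rule bounded_measurableE[OF f]) blast
  let ?sf = "translate act s f"
  have sf: "?sf \<in> bounded_measurable M" by (rule translate_bounded_measurable[OF f])
  then have sfm: "?sf \<in> borel_measurable M" by (simp add: bounded_measurable_def)
  have sfB: "\<bar>?sf x\<bar> \<le> B" for x by (simp add: translate_def B(3))
  let ?\<psi> = "\<lambda>k g. local_average k (- s + g) x f"
  have \<psi>m: "?\<psi> k \<in> borel_measurable borel" for k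
  proof -
    have "(\<lambda>g. - s + g) \<in> borel_measurable borel"
      by (intro borel_measurable_continuous_onI continuous_on_add continuous_on_const continuous_on_id)
    from measurable_compose[OF this local_average_measurable[OF f]] show ?thesis .
  qed
  have \<psi>B: "\<bar>?\<psi> k g\<bar> \<le> B" for k g by (rule local_average_bound[OF B(1,3)])
  define b where "b i k = (LINT g|haar. m i (g, act s x) * ?\<psi> k g)" for i k
  have bB: "\<bar>b i k\<bar> \<le> B" for i k unfolding b_def by (rule integral_m_times_bound[OF \<psi>m \<psi>B])
  have b_bdd: "bounded (range (b i))" for i using bB by (auto simp: bounded_iff)
  have eq1: "\<Lambda>\<^sub>1 (\<lambda>k. orbit_average i k (act s x) ?sf) = \<Lambda>\<^sub>1 (b i)" for i
  proof -
    let ?\<delta> = "\<lambda>k g. local_average k g (act s x) ?sf - ?\<psi> k g"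
    have "(\<lambda>k. LINT g|haar. m i (g, act s x) * ?\<delta> k g) \<longlonglongrightarrow> 0"
    proof (rule integral_m_times_tendsto)
      show "?\<delta> k \<in> borel_measurable borel" for k
        using local_average_measurable[OF sf] \<psi>m by (rule borel_measurable_diff)
      show "\<bar>?\<delta> k g\<bar> \<le> B + B" for k g
        using local_average_bound[OF sfm sfB, of k g "act s x"] \<psi>B[of k g] by linarith
      show "(\<lambda>k. ?\<delta> k g) \<longlonglongrightarrow> 0" for g by (rule local_average_translate[OF B(1,3)])
    qed
    moreover have "(LINT g|haar. m i (g, act s x) * ?\<delta> k g) = orbit_average i k (act s x) ?sf - b i k" for k
      unfolding orbit_average_def b_def right_diff_distrib
      by (rule Bochner_Integration.integral_diff[OF integrable_m_local_average[OF sf] integrable_m_times[OF \<psi>m \<psi>B]])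
    ultimately have lim: "(\<lambda>k. orbit_average i k (act s x) ?sf - b i k) \<longlonglongrightarrow> 0" by simp
    have bdd: "bounded (range (\<lambda>k. orbit_average i k (act s x) ?sf - b i k))"
      using lim convergent_imp_bounded by blast
    have "\<Lambda>\<^sub>1 (\<lambda>k. b i k + (orbit_average i k (act s x) ?sf - b i k))
        = \<Lambda>\<^sub>1 (b i) + \<Lambda>\<^sub>1 (\<lambda>k. orbit_average i k (act s x) ?sf - b i k)"
      by (rule \<Lambda>\<^sub>1_add[OF b_bdd bdd])
    then show ?thesis using \<Lambda>\<^sub>1_lim[OF lim] by simp
  qed
  define \<delta> where "\<delta> i = (LINT g|haar. \<bar>m i (s + g, act s x) - m i (g, x)\<bar>)" for i
  have int_s: "integrable haar (\<lambda>g. m i (s + g, act s x))" for i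
    using haar_integral_translate(2)[OF borel_measurable_integrable[OF m_integrable] m_integrable] .
  have b_eq: "b i k = (LINT g|haar. m i (s + g, act s x) * local_average k g x f)"
    and b_int: "integrable haar (\<lambda>g. m i (s + g, act s x) * local_average k g x f)" for i k
  proof -
    have i: "integrable haar (\<lambda>g. m i (g, act s x) * ?\<psi> k g)" by (rule integrable_m_times[OF \<psi>m \<psi>B])
    from haar_integral_translate(1)[OF borel_measurable_integrable[OF i], of s]
    show "b i k = (LINT g|haar. m i (s + g, act s x) * local_average k g x f)"
      unfolding b_def by (simp add: add.assoc[symmetric])
    from haar_integral_translate(2)[OF borel_measurable_integrable[OF i] i, of s]
    show "integrable haar (\<lambda>g. m i (s + g, act s x) * local_average k g x f)"
      by (simp add: add.assoc[symmetric])
  qed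
  \<comment> \<open>The averages are bounded by B, so only the L1 distance of the two densities
    counts, and this does not involve k.\<close>
  have diff: "\<bar>b i k - orbit_average i k x f\<bar> \<le> B * \<delta> i" for i k
  proof -
    have eq: "b i k - orbit_average i k x f
        = (LINT g|haar. m i (s + g, act s x) * local_average k g x f - m i (g, x) * local_average k g x f)"
      unfolding b_eq orbit_average_def
      by (rule Bochner_Integration.integral_diff[OF b_int integrable_m_local_average[OF f], symmetric])
    have "\<bar>b i k - orbit_average i k x f\<bar>
        \<le> (LINT g|haar. \<bar>m i (s + g, act s x) * local_average k g x f - m i (g, x) * local_average k g x f\<bar>)"
      unfolding eq by (rule integral_abs_bound)
    also have "\<dots> \<le> (LINT g|haar. B * \<bar>m i (s + g, act s x) - m i (g, x)\<bar>)"
    proof (rule integral_mono)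
      show "integrable haar (\<lambda>g. \<bar>m i (s + g, act s x) * local_average k g x f - m i (g, x) * local_average k g x f\<bar>)"
        by (intro integrable_abs Bochner_Integration.integrable_diff b_int integrable_m_local_average f)
      show "integrable haar (\<lambda>g. B * \<bar>m i (s + g, act s x) - m i (g, x)\<bar>)"
        by (intro integrable_mult_right integrable_abs Bochner_Integration.integrable_diff int_s m_integrable)
      show "\<bar>m i (s + g, act s x) * local_average k g x f - m i (g, x) * local_average k g x f\<bar>
          \<le> B * \<bar>m i (s + g, act s x) - m i (g, x)\<bar>" for g
        using local_average_bound[OF B(1,3), of k g x]
        unfolding left_diff_distrib[symmetric] abs_mult
        by (subst mult.commute) (rule mult_right_mono, simp_all)
    qed
    also have "\<dots> = B * \<delta> i" by (simp add: \<delta>_def)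
    finally show ?thesis .
  qed
  have inner: "\<bar>\<Lambda>\<^sub>1 (b i) - \<Lambda>\<^sub>1 (\<lambda>k. orbit_average i k x f)\<bar> \<le> B * \<delta> i" for i
  proof -
    have bdd: "bounded (range (\<lambda>k. b i k - orbit_average i k x f))" using diff by (auto simp: bounded_iff)
    have "\<Lambda>\<^sub>1 (\<lambda>k. orbit_average i k x f + (b i k - orbit_average i k x f))
        = \<Lambda>\<^sub>1 (\<lambda>k. orbit_average i k x f) + \<Lambda>\<^sub>1 (\<lambda>k. b i k - orbit_average i k x f)"
      by (rule \<Lambda>\<^sub>1_add[OF bounded_orbit_average[OF f] bdd])
    then show ?thesis using \<Lambda>\<^sub>1_bound[of "\<lambda>k. b i k - orbit_average i k x f", OF diff] by simp
  qed
  let ?u = "\<lambda>i. \<Lambda>\<^sub>1 (\<lambda>k. orbit_average i k x f)"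
  have "((\<lambda>i. B * \<delta> i) \<longlongrightarrow> B * 0) F"
    unfolding \<delta>_def by (intro tendsto_mult tendsto_const m_asymp_invariant)
  then have "((\<lambda>i. B * \<delta> i) \<longlongrightarrow> 0) F" by simp
  then have lim2: "((\<lambda>i. \<Lambda>\<^sub>1 (b i) - ?u i) \<longlongrightarrow> 0) F"
    by (rule Lim_null_comparison[rotated]) (simp add: inner)
  have "\<bar>\<Lambda>\<^sub>1 (b i)\<bar> \<le> B" "\<bar>?u i\<bar> \<le> B" for i
    by (rule \<Lambda>\<^sub>1_bound, rule bB, rule \<Lambda>\<^sub>1_bound, rule orbit_average_bound[OF f B(3)])
  then have "\<bar>\<Lambda>\<^sub>1 (b i) - ?u i\<bar> \<le> B + B" for i
    by (rule order_trans[OF abs_triangle_ineq4 add_mono])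
  then have bdd: "bounded (range (\<lambda>i. \<Lambda>\<^sub>1 (b i) - ?u i))" by (auto simp: bounded_iff)
  have "lift ?sf (act s x) = \<Lambda>\<^sub>2 (\<lambda>i. ?u i + (\<Lambda>\<^sub>1 (b i) - ?u i))"
    unfolding lift_def eq1 by simp
  also have "\<dots> = \<Lambda>\<^sub>2 ?u + \<Lambda>\<^sub>2 (\<lambda>i. \<Lambda>\<^sub>1 (b i) - ?u i)"
    by (rule \<Lambda>\<^sub>2_add[OF bounded_inner_limit[OF f] bdd])
  also have "\<dots> = lift f x" using \<Lambda>\<^sub>2_lim[OF lim2] by (simp add: lift_def)
  finally show ?thesis .
qed

lemma lift_translate:
  assumes "f \<in> bounded_measurable M"
  shows "lift (translate act s f) = translate act s (lift f)"
proof
  fix x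
  show "lift (translate act s f) x = translate act s (lift f) x"
    using lift_translate_at[OF assms, of s "act (- s) x"] by (simp add: translate_def)
qed

end

section \<open>From operators to liftings\<close>

lemma locally_AE_mono:
  assumes "locally_AE M P" "\<And>x. P x \<Longrightarrow> Q x"
  shows "locally_AE M Q"
  using assms unfolding locally_AE_def by (auto elim!: eventually_mono)

lemma locally_AE_conj:
  assumes "locally_AE M P" "locally_AE M Q"
  shows "locally_AE M (\<lambda>x. P x \<and> Q x)"
  unfolding locally_AE_def
proof (intro allI impI)
  fix K :: "'a set" assume "compact K"
  then have "AE x in M. x \<in> K \<longrightarrow> P x" "AE x in M. x \<in> K \<longrightarrow> Q x"
    using assms by (simp_all add: locally_AE_def)
  then show "AE x in M. x \<in> K \<longrightarrow> P x \<and> Q x" by eventually_elim blast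
qed

lemma bounded_measurable_bound:
  assumes "f \<in> bounded_measurable M"
  shows "f \<in> borel_measurable M" "\<exists>B. \<forall>x. norm (f x) \<le> B"
  using assms by (auto simp: bounded_measurable_def bounded_iff)

lemma bounded_measurableI:
  assumes "f \<in> borel_measurable M" "\<And>x. norm (f x) \<le> B"
  shows "f \<in> bounded_measurable M"
  using assms by (auto simp: bounded_measurable_def bounded_iff)

lemma bounded_measurable_add:
  fixes f g :: "'x \<Rightarrow> 'k::{real_normed_field,second_countable_topology}"
  assumes "f \<in> bounded_measurable M" "g \<in> bounded_measurable M"
  shows "(\<lambda>x. f x + g x) \<in> bounded_measurable M"
proof -
  obtain A B where A: "\<forall>x. norm (f x) \<le> A" and B: "\<forall>x. norm (g x) \<le> B"
    using bounded_measurable_bound(2)[OF assms(1)] bounded_measurable_bound(2)[OF assms(2)] by (elim exE)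
  show ?thesis
  proof (rule bounded_measurableI)
    show "(\<lambda>x. f x + g x) \<in> borel_measurable M"
      using bounded_measurable_bound(1)[OF assms(1)] bounded_measurable_bound(1)[OF assms(2)] by measurable
    show "norm (f x + g x) \<le> A + B" for x
      using norm_triangle_mono[of "f x" A "g x" B] A B by blast
  qed
qed

lemma bounded_measurable_cmult:
  fixes f :: "'x \<Rightarrow> 'k::{real_normed_field,second_countable_topology}"
  assumes "f \<in> bounded_measurable M"
  shows "(\<lambda>x. a * f x) \<in> bounded_measurable M"
proof -
  obtain A where A: "\<forall>x. norm (f x) \<le> A"
    using bounded_measurable_bound(2)[OF assms] by (elim exE)
  show ?thesis
  proof (rule bounded_measurableI)
    show "(\<lambda>x. a * f x) \<in> borel_measurable M"
      using bounded_measurable_bound(1)[OF assms] by measurable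
    show "norm (a * f x) \<le> norm a * A" for x
      using A by (simp add: norm_mult mult_left_mono)
  qed
qed

text \<open>An operator that respects local equality descends to classes by evaluation at any
  representative. For equivariance the representative picked from a translated class is the
  translate of some member of the original class.\<close>

lemma lifting_of_operator:
  fixes M :: "'x::topological_space measure" and act :: "'g::group_add \<Rightarrow> 'x \<Rightarrow> 'x"
    and L :: "('x \<Rightarrow> 'k::{real_normed_field,second_countable_topology}) \<Rightarrow> ('x \<Rightarrow> 'k)"
  assumes L_meas: "\<And>f. f \<in> bounded_measurable M \<Longrightarrow> L f \<in> bounded_measurable M"
    and L_eq: "\<And>f. f \<in> bounded_measurable M \<Longrightarrow> locally_AE M (\<lambda>x. L f x = f x)"
    and L_add: "\<And>f f'. f \<in> bounded_measurable M \<Longrightarrow> f' \<in> bounded_measurable M \<Longrightarrow>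
      L (\<lambda>x. f x + f' x) = (\<lambda>x. L f x + L f' x)"
    and L_cmult: "\<And>f a. f \<in> bounded_measurable M \<Longrightarrow> L (\<lambda>x. a * f x) = (\<lambda>x. a * L f x)"
    and L_pos: "\<And>f x. f \<in> bounded_measurable M \<Longrightarrow> locally_AE M (\<lambda>x. \<exists>r\<ge>0. f x = of_real r) \<Longrightarrow>
      \<exists>r\<ge>0. L f x = of_real r"
    and L_cong: "\<And>f f'. f \<in> bounded_measurable M \<Longrightarrow> f' \<in> bounded_measurable M \<Longrightarrow>
      locally_AE M (\<lambda>x. f x = f' x) \<Longrightarrow> L f = L f'"
    and cont_meas: "\<And>f :: 'x \<Rightarrow> 'k. continuous_on UNIV f \<Longrightarrow> f \<in> borel_measurable M"
    and L_cont: "\<And>f. continuous_on UNIV f \<Longrightarrow> f \<in> bounded_measurable M \<Longrightarrow> L f = f"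
    and L_translate: "\<And>f s. f \<in> bounded_measurable M \<Longrightarrow> L (translate act s f) = translate act s (L f)"
  shows "\<exists>\<Lambda> :: ('x \<Rightarrow> 'k) set \<Rightarrow> ('x \<Rightarrow> 'k). linear_lifting M \<Lambda> \<and> strong_lifting M \<Lambda> \<and> equivariant_lifting M act \<Lambda>"
proof -
  define \<Lambda> where "\<Lambda> \<phi> = L (SOME f. f \<in> \<phi>)" for \<phi>
  have mem: "f' \<in> Linfty_class M f \<longleftrightarrow> f' \<in> bounded_measurable M \<and> locally_AE M (\<lambda>x. f x = f' x)"
    if "f \<in> bounded_measurable M" for f f' :: "'x \<Rightarrow> 'k"
    using that by (simp add: Linfty_class_def locally_AE_eq_rel_def)
  have refl: "f \<in> Linfty_class M f" if "f \<in> bounded_measurable M" for f :: "'x \<Rightarrow> 'k"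
    using that mem[OF that] by (simp add: locally_AE_def)
  have \<Lambda>_class: "\<Lambda> (Linfty_class M f) = L f" if f: "f \<in> bounded_measurable M" for f
  proof -
    have "(SOME f'. f' \<in> Linfty_class M f) \<in> Linfty_class M f" by (rule someI[of _ f]) (rule refl[OF f])
    then show ?thesis unfolding \<Lambda>_def mem[OF f] using L_cong[OF f] by metis
  qed
  have LinftyE: "\<exists>f\<in>bounded_measurable M. \<phi> = Linfty_class M f" if "\<phi> \<in> Linfty M" for \<phi> :: "('x \<Rightarrow> 'k) set"
    using that unfolding Linfty_def Linfty_class_def by (rule quotientE) blast
  have \<Lambda>_mem: "f \<in> bounded_measurable M \<and> \<Lambda> \<phi> = L f" if \<phi>: "\<phi> \<in> Linfty M" and f: "f \<in> \<phi>" for \<phi> f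
  proof -
    obtain f0 where f0: "f0 \<in> bounded_measurable M" "\<phi> = Linfty_class M f0" using LinftyE[OF \<phi>] by blast
    have "f \<in> bounded_measurable M" "locally_AE M (\<lambda>x. f0 x = f x)" using f unfolding f0(2) mem[OF f0(1)] by simp_all
    then show ?thesis using L_cong[OF f0(1)] \<Lambda>_class[OF f0(1)] f0(2) by simp
  qed
  have one_meas: "(\<lambda>_. 1 :: 'k) \<in> bounded_measurable M" by (simp add: bounded_measurable_def)
  have "linear_lifting M \<Lambda>"
    unfolding linear_lifting_def
  proof (intro conjI ballI allI impI)
    fix \<phi> :: "('x \<Rightarrow> 'k) set" assume "\<phi> \<in> Linfty M"
    then obtain f where f: "f \<in> bounded_measurable M" "\<phi> = Linfty_class M f" using LinftyE by blast
    have "locally_AE M (\<lambda>x. f x = L f x)" using L_eq[OF f(1)] by (simp add: eq_commute)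
    then show "\<Lambda> \<phi> \<in> bounded_measurable M" "\<Lambda> \<phi> \<in> \<phi>"
      using L_meas[OF f(1)] unfolding f(2) \<Lambda>_class[OF f(1)] mem[OF f(1)] by simp_all
  next
    fix f g :: "'x \<Rightarrow> 'k" assume "f \<in> bounded_measurable M" "g \<in> bounded_measurable M"
    then show "\<Lambda> (Linfty_class M (\<lambda>x. f x + g x)) = (\<lambda>x. \<Lambda> (Linfty_class M f) x + \<Lambda> (Linfty_class M g) x)"
      by (simp add: \<Lambda>_class bounded_measurable_add L_add)
  next
    fix a and f :: "'x \<Rightarrow> 'k" assume "f \<in> bounded_measurable M"
    then show "\<Lambda> (Linfty_class M (\<lambda>x. a * f x)) = (\<lambda>x. a * \<Lambda> (Linfty_class M f) x)"
      by (simp add: \<Lambda>_class bounded_measurable_cmult L_cmult)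
  next
    fix f :: "'x \<Rightarrow> 'k" and x
    assume "f \<in> bounded_measurable M" "locally_AE M (\<lambda>x. \<exists>r\<ge>0. f x = of_real r)"
    then show "\<exists>r\<ge>0. \<Lambda> (Linfty_class M f) x = of_real r" using L_pos[of f x] \<Lambda>_class[of f] by simp
  next
    show "\<Lambda> (Linfty_class M (\<lambda>_. 1)) = (\<lambda>_. 1)"
      using L_cont[OF continuous_on_const one_meas] by (simp add: \<Lambda>_class one_meas)
  qed
  moreover have "strong_lifting M \<Lambda>"
    unfolding strong_lifting_def
    using cont_meas L_cont \<Lambda>_class by (simp add: bounded_measurable_def)
  moreover have "equivariant_lifting M act \<Lambda>"
    unfolding equivariant_lifting_def
  proof (intro allI ballI)
    fix s and \<phi> :: "('x \<Rightarrow> 'k) set" assume \<phi>: "\<phi> \<in> Linfty M"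
    then have "\<phi> \<noteq> {}" using LinftyE refl by blast
    then have "(SOME h. h \<in> translate act s ` \<phi>) \<in> translate act s ` \<phi>" by (simp add: some_in_eq)
    then obtain f where f: "f \<in> \<phi>" "(SOME h. h \<in> translate act s ` \<phi>) = translate act s f" by blast
    show "\<Lambda> (translate act s ` \<phi>) = translate act s (\<Lambda> \<phi>)"
      using \<Lambda>_mem[OF \<phi> f(1)] L_translate unfolding \<Lambda>_def[of "translate act s ` \<phi>"] f(2) by simp
  qed
  ultimately show ?thesis by (intro exI[of _ \<Lambda>] conjI)
qed

text \<open>The complex lifting is the complexification of the real one, acting separately on real
  and imaginary parts.\<close>

lemma real_and_complex_lifting:
  fixes M :: "'x::topological_space measure" and act :: "'g::group_add \<Rightarrow> 'x \<Rightarrow> 'x"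
    and L :: "('x \<Rightarrow> real) \<Rightarrow> ('x \<Rightarrow> real)"
  assumes L_meas: "\<And>f. f \<in> bounded_measurable M \<Longrightarrow> L f \<in> bounded_measurable M"
    and L_eq: "\<And>f. f \<in> bounded_measurable M \<Longrightarrow> locally_AE M (\<lambda>x. L f x = f x)"
    and L_add: "\<And>f f'. f \<in> bounded_measurable M \<Longrightarrow> f' \<in> bounded_measurable M \<Longrightarrow>
      L (\<lambda>x. f x + f' x) = (\<lambda>x. L f x + L f' x)"
    and L_cmult: "\<And>f a. f \<in> bounded_measurable M \<Longrightarrow> L (\<lambda>x. a * f x) = (\<lambda>x. a * L f x)"
    and L_nonneg: "\<And>f x. f \<in> bounded_measurable M \<Longrightarrow> (\<And>x. 0 \<le> f x) \<Longrightarrow> 0 \<le> L f x"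
    and L_cong: "\<And>f f'. f \<in> bounded_measurable M \<Longrightarrow> f' \<in> bounded_measurable M \<Longrightarrow>
      locally_AE M (\<lambda>x. f x = f' x) \<Longrightarrow> L f = L f'"
    and open_meas: "\<And>U. open U \<Longrightarrow> U \<in> sets M" and space_M: "space M = UNIV"
    and L_cont: "\<And>f. continuous_on UNIV f \<Longrightarrow> f \<in> bounded_measurable M \<Longrightarrow> L f = f"
    and L_translate: "\<And>f s. f \<in> bounded_measurable M \<Longrightarrow> L (translate act s f) = translate act s (L f)"
  shows "(\<exists>\<Lambda> :: ('x \<Rightarrow> real) set \<Rightarrow> ('x \<Rightarrow> real).
            linear_lifting M \<Lambda> \<and> strong_lifting M \<Lambda> \<and> equivariant_lifting M act \<Lambda>) \<and>
         (\<exists>\<Lambda> :: ('x \<Rightarrow> complex) set \<Rightarrow> ('x \<Rightarrow> complex).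
            linear_lifting M \<Lambda> \<and> strong_lifting M \<Lambda> \<and> equivariant_lifting M act \<Lambda>)"
proof
  have cont_meas: "f \<in> borel_measurable M" if "continuous_on UNIV f" for f :: "'x \<Rightarrow> 'k::real_normed_field"
    by (rule borel_measurableI) (use open_vimage[OF _ that] open_meas space_M in auto)
  \<comment> \<open>Positivity of L is given for everywhere nonnegative functions; the positive part
    of f lies in the same class as f.\<close>
  have L_AE_nonneg: "0 \<le> L f x" if f: "f \<in> bounded_measurable M" and ae: "locally_AE M (\<lambda>x. 0 \<le> f x)" for f x
  proof -
    obtain B where B: "\<forall>x. norm (f x) \<le> B"
      using bounded_measurable_bound(2)[OF f] by (elim exE)
    have m: "(\<lambda>x. max 0 (f x)) \<in> bounded_measurable M"
    proof (rule bounded_measurableI)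
      show "(\<lambda>x. max 0 (f x)) \<in> borel_measurable M"
        using bounded_measurable_bound(1)[OF f] by measurable
      show "norm (max 0 (f x)) \<le> B" for x
        using B[rule_format, of x] by (simp add: max_def abs_le_iff)
    qed
    have "L f = L (\<lambda>x. max 0 (f x))"
      by (rule L_cong[OF f m locally_AE_mono[OF ae]]) simp
    then show ?thesis using L_nonneg[OF m] by simp
  qed
  show "\<exists>\<Lambda> :: ('x \<Rightarrow> real) set \<Rightarrow> ('x \<Rightarrow> real).
            linear_lifting M \<Lambda> \<and> strong_lifting M \<Lambda> \<and> equivariant_lifting M act \<Lambda>"
  proof (rule lifting_of_operator[of M L act, OF L_meas L_eq L_add L_cmult _ L_cong cont_meas L_cont L_translate])
    fix f :: "'x \<Rightarrow> real" and x
    assume f: "f \<in> bounded_measurable M" "locally_AE M (\<lambda>x. \<exists>r\<ge>0. f x = of_real r)"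
    have "0 \<le> L f x" by (rule L_AE_nonneg[OF f(1) locally_AE_mono[OF f(2)]]) auto
    then show "\<exists>r\<ge>0. L f x = of_real r" by auto
  qed
  define C where "C f x = Complex (L (\<lambda>x. Re (f x)) x) (L (\<lambda>x. Im (f x)) x)" for f x
  have ReIm: "(\<lambda>x. Re (f x)) \<in> bounded_measurable M" "(\<lambda>x. Im (f x)) \<in> bounded_measurable M"
    if fb: "f \<in> bounded_measurable M" for f :: "'x \<Rightarrow> complex"
  proof -
    obtain B where B: "\<forall>x. norm (f x) \<le> B"
      using bounded_measurable_bound(2)[OF fb] by (elim exE)
    have f: "f \<in> borel_measurable M" by (rule bounded_measurable_bound(1)[OF fb])
    show "(\<lambda>x. Re (f x)) \<in> bounded_measurable M"
    proof (rule bounded_measurableI)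
      show "(\<lambda>x. Re (f x)) \<in> borel_measurable M" using f by measurable
      show "norm (Re (f x)) \<le> B" for x
        using abs_Re_le_cmod[of "f x"] B[rule_format, of x] by simp
    qed
    show "(\<lambda>x. Im (f x)) \<in> bounded_measurable M"
    proof (rule bounded_measurableI)
      show "(\<lambda>x. Im (f x)) \<in> borel_measurable M" using f by measurable
      show "norm (Im (f x)) \<le> B" for x
        using abs_Im_le_cmod[of "f x"] B[rule_format, of x] by simp
    qed
  qed
  show "\<exists>\<Lambda> :: ('x \<Rightarrow> complex) set \<Rightarrow> ('x \<Rightarrow> complex).
            linear_lifting M \<Lambda> \<and> strong_lifting M \<Lambda> \<and> equivariant_lifting M act \<Lambda>"
  proof (rule lifting_of_operator[of M C act])
    fix f :: "'x \<Rightarrow> complex" assume f: "f \<in> bounded_measurable M"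
    note L1 = L_meas[OF ReIm(1)[OF f]] and L2 = L_meas[OF ReIm(2)[OF f]]
    obtain A B where AB: "\<forall>x. norm (L (\<lambda>x. Re (f x)) x) \<le> A" "\<forall>x. norm (L (\<lambda>x. Im (f x)) x) \<le> B"
      using bounded_measurable_bound(2)[OF L1] bounded_measurable_bound(2)[OF L2] by (elim exE)
    show "C f \<in> bounded_measurable M"
    proof (rule bounded_measurableI)
      have "C f = (\<lambda>x. complex_of_real (L (\<lambda>x. Re (f x)) x) + \<i> * complex_of_real (L (\<lambda>x. Im (f x)) x))"
        by (simp add: fun_eq_iff C_def complex_eq_iff)
      then show "C f \<in> borel_measurable M"
        using bounded_measurable_bound(1)[OF L1] bounded_measurable_bound(1)[OF L2] by simp
      show "norm (C f x) \<le> A + B" for x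
        using AB(1)[rule_format, of x] AB(2)[rule_format, of x] cmod_le[of "C f x"] by (simp add: C_def)
    qed
    show "locally_AE M (\<lambda>x. C f x = f x)"
      by (rule locally_AE_mono[OF locally_AE_conj[OF L_eq[OF ReIm(1)[OF f]] L_eq[OF ReIm(2)[OF f]]]])
         (simp add: C_def complex_eq_iff)
    show "C (translate act s f) = translate act s (C f)" for s
      using L_translate[OF ReIm(1)[OF f], of s] L_translate[OF ReIm(2)[OF f], of s]
      by (simp add: C_def translate_def fun_eq_iff)
    show "C (\<lambda>x. a * f x) = (\<lambda>x. a * C f x)" for a
    proof -
      \<comment> \<open>A complex scalar mixes the two parts by real linear combinations, so complex
        homogeneity reduces to real linearity.\<close>
      have lin: "L (\<lambda>x. p * Re (f x) + q * Im (f x)) = (\<lambda>x. p * L (\<lambda>x. Re (f x)) x + q * L (\<lambda>x. Im (f x)) x)" for p q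
        by (simp add: L_add L_cmult bounded_measurable_cmult ReIm[OF f])
      show ?thesis
        using lin[of "Re a" "- Im a"] lin[of "Im a" "Re a"]
        by (simp add: C_def fun_eq_iff complex_eq_iff add.commute)
    qed
    show "\<exists>r\<ge>0. C f x = of_real r" if ae: "locally_AE M (\<lambda>x. \<exists>r\<ge>0. f x = of_real r)" for x
    proof -
      have "0 \<le> L (\<lambda>x. Re (f x)) x"
        by (rule L_AE_nonneg[OF ReIm(1)[OF f] locally_AE_mono[OF ae]]) auto
      moreover have "0 \<le> L (\<lambda>x. Im (f x)) x"
        by (rule L_AE_nonneg[OF ReIm(2)[OF f] locally_AE_mono[OF ae]]) auto
      \<comment> \<open>The imaginary part vanishes locally almost everywhere and so agrees with its
        negative. Its image under L then equals its own negative, hence is 0.\<close>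
      moreover have "L (\<lambda>x. Im (f x)) = L (\<lambda>x. (- 1) * Im (f x))"
      proof (rule L_cong[OF ReIm(2)[OF f] _ locally_AE_mono[OF ae]])
        show "(\<lambda>x. (- 1) * Im (f x)) \<in> bounded_measurable M"
          by (rule bounded_measurable_cmult[OF ReIm(2)[OF f]])
      qed auto
      then have "L (\<lambda>x. Im (f x)) x = 0" using L_cmult[OF ReIm(2)[OF f], of "- 1"] by (simp add: fun_eq_iff)
      ultimately show ?thesis
        by (intro exI[of _ "L (\<lambda>x. Re (f x)) x"]) (simp add: C_def complex_eq_iff)
    qed
    show "C f = f" if "continuous_on UNIV f"
    proof -
      have "continuous_on UNIV (\<lambda>x. Re (f x))" "continuous_on UNIV (\<lambda>x. Im (f x))"
        using that by (intro continuous_intros; assumption)+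
      then show ?thesis
        using L_cont ReIm[OF f] by (simp add: C_def fun_eq_iff complex_eq_iff)
    qed
    fix f' :: "'x \<Rightarrow> complex" assume f': "f' \<in> bounded_measurable M"
    show "C (\<lambda>x. f x + f' x) = (\<lambda>x. C f x + C f' x)"
      by (simp add: C_def fun_eq_iff complex_eq_iff L_add ReIm f f')
    assume ae: "locally_AE M (\<lambda>x. f x = f' x)"
    have "L (\<lambda>x. Re (f x)) = L (\<lambda>x. Re (f' x))" "L (\<lambda>x. Im (f x)) = L (\<lambda>x. Im (f' x))"
      by (rule L_cong[OF _ _ locally_AE_mono[OF ae]], simp_all add: ReIm f f')+
    then show "C f = C f'" by (simp add: C_def fun_eq_iff)
  next
    fix f :: "'x \<Rightarrow> complex" assume "continuous_on UNIV f"
    then show "f \<in> borel_measurable M" by (rule cont_meas)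
  qed
qed

section \<open>Riemannian measures\<close>

lemma riemannian_sets:
  assumes "riemannian_lebesgue_measure S \<A> \<rho> M"
  shows "E \<in> sets M \<longleftrightarrow> (\<forall>d\<in>\<A>. snd d ` (E \<inter> fst d) \<in> sets (model_measure S))"
proof -
  have "sets M = {E. \<forall>(U, \<phi>)\<in>\<A>. \<phi> ` (E \<inter> U) \<in> sets (model_measure S)}"
    using assms unfolding riemannian_lebesgue_measure_def by (elim conjE)
  then show ?thesis by (simp add: case_prod_beta)
qed

lemma riemannian_emeasure:
  assumes "riemannian_lebesgue_measure S \<A> \<rho> M" "d \<in> \<A>" "E \<in> sets M" "E \<subseteq> fst d"
  shows "emeasure M E =
    (\<integral>\<^sup>+v. ennreal (volume_density S (\<rho> d (inv_into (fst d) (snd d) v))) * indicator (snd d ` E) v \<partial>model_measure S)"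
proof -
  have *: "\<forall>(U, \<phi>)\<in>\<A>. \<forall>E\<in>sets M. E \<subseteq> U \<longrightarrow> emeasure M E =
        (\<integral>\<^sup>+v. ennreal (volume_density S (\<rho> (U, \<phi>) (inv_into U \<phi> v))) * indicator (\<phi> ` E) v \<partial>model_measure S)"
    using assms(1) unfolding riemannian_lebesgue_measure_def by (elim conjE)
  from bspec[OF this assms(2), unfolded case_prod_beta, rule_format, OF assms(3,4)]
  show ?thesis by simp
qed

text \<open>The density sqrt(det \<rho>) is positive throughout the chart, as \<rho> is positive
  definite, so its integral over a set vanishes exactly when the set is Lebesgue null in
  coordinates.\<close>

lemma riemannian_null_iff:
  fixes \<A> :: "('x::t2_space, 'n::finite) chart set" and M :: "'x measure"
  assumes atlas: "C1_atlas UNIV \<A>"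
    and riem: "riemannian_structure UNIV \<A> \<rho>"
    and M: "riemannian_lebesgue_measure UNIV \<A> \<rho> M"
    and d: "d \<in> \<A>" and E: "E \<in> sets M" "E \<subseteq> fst d"
  shows "emeasure M E = 0 \<longleftrightarrow> negligible (snd d ` E)"
proof -
  let ?U = "fst d" and ?\<phi> = "snd d"
  let ?\<psi> = "inv_into ?U ?\<phi>"
  note homeo = C1_atlas_homeomorphism[OF atlas d]
  have nz: "(UNIV :: (real^'n) set) \<noteq> {0}" by (metis UNIV_I singletonD zero_neq_one)
  have r: "\<forall>(U, \<phi>)\<in>\<A>. continuous_on U (\<rho> (U, \<phi>)) \<and>
      (\<forall>x\<in>U. (\<forall>v\<in>UNIV. \<forall>w\<in>UNIV. v \<bullet> (\<rho> (U, \<phi>) x *v w) = w \<bullet> (\<rho> (U, \<phi>) x *v v)) \<and>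
        (\<forall>v\<in>UNIV. v \<noteq> 0 \<longrightarrow> 0 < v \<bullet> (\<rho> (U, \<phi>) x *v v)))"
    using riem unfolding riemannian_structure_def by (rule conjunct1)
  have cont: "continuous_on ?U (\<rho> d)" and pos: "\<And>x v. x \<in> ?U \<Longrightarrow> v \<noteq> 0 \<Longrightarrow> 0 < v \<bullet> (\<rho> d x *v v)"
    using bspec[OF r d] by (simp_all add: case_prod_beta)
  define q where "q v = sqrt (det (\<rho> d (?\<psi> v)))" for v
  have q_pos: "0 < q v" if "v \<in> ?\<phi> ` ?U" for v
  proof -
    have "?\<psi> v \<in> ?U" using inv_into_into[OF that] .
    from det_pos_of_positive_definite[OF pos[OF this]] show ?thesis by (simp add: q_def)
  qed
  have "continuous_on (?\<phi> ` ?U) (\<lambda>v. \<rho> d (?\<psi> v))"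
    by (rule continuous_on_compose2[OF cont homeomorphism_cont2[OF homeo]]) (auto intro: inv_into_into)
  then have cq: "continuous_on (?\<phi> ` ?U) q" unfolding q_def det_def by (intro continuous_intros)
  define k where "k v = indicator (?\<phi> ` ?U) v *\<^sub>R q v" for v
  have k: "k \<in> borel_measurable lebesgue"
  proof (rule measurable_completion)
    have "k \<in> borel_measurable borel"
      unfolding k_def
      by (rule borel_measurable_continuous_on_indicator[OF borel_open[OF C1_atlas_open_image[OF atlas d]] cq])
    then show "k \<in> borel_measurable lborel" by simp
  qed
  have "?\<phi> ` (E \<inter> ?U) \<in> sets lebesgue"
    using E(1) d unfolding riemannian_sets[OF M] model_measure_def by (simp add: nz)
  moreover have "E \<inter> ?U = E" using E(2) by blast
  ultimately have sE: "?\<phi> ` E \<in> sets lebesgue" by simp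
  have "emeasure M E = (\<integral>\<^sup>+v. ennreal (q v) * indicator (?\<phi> ` E) v \<partial>lebesgue)"
    using riemannian_emeasure[OF M d E] by (simp add: q_def model_measure_def volume_density_def nz)
  also have "\<dots> = (\<integral>\<^sup>+v. ennreal (k v) * indicator (?\<phi> ` E) v \<partial>lebesgue)"
    using E(2) by (intro nn_integral_cong) (auto simp: k_def indicator_def)
  finally have "emeasure M E = 0 \<longleftrightarrow> (AE v in lebesgue. ennreal (k v) * indicator (?\<phi> ` E) v = 0)"
    using k sE by (simp add: nn_integral_0_iff_AE)
  also have "\<dots> \<longleftrightarrow> (AE v in lebesgue. v \<notin> ?\<phi> ` E)"
  proof (rule AE_cong)
    fix v
    have "0 < k v" if "v \<in> ?\<phi> ` E" using q_pos[of v] that E(2) by (auto simp: k_def indicator_def)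
    then show "ennreal (k v) * indicator (?\<phi> ` E) v = 0 \<longleftrightarrow> v \<notin> ?\<phi> ` E"
      by (cases "v \<in> ?\<phi> ` E") (auto simp: ennreal_eq_0_iff simp del: image_iff)
  qed
  also have "\<dots> \<longleftrightarrow> negligible (?\<phi> ` E)"
    using AE_iff_null_sets[OF sE] negligible_iff_null_sets by blast
  finally show ?thesis .
qed

text \<open>From compact sets to charts one exhausts a chart domain by countably many compact sets;
  in the other direction a compact set is covered by finitely many chart domains.\<close>

lemma riemannian_locally_AE:
  fixes \<A> :: "('x::t2_space, 'n::finite) chart set" and M :: "'x measure"
  assumes atlas: "C1_atlas UNIV \<A>"
    and riem: "riemannian_structure UNIV \<A> \<rho>"
    and M: "riemannian_lebesgue_measure UNIV \<A> \<rho> M"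
  shows "locally_AE M P \<longleftrightarrow> (\<forall>d\<in>\<A>. negligible (snd d ` {x\<in>fst d. \<not> P x}))"
proof
  have nz: "(UNIV :: (real^'n) set) \<noteq> {0}" by (metis UNIV_I singletonD zero_neq_one)
  have space: "space M = UNIV" using M by (simp add: riemannian_lebesgue_measure_def)
  have sets: "E \<in> sets M \<longleftrightarrow> (\<forall>d\<in>\<A>. snd d ` (E \<inter> fst d) \<in> sets lebesgue)" for E
    using riemannian_sets[OF M, of E] by (simp add: model_measure_def nz)
  have chart_sets: "fst d \<in> sets M" if "d \<in> \<A>" for d
    unfolding sets
  proof
    fix e assume e: "e \<in> \<A>"
    have "openin (top_of_set (fst e)) (fst d \<inter> fst e)"
      using C1_atlas_open[OF atlas that] by (metis Int_commute openin_open_Int)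
    then have "openin (top_of_set (snd e ` fst e)) (snd e ` (fst d \<inter> fst e))"
      by (rule homeomorphism_imp_open_map[OF C1_atlas_homeomorphism[OF atlas e]])
    then have "open (snd e ` (fst d \<inter> fst e))"
      by (rule openin_open_trans[OF _ C1_atlas_open_image[OF atlas e]])
    then show "snd e ` (fst d \<inter> fst e) \<in> sets lebesgue" by (intro sets_completionI_sets) (simp add: borel_open)
  qed
  show "\<forall>d\<in>\<A>. negligible (snd d ` {x\<in>fst d. \<not> P x})" if ae: "locally_AE M P"
  proof
    fix d assume d: "d \<in> \<A>"
    let ?\<psi> = "inv_into (fst d) (snd d)"
    note homeo = C1_atlas_homeomorphism[OF atlas d]
    obtain K :: "nat \<Rightarrow> (real^'n) set" where "(\<forall>n. compact (K n) \<and> K n \<subseteq> snd d ` fst d) \<and> incseq K \<and>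
        \<Union>(range K) = snd d ` fst d"
      using open_eq_Union_compacts[OF C1_atlas_open_image[OF atlas d]] by (rule exE)
    then have K: "\<And>n. compact (K n)" "\<And>n. K n \<subseteq> snd d ` fst d" "\<Union>(range K) = snd d ` fst d" by simp_all
    have "\<exists>N. N \<in> sets M \<and> emeasure M N = 0 \<and> {x. \<not> (x \<in> ?\<psi> ` K n \<longrightarrow> P x)} \<subseteq> N" for n
    proof -
      have "compact (?\<psi> ` K n)"
        by (rule compact_continuous_image[OF continuous_on_subset[OF homeomorphism_cont2[OF homeo] K(2)] K(1)])
      then have "AE x in M. x \<in> ?\<psi> ` K n \<longrightarrow> P x" using ae by (simp add: locally_AE_def)
      then obtain N where "{x \<in> space M. \<not> (x \<in> ?\<psi> ` K n \<longrightarrow> P x)} \<subseteq> N" "emeasure M N = 0" "N \<in> sets M"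
        by (rule AE_E)
      then show ?thesis unfolding space by (intro exI[of _ N]) simp
    qed
    then obtain N where N: "\<And>n. N n \<in> sets M" "\<And>n. emeasure M (N n) = 0"
        "\<And>n. {x. \<not> (x \<in> ?\<psi> ` K n \<longrightarrow> P x)} \<subseteq> N n"
      by metis
    have "negligible (snd d ` (N n \<inter> fst d))" for n
    proof -
      have s: "N n \<inter> fst d \<in> sets M" using N(1) chart_sets[OF d] by (rule sets.Int)
      have "emeasure M (N n \<inter> fst d) \<le> emeasure M (N n)" by (rule emeasure_mono) (use N(1) in auto)
      then have "emeasure M (N n \<inter> fst d) = 0" using N(2) by simp
      then show ?thesis using riemannian_null_iff[OF atlas riem M d s] by simp
    qed
    then have "negligible (\<Union>n. snd d ` (N n \<inter> fst d))"
      by (intro negligible_countable_Union) auto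
    moreover have "snd d ` {x\<in>fst d. \<not> P x} \<subseteq> (\<Union>n. snd d ` (N n \<inter> fst d))"
    proof
      fix w assume "w \<in> snd d ` {x\<in>fst d. \<not> P x}"
      then obtain x where x: "x \<in> fst d" "\<not> P x" "w = snd d x" by blast
      then have "w \<in> \<Union>(range K)" unfolding K(3) by simp
      then obtain n where "w \<in> K n" by blast
      moreover have "?\<psi> w = x" using homeomorphism_apply1[OF homeo x(1)] x(3) by simp
      ultimately have "x \<in> ?\<psi> ` K n" by blast
      then have "x \<in> N n" using N(3)[of n] x(2) by blast
      then show "w \<in> (\<Union>n. snd d ` (N n \<inter> fst d))" using x by blast
    qed
    ultimately show "negligible (snd d ` {x\<in>fst d. \<not> P x})" by (rule negligible_subset)
  qed
  show "locally_AE M P" if neg: "\<forall>d\<in>\<A>. negligible (snd d ` {x\<in>fst d. \<not> P x})"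
    unfolding locally_AE_def
  proof (intro allI impI)
    fix K :: "'x set" assume "compact K"
    have null: "{x\<in>fst d. \<not> P x} \<in> null_sets M" if d: "d \<in> \<A>" for d
    proof -
      \<comment> \<open>Measurability comes from completeness: the trace of the set in every chart
        is contained in a negligible set.\<close>
      have "{x\<in>fst d. \<not> P x} \<in> sets M"
        unfolding sets
      proof
        fix e assume "e \<in> \<A>"
        then have "negligible (snd e ` {x\<in>fst e. \<not> P x})" using neg by blast
        then have "negligible (snd e ` ({x\<in>fst d. \<not> P x} \<inter> fst e))" by (rule negligible_subset) blast
        then show "snd e ` ({x\<in>fst d. \<not> P x} \<inter> fst e) \<in> sets lebesgue" by (rule negligible_imp_sets)
      qed
      moreover from riemannian_null_iff[OF atlas riem M d this] have "emeasure M {x\<in>fst d. \<not> P x} = 0"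
        using neg d by auto
      ultimately show ?thesis by (rule null_setsI[rotated])
    qed
    have "K \<subseteq> (\<Union>d\<in>\<A>. fst d)" using C1_atlas_cover[OF atlas] by simp
    from compactE_image[OF \<open>compact K\<close> C1_atlas_open[OF atlas] this]
    have "\<exists>D. D \<subseteq> \<A> \<and> finite D \<and> K \<subseteq> (\<Union>d\<in>D. fst d)" by metis
    then obtain D where D: "D \<subseteq> \<A>" "finite D" "K \<subseteq> (\<Union>d\<in>D. fst d)"
      by (elim exE conjE)
    have "(\<Union>d\<in>D. {x\<in>fst d. \<not> P x}) \<in> null_sets M"
      using D(1,2) null by (intro null_sets.finite_UN) auto
    then show "AE x in M. x \<in> K \<longrightarrow> P x"
      by (rule AE_I') (use D(3) in blast)
  qed
qed

text \<open>Haar invariance is given for images of sets, while integration uses preimages; the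
  preimage under s is the image under - s.\<close>

lemma haar_translate_invariant:
  fixes haar :: "'g::{topological_group_add,t2_space} measure"
  assumes "left_haar_measure haar"
  shows "distr haar haar ((+) s) = haar"
proof (rule measure_eqI)
  have sets: "sets haar = sets borel"
    and inv: "\<And>g A. A \<in> sets borel \<Longrightarrow> emeasure haar ((+) g ` A) = emeasure haar A"
    using assms by (simp_all add: left_haar_measure_def)
  have space: "space haar = UNIV" using sets_eq_imp_space_eq[OF sets] by simp
  have "continuous_on UNIV ((+) s :: 'g \<Rightarrow> 'g)"
    by (intro continuous_on_add continuous_on_const continuous_on_id)
  then have "(+) s \<in> borel_measurable borel" by (rule borel_measurable_continuous_onI)
  then have meas: "(+) s \<in> haar \<rightarrow>\<^sub>M haar" using measurable_cong_sets[OF sets sets] by blast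
  fix A assume "A \<in> sets (distr haar haar ((+) s))"
  then have A: "A \<in> sets haar" by simp
  have "(+) s -` A = (+) (- s) ` A"
    by (auto simp: image_iff add.assoc[symmetric] intro!: bexI[of _ "s + _"])
  then have "emeasure haar ((+) s -` A) = emeasure haar A" using inv A sets by simp
  then show "emeasure (distr haar haar ((+) s)) A = emeasure haar A"
    using emeasure_distr[OF meas A] by (simp add: space)
qed simp

text \<open>All charts map into {0}, so every single point has measure 1 and no non-empty set is
  locally null.\<close>

lemma zero_dimensional_locally_AE:
  fixes \<A> :: "('x::t2_space, 'n::finite) chart set" and M :: "'x measure"
  assumes atlas: "C1_atlas {0} \<A>" and M: "riemannian_lebesgue_measure {0} \<A> \<rho> M"
  shows "sets M = UNIV" "locally_AE M P \<Longrightarrow> P x"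
proof -
  have a: "(\<Union>(U, \<phi>)\<in>\<A>. U) = UNIV \<and>
    (\<forall>(U, \<phi>)\<in>\<A>. open U \<and> openin (top_of_set {0}) (\<phi> ` U) \<and> homeomorphism U (\<phi> ` U) \<phi> (inv_into U \<phi>)) \<and>
    (\<forall>(U, \<phi>)\<in>\<A>. \<forall>(V, \<psi>)\<in>\<A>. C1_on {0} (\<phi> ` (U \<inter> V)) (\<psi> \<circ> inv_into U \<phi>))"
    using atlas unfolding C1_atlas_def .
  have zero: "snd d ` fst d \<subseteq> {0}" if "d \<in> \<A>" for d
  proof -
    have "openin (top_of_set {0}) (snd d ` fst d)"
      using bspec[OF a[THEN conjunct2, THEN conjunct1] that] by (simp add: case_prod_beta)
    then show ?thesis by (rule openin_imp_subset)
  qed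
  show sets: "sets M = UNIV"
  proof -
    have "E \<in> sets M" for E
      unfolding riemannian_sets[OF M] using zero by (auto simp: model_measure_def)
    then show ?thesis by blast
  qed
  have space: "space M = UNIV" using M by (simp add: riemannian_lebesgue_measure_def)
  have "x \<in> (\<Union>(U, \<phi>)\<in>\<A>. U)" unfolding a[THEN conjunct1] by simp
  then obtain d where d: "d \<in> \<A>" "x \<in> fst d" by auto
  have "snd d x = 0" using zero[OF d(1)] d(2) by blast
  have "{x} \<in> sets M" using sets by simp
  from riemannian_emeasure[OF M d(1) this]
  have "emeasure M {x} = (\<integral>\<^sup>+v. indicator {0} v \<partial>count_space {0::real^'n})"
    using d(2) \<open>snd d x = 0\<close> by (simp add: volume_density_def model_measure_def)
  then have pos: "emeasure M {x} \<noteq> 0" by (simp add: nn_integral_count_space_finite)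
  assume "locally_AE M P"
  then have "AE y in M. y \<in> {x} \<longrightarrow> P y"
    unfolding locally_AE_def by (elim allE[of _ "{x}"]) (erule mp, simp)
  then obtain N where N: "{y \<in> space M. \<not> (y \<in> {x} \<longrightarrow> P y)} \<subseteq> N" "emeasure M N = 0" "N \<in> sets M"
    by (rule AE_E)
  show "P x"
  proof (rule ccontr)
    assume "\<not> P x"
    then have "{x} \<subseteq> N" using N(1) space by auto
    then have "emeasure M {x} \<le> emeasure M N" using N(3) by (rule emeasure_mono)
    with N(2) pos show False by simp
  qed
qed

theorem theorem1:
  fixes act :: "'g::{topological_group_add,t2_space} \<Rightarrow> 'x::t2_space \<Rightarrow> 'x"
    and haar :: "'g measure"
    and S :: "(real^'n::finite) set"
    and \<A> :: "('x, 'n) chart set"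
    and \<rho> :: "('x, 'n) chart \<Rightarrow> 'x \<Rightarrow> real^'n^'n"
    and M :: "'x measure"
  assumes "locally_compact_space (euclidean :: 'g topology)"
    and "left_haar_measure haar"
    and "differentiable_manifold S \<A>"
    and "riemannian_structure S \<A> \<rho>"
    and "riemannian_lebesgue_measure S \<A> \<rho> M"
    and "C1_continuous_action S \<A> act"
    and "amenable_action TYPE('i) haar act"
  shows "(\<exists>\<Lambda> :: ('x \<Rightarrow> real) set \<Rightarrow> ('x \<Rightarrow> real).
            linear_lifting M \<Lambda> \<and> strong_lifting M \<Lambda> \<and> equivariant_lifting M act \<Lambda>) \<and>
         (\<exists>\<Lambda> :: ('x \<Rightarrow> complex) set \<Rightarrow> ('x \<Rightarrow> complex).
            linear_lifting M \<Lambda> \<and> strong_lifting M \<Lambda> \<and> equivariant_lifting M act \<Lambda>)"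
proof -
  have S: "S = UNIV \<or> S = {0}" and para: "paracompact_type TYPE('x)" and atlas: "C1_atlas S \<A>"
    using assms(3) by (simp_all add: differentiable_manifold_def)
  have space: "space M = UNIV" using assms(5) by (simp add: riemannian_lebesgue_measure_def)
  show ?thesis
  proof (cases "S = {0}")
    case True
    note z = zero_dimensional_locally_AE[OF atlas[unfolded True] assms(5)[unfolded True]]
    \<comment> \<open>In dimension 0 each class consists of one function, and the identity is a
      lifting.\<close>
    show ?thesis
      by (rule real_and_complex_lifting[of M "\<lambda>f. f"])
         (use z space in \<open>auto simp: fun_eq_iff locally_AE_def\<close>)
  next
    case False
    then have S: "S = UNIV" using S by simp
    have nz: "(UNIV :: (real^'n) set) \<noteq> {0}" using False S by simp
    interpret charted_action \<A> act M
    proof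
      show "C1_atlas UNIV \<A>" using atlas S by simp
      show "C1_continuous_action UNIV \<A> act" using assms(6) S by simp
      show "space M = UNIV" by (rule space)
      show "E \<in> sets M \<longleftrightarrow> (\<forall>d\<in>\<A>. snd d ` (E \<inter> fst d) \<in> sets lebesgue)" for E
        using riemannian_sets[OF assms(5), of E] S nz by (simp add: model_measure_def)
      show "locally_AE M P \<longleftrightarrow> (\<forall>d\<in>\<A>. negligible (snd d ` {x\<in>fst d. \<not> P x}))" for P
        by (rule riemannian_locally_AE) (use atlas assms(4,5) S in auto)
    qed
    obtain F :: "'i filter" and m :: "'i \<Rightarrow> 'g \<times> 'x \<Rightarrow> real" where Fm: "F \<noteq> bot \<and>
      (\<forall>i. continuous_on UNIV (m i) \<and> (\<forall>p. 0 \<le> m i p)) \<and>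
      (\<forall>i x. has_bochner_integral haar (\<lambda>g. m i (g, x)) 1) \<and>
      (\<forall>K. compact K \<longrightarrow>
        uniform_limit K
          (\<lambda>i (s, x). LINT g|haar. \<bar>m i (s + g, act s x) - m i (g, x)\<bar>) (\<lambda>_. 0) F)"
      using assms(7) unfolding amenable_action_def by (elim exE)
    then have "F \<noteq> bot" by (rule conjunct1)
    have m: "0 \<le> m i p" "has_bochner_integral haar (\<lambda>g. m i (g, x)) 1" for i p x
      using Fm[THEN conjunct2, THEN conjunct1] Fm[THEN conjunct2, THEN conjunct2, THEN conjunct1] by blast+
    \<comment> \<open>A single pair is a compact set, so amenability gives convergence at each (s,
      x).\<close>
    have unif: "uniform_limit {(s, x)} (\<lambda>i (s, x). LINT g|haar. \<bar>m i (s + g, act s x) - m i (g, x)\<bar>) (\<lambda>_. 0) F" for s x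
      using Fm by (elim conjE) (simp only: compact_insert compact_empty)
    show ?thesis
    proof (rule chart_selection[OF para atlas[unfolded S], where 'g='g])
      fix c :: "'x \<Rightarrow> ('x, 'n) chart"
      assume c: "\<And>x. c x \<in> \<A>" "\<And>x. x \<in> fst (c x)" "\<And>x. \<exists>V. open V \<and> x \<in> V \<and> finite (c ` V)"
        "\<And>(p :: 'g \<Rightarrow> 'x) P. continuous_on UNIV p \<Longrightarrow> (\<And>d. open (P d)) \<Longrightarrow> {g. g \<in> P (c (p g))} \<in> sets borel"
      show ?thesis
      \<comment> \<open>Two functionals are fixed: one for radii 1 / (k + 1) with k tending to
        infinity, one for the filter of the net.\<close>
      proof (rule exists_limit_functional[OF sequentially_bot], rule exists_limit_functional[OF \<open>F \<noteq> bot\<close>], goal_cases)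
        case (1 \<Lambda>1 \<Lambda>2)
        interpret amenable_chart_choice \<A> act M c haar F m \<Lambda>1 \<Lambda>2
        proof
          show "sets haar = sets borel" using assms(2) by (simp add: left_haar_measure_def)
          show "distr haar haar ((+) s) = haar" for s by (rule haar_translate_invariant[OF assms(2)])
          show "0 \<le> m i p" "has_bochner_integral haar (\<lambda>g. m i (g, x)) 1" for i p x by (rule m)+
          show "((\<lambda>i. LINT g|haar. \<bar>m i (s + g, act s x) - m i (g, x)\<bar>) \<longlongrightarrow> 0) F" for s x
            using tendsto_uniform_limitI[OF unif[of s x], of "(s, x)"] by simp
        qed (fact c 1)+
        show ?case
          by (rule real_and_complex_lifting[of M lift act])
             (fact lift_bounded_measurable lift_locally_AE_eq lift_nonneg lift_cong open_sets_M space_M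
                lift_continuous lift_translate | rule ext, fact lift_add lift_cmult)+
      qed
    qed
  qed
qed

end
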